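(* Let $n\in\mathbb N$ and let $C,C'\in\mathcal C^n$ be multiplication rules. If the associators of $OH^n_C$ and $OH^n_{C'}$ are the same, then there is an isomorphism of graded rings $$OH^n_C\simeq OH^n_{C'}.$$
   Context: **Diagrams.** $B^n$ is the set of crossingless matchings of the $2n$ points $\{1,\dots,2n\}$ on a line: partitions of the points into $n$ pairs (arcs) which can be drawn as $n$ pairwise disjoint half-circles on one side of the line (arcs may be nested). $W$ denotes reflection in the line. For $a,b\in B^n$, $W(b)a$ is the collection of disjoint circles in the plane obtained by gluing the reflection of $b$ to $a$ along the $2n$ points; its circles correspond to the connected components of the graph on $\{1,\dots,2n\}$ whose edges are the arcs of $a$ and of $b$. $|W(b)a|$ is the number of circles. **The group $OH^n$.** For a collection of circles $S$, $V(S)$ is the free abelian group on the circles of $S$. Put $b(OH^n)a:=\bigwedge^*V(W(b)a)$ (exterior algebra over $\mathbb Z$), graded so that a wedge of $k$ circles has degree $2k+n-|W(b)a|$. Let ${}_b1_a$ be the unit of this exterior algebra and $1_a:={}_a1_a$. Set $OH^n:=\bigoplus_{a,b\in B^n}b(OH^n)a$. **Multiplication rules.** A multiplication rule $C$ consists, for each triple $(c,b,a)\in (B^n)^3$, of (i) a total order on the points $\{1,\dots,2n\}$ such that whenever $i,j$ are joined by an arc of $b$ and $k$ lies strictly between $i$ and $j$ (in the usual order), then $i$ or $j$ precedes $k$ in the order of the rule; and (ii) an orientation $i\to j$ or $j\to i$ of each arc $\{i,j\}$ of $b$. $\mathcal C^n$ is the set of all multiplication rules. **Multiplication.** $OH^n_C$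 is $OH^n$ with the following multiplication. If $c\neq b$ the product of an element of $d(OH^n)c$ with an element of $b(OH^n)a$ is $0$. For $x\in c(OH^n)b$, $y\in b(OH^n)a$, place $W(c)b$ above $W(b)a$; this gives a collection of circles $D_0$ and the element $x\wedge y\in\bigwedge^*V(D_0)$ (using $V(D_0)=V(W(c)b)\oplus V(W(b)a)$). Go through the points in the order given by $C$ for $(c,b,a)$; each time an arc $\{i,j\}$ of $b$ is met for the first time, do a surgery: delete the copy of this arc in $W(c)b$ and its mirror copy in $W(b)a$, and join the upper point $i$ to the lower point $i$ and the upper point $j$ to the lower point $j$ by vertical segments. Each surgery either merges two circles into one or splits one circle into two. To a merge $S_1\to S_2$ of $a_1,a_2$ into $b_1$ associate the map $\bigwedge^*V(S_1)\to\bigwedge^*V(S_2)$ induced by $a_1,a_2\mapsto b_1$ and the identity on the other circles. To a split $S_1\to S_2$ of a circle $e$ into the circle $e_i$ through point $i$ and the circle $e_j$ through point $j$, with orientation $i\to j$ of the arc, associate the map $x\mapsto (e_i-e_j)\wedge x'$, where $x'$ is obtained from $x$ by replacing $e$ by $e_i$ (equivalently by $e_j$). After all $n$ surgeries one obtains $W(c)a$, and $xy\in c(OH^n)a$ is the image of $x\wedge y$ under the composite of these maps. $OH^n_C$ is a graded unital, in general non-associative, ring with unit $\sum_a 1_a$. **Associator.** A homogeneous element $x\in b(OH^n_C)a$ has the bidegree $|x|=(\deg x, W(b)a)$. The associator of $OH^n_C$ is the sign function $\phi^C$ of triples of bidegrees, $\phi^C(|x|,|y|,|z|)\in\{-1,1\}$,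 such that $(xy)z=\phi^C(|x|,|y|,|z|)\,x(yz)$ in $OH^n_C$ for all homogeneous $x\in d(OH^n_C)c$, $y\in c(OH^n_C)b$, $z\in b(OH^n_C)a$ and all $a,b,c,d\in B^n$. That the associators of $OH^n_C$ and $OH^n_{C'}$ are the same means that $\phi^C=\phi^{C'}$, i.e. one and the same sign function satisfies this identity for the multiplications of both rings. *)

theory Defs
  imports
    "HOL-Algebra.QuotRing"
    "HOL-Library.Poly_Mapping"
    "HOL-Library.Disjoint_Sets"
    "HOL-Combinatorics.Multiset_Permutations"
begin

section \<open>Crossingless matchings and circles\<close>

type_synonym matching = "nat set set"

definition crossingless_matchings :: "nat \<Rightarrow> matching set" where
  "crossingless_matchings n =
     {a. partition_on {1..2 * n} a \<and> (\<forall>A\<in>a. card A = 2) \<and>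
         (\<forall>i j k l. {i, k} \<in> a \<and> {j, l} \<in> a \<longrightarrow> \<not> (i < j \<and> j < k \<and> k < l))}"

text \<open>
  A collection of circles is given by a graph in which every vertex lies on an edge. A circle is
  a connected component of the graph, represented by its set of vertices.
\<close>

definition circle_of :: "nat set set \<Rightarrow> nat \<Rightarrow> nat set" where
  "circle_of E v = {w. (v, w) \<in> {(x, y). {x, y} \<in> E}\<^sup>*}"

definition circles :: "nat set set \<Rightarrow> nat set set" where
  "circles E = circle_of E ` \<Union>E"

text \<open>The circles of \<open>W(b)a\<close>.\<close>

definition glue :: "matching \<Rightarrow> matching \<Rightarrow> nat set set" where
  "glue b a = circles (b \<union> a)"

section \<open>The exterior algebra on a collection of circles\<close>

text \<open>
  The exterior algebra on the free abelian group with finite basis \<open>S\<close> is the free abelian group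
  on the subsets of \<open>S\<close>: a subset stands for the wedge of its elements in increasing order. Circles
  are ordered by their least vertices; this is a total order on every collection of pairwise
  disjoint circles, and only such collections occur below.
\<close>

type_synonym exterior = "nat set set \<Rightarrow>\<^sub>0 int"

definition exterior_algebra :: "nat set set \<Rightarrow> exterior set" where
  "exterior_algebra S = {x. Poly_Mapping.keys x \<subseteq> Pow S}"

definition inversions :: "nat set list \<Rightarrow> nat" where
  "inversions cs = card {(p, q). p < q \<and> q < length cs \<and> Min (cs ! q) < Min (cs ! p)}"

text \<open>The element \<open>c\<^sub>1 \<and> \<dots> \<and> c\<^sub>k\<close> for an arbitrary list of circles.\<close>

definition wedge_list :: "nat set list \<Rightarrow> exterior" where
  "wedge_list cs = (if distinct cs then frag_cmul ((- 1) ^ inversions cs) (frag_of (set cs)) else 0)"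

definition increasing_list :: "nat set set \<Rightarrow> nat set list" where
  "increasing_list A = sorted_key_list_of_set Min A"

definition wedge :: "exterior \<Rightarrow> exterior \<Rightarrow> exterior" where
  "wedge x y = frag_extend (\<lambda>A. frag_extend (\<lambda>B. wedge_list (increasing_list A @ increasing_list B)) y) x"

text \<open>The homomorphism of exterior algebras induced by a map \<open>f\<close> of circles.\<close>

definition exterior_map :: "(nat set \<Rightarrow> nat set) \<Rightarrow> exterior \<Rightarrow> exterior" where
  "exterior_map f = frag_extend (\<lambda>A. wedge_list (map f (increasing_list A)))"

section \<open>Multiplication rules\<close>

definition precedes :: "nat list \<Rightarrow> nat \<Rightarrow> nat \<Rightarrow> bool" where
  "precedes ps i j \<longleftrightarrow> (\<exists>p q. p < q \<and> q < length ps \<and> ps ! p = i \<and> ps ! q = j)"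

text \<open>
  A rule assigns to \<open>(c, b, a)\<close> a total order on the points, written as the list of the points in
  this order, and an orientation of the arcs of \<open>b\<close>, written as a set of ordered pairs: \<open>(i, j)\<close>
  stands for \<open>i \<rightarrow> j\<close>.
\<close>

type_synonym rule = "matching \<Rightarrow> matching \<Rightarrow> matching \<Rightarrow> nat list \<times> (nat \<times> nat) set"

definition admissible_order :: "nat \<Rightarrow> matching \<Rightarrow> nat list \<Rightarrow> bool" where
  "admissible_order n b ps \<longleftrightarrow>
     ps \<in> permutations_of_set {1..2 * n} \<and>
     (\<forall>i j k. {i, j} \<in> b \<and> i < k \<and> k < j \<longrightarrow> precedes ps i k \<or> precedes ps j k)"

definition orientation :: "matching \<Rightarrow> (nat \<times> nat) set \<Rightarrow> bool" where
  "orientation b R \<longleftrightarrow> bij_betw (\<lambda>(i, j). {i, j}) R b"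

definition multiplication_rules :: "nat \<Rightarrow> rule set" where
  "multiplication_rules n =
     {C. \<forall>c\<in>crossingless_matchings n. \<forall>b\<in>crossingless_matchings n. \<forall>a\<in>crossingless_matchings n.
           admissible_order n b (fst (C c b a)) \<and> orientation b (snd (C c b a))}"

section \<open>Surgeries\<close>

text \<open>
  The vertices of the diagrams between \<open>W(c)b\<close> above \<open>W(b)a\<close> and \<open>W(c)a\<close> are two copies,
  \<open>upper i\<close> and \<open>lower i\<close>, of every point \<open>i\<close>.
\<close>

definition upper :: "nat \<Rightarrow> nat" where "upper i = 2 * i"
definition lower :: "nat \<Rightarrow> nat" where "lower i = 2 * i + 1"
definition point :: "nat \<Rightarrow> nat" where "point v = v div 2"

text \<open>The diagram in which the surgeries along the set \<open>T\<close> of arcs of \<open>b\<close> have been done.\<close>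

definition diagram :: "matching \<Rightarrow> matching \<Rightarrow> matching \<Rightarrow> nat set set \<Rightarrow> nat set set" where
  "diagram c b a T =
     (\<lambda>A. upper ` A) ` (c \<union> (b - T)) \<union> (\<lambda>A. lower ` A) ` ((b - T) \<union> a) \<union>
     (\<lambda>i. {upper i, lower i}) ` \<Union>T"

text \<open>
  The map of the surgery along the arc \<open>i \<rightarrow> j\<close>, after the surgeries along \<open>T\<close>. It is a merge if
  the two copies of the arc lie on different circles, and a split otherwise.
\<close>

definition surgery :: "matching \<Rightarrow> matching \<Rightarrow> matching \<Rightarrow> nat set set \<Rightarrow> nat \<Rightarrow> nat \<Rightarrow> exterior \<Rightarrow> exterior" where
  "surgery c b a T i j x =
     (let old = circle_of (diagram c b a T); new = circle_of (diagram c b a (insert {i, j} T)) in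
      if old (upper i) \<noteq> old (lower i)
      then exterior_map (\<lambda>s. if s = old (upper i) \<or> s = old (lower i) then new (upper i) else s) x
      else wedge (frag_of {new (upper i)} - frag_of {new (upper j)})
             (exterior_map (\<lambda>s. if s = old (upper i) then new (upper i) else s) x))"

definition oriented_arc :: "(nat \<times> nat) set \<Rightarrow> nat \<Rightarrow> nat \<times> nat" where
  "oriented_arc R p = (THE e. e \<in> R \<and> (fst e = p \<or> snd e = p))"

fun surgeries :: "matching \<Rightarrow> matching \<Rightarrow> matching \<Rightarrow> (nat \<times> nat) set \<Rightarrow> nat set set \<Rightarrow> nat list \<Rightarrow> exterior \<Rightarrow> exterior"
where
  "surgeries c b a R T [] x = x"
| "surgeries c b a R T (p # ps) x =
     (let (i, j) = oriented_arc R p in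
      if {i, j} \<in> T then surgeries c b a R T ps x
      else surgeries c b a R (insert {i, j} T) ps (surgery c b a T i j x))"

text \<open>
  The first two maps embed the exterior algebras of \<open>W(c)b\<close> and \<open>W(b)a\<close> in that of the stacked
  diagram; the last one identifies the final diagram, whose vertices \<open>upper i\<close> and \<open>lower i\<close> are
  joined for all \<open>i\<close>, with \<open>W(c)a\<close>.
\<close>

definition component_mult :: "rule \<Rightarrow> matching \<Rightarrow> matching \<Rightarrow> matching \<Rightarrow> exterior \<Rightarrow> exterior \<Rightarrow> exterior" where
  "component_mult C c b a x y =
     exterior_map ((`) point)
       (surgeries c b a (snd (C c b a)) {} (fst (C c b a))
         (wedge (exterior_map ((`) upper) x) (exterior_map ((`) lower) y)))"

section \<open>The ring\<close>

text \<open>The component of \<open>x\<close> in \<open>b(OH\<^sup>n)a\<close> is \<open>x b a\<close>.\<close>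

type_synonym oh = "matching \<Rightarrow> matching \<Rightarrow> exterior"

definition OH_carrier :: "nat \<Rightarrow> oh set" where
  "OH_carrier n =
     {x. \<forall>b a. if b \<in> crossingless_matchings n \<and> a \<in> crossingless_matchings n
               then x b a \<in> exterior_algebra (glue b a) else x b a = 0}"

definition OH :: "nat \<Rightarrow> rule \<Rightarrow> oh ring" where
  "OH n C =
     \<lparr>carrier = OH_carrier n,
      monoid.mult = (\<lambda>x y c a. \<Sum>b\<in>crossingless_matchings n. component_mult C c b a (x c b) (y b a)),
      one = (\<lambda>b a. if b = a \<and> a \<in> crossingless_matchings n then frag_of {} else 0),
      zero = (\<lambda>b a. 0),
      add = (\<lambda>x y b a. x b a + y b a)\<rparr>"

definition monomial_degree :: "nat \<Rightarrow> matching \<Rightarrow> matching \<Rightarrow> nat set set \<Rightarrow> int" where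
  "monomial_degree n b a A = 2 * int (card A) + int n - int (card (glue b a))"

definition OH_degree :: "nat \<Rightarrow> int \<Rightarrow> oh set" where
  "OH_degree n k =
     {x \<in> OH_carrier n. \<forall>b a. \<forall>A\<in>Poly_Mapping.keys (x b a). monomial_degree n b a A = k}"

definition OH_component :: "nat \<Rightarrow> matching \<Rightarrow> matching \<Rightarrow> oh set" where
  "OH_component n b a = {x \<in> OH_carrier n. \<forall>b' a'. (b', a') \<noteq> (b, a) \<longrightarrow> x b' a' = 0}"

text \<open>
  The diagram \<open>W(b)a\<close> in the plane determines \<open>b\<close> and \<open>a\<close> (its set of circles, as sets of points,
  does not), and in a bidegree it is recorded as the pair \<open>(b, a)\<close>.
\<close>

type_synonym bidegree = "int \<times> matching \<times> matching"

definition is_associator ::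
  "nat \<Rightarrow> rule \<Rightarrow> (bidegree \<Rightarrow> bidegree \<Rightarrow> bidegree \<Rightarrow> int) \<Rightarrow> bool" where
  "is_associator n C \<phi> \<longleftrightarrow>
     (\<forall>u v w. \<phi> u v w \<in> {-1, 1}) \<and>
     (\<forall>a\<in>crossingless_matchings n. \<forall>b\<in>crossingless_matchings n.
      \<forall>c\<in>crossingless_matchings n. \<forall>d\<in>crossingless_matchings n. \<forall>k l m.
      \<forall>x\<in>OH_component n d c \<inter> OH_degree n k.
      \<forall>y\<in>OH_component n c b \<inter> OH_degree n l.
      \<forall>z\<in>OH_component n b a \<inter> OH_degree n m.
        (x \<otimes>\<^bsub>OH n C\<^esub> y) \<otimes>\<^bsub>OH n C\<^esub> z =
        (\<lambda>b' a'. frag_cmul (\<phi> (k, d, c) (l, c, b) (m, b, a))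
                   ((x \<otimes>\<^bsub>OH n C\<^esub> (y \<otimes>\<^bsub>OH n C\<^esub> z)) b' a')))"

text \<open>
  \<^const>\<open>ring_iso\<close> is the set of unital ring isomorphisms; its definition does not presuppose
  associativity.
\<close>

definition graded_ring_iso :: "nat \<Rightarrow> rule \<Rightarrow> rule \<Rightarrow> (oh \<Rightarrow> oh) set" where
  "graded_ring_iso n C C' =
     {h \<in> ring_iso (OH n C) (OH n C'). \<forall>k. h ` OH_degree n k = OH_degree n k}"

end

theory Submission
  imports Defs
begin

text \<open>
  Composing the surgeries, a product of two components is \<open>x, y \<mapsto> \<omega> \<and> f(x \<and> y)\<close>, where \<open>f\<close> is
  induced by the cobordism and \<open>\<omega>\<close> is a wedge of differences of circles. If a component of the
  cobordism has positive genus then \<open>\<omega> = 0\<close>; otherwise \<open>\<omega>\<close> generates the top exterior power of the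
  lattice spanned by the differences of outgoing circles in one component of the cobordism. Hence
  two rules give products that differ by a sign \<open>\<tau>(c, b, a)\<close> whenever they do not vanish. Equal
  associators make \<open>\<tau>\<close> a cocycle, but only on those \<open>(d, c, b, a)\<close> for which the total cobordism has
  genus zero, so \<open>\<tau>\<close> need not be a coboundary. It is determined by the
  values \<open>\<tau>(x, y, x)\<close> where \<open>x\<close> and \<open>y\<close> differ by one exchange of arcs, and by transport around squares
  of exchanges there are only two such values: one for the exchanges inside black regions of the
  chequered plane, one for those inside white regions. Both signs can be corrected by automorphisms
  of the exterior algebras that act on the differences of circles adjacent to a black or a white
  region by a sign each, and these automorphisms are the isomorphism.
\<close>

section \<open>Exterior algebras\<close>

text \<open>The correction is made before the signs are analysed: \<open>\<rho>\<close> compares the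
  twisted product of one rule with the product of the other. It is again a sign, obeys the cocycle
  relation wherever a triple product of units is nonzero, and rigidity asks only that it be 1 on one
  move in each direction. Three facts make this work. A product commutes up to sign with
  multiplication by circles, so it is determined by its value at the units, and the associator is
  evaluated at units only, whose bidegrees do not depend on the rule. That value, when nonzero,
  generates the elements of its degree that are annihilated by the differences of circles along the
  arcs of \<open>b\<close>; a map that preserves both properties can only scale it. Finally, the
  twist is written in terms of consecutive points of the line and not of circles, so one formula
  serves all components and passes through every product. On the move from \<open>std n\<close> to
  \<open>tau n 0 1\<close> and on its reverse the twist factors are
  \<open>\<epsilon> * \<delta> ^ 2\<close> and \<open>\<epsilon> * \<delta>\<close>, which fixes
  both parameters.\<close>

definition lin :: "(exterior \<Rightarrow> exterior) \<Rightarrow> bool" where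
  "lin G \<longleftrightarrow> (\<forall>x y. G (x - y) = G x - G y)"

lemma linI: "(\<And>x y. G (x - y) = G x - G y) \<Longrightarrow> lin G"
  by (simp add: lin_def)

lemma lin_diff: "lin G \<Longrightarrow> G (x - y) = G x - G y"
  by (simp add: lin_def)

lemma lin_zero: "lin G \<Longrightarrow> G 0 = 0"
  by (metis lin_diff diff_self)

lemma lin_minus: "lin G \<Longrightarrow> G (- x) = - G x"
  by (metis lin_diff lin_zero diff_0)

lemma lin_add: "lin G \<Longrightarrow> G (x + y) = G x + G y"
  by (metis lin_diff lin_minus diff_minus_eq_add)

lemma lin_cmul:
  assumes "lin G" shows "G (frag_cmul k x) = frag_cmul k (G x)"
proof -
  have n: "G (frag_cmul (int m) x) = frag_cmul (int m) (G x)" for m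
    by (induction m) (simp_all add: lin_zero[OF assms] lin_add[OF assms] frag_cmul_distrib)
  show ?thesis
    by (cases k rule: int_cases2)
      (simp_all add: n minus_frag_cmul[symmetric] lin_minus[OF assms] del: minus_frag_cmul)
qed

lemma lin_sum:
  assumes "lin G" shows "G (\<Sum>i\<in>I. h i) = (\<Sum>i\<in>I. G (h i))"
  by (induction I rule: infinite_finite_induct) (simp_all add: lin_zero[OF assms] lin_add[OF assms])

lemma lin_frag_extend [simp]: "lin (frag_extend f)"
  by (simp add: lin_def frag_extend_diff)

lemma lin_compose: "lin G \<Longrightarrow> lin H \<Longrightarrow> lin (\<lambda>x. G (H x))"
  by (simp add: lin_def)

lemma lin_plus: "lin G \<Longrightarrow> lin H \<Longrightarrow> lin (\<lambda>x. G x + H x)"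
  by (simp add: lin_def)

lemma lin_scale: "lin G \<Longrightarrow> lin (\<lambda>x. frag_cmul k (G x))"
  unfolding lin_def by (metis add_diff_cancel_right' diff_add_cancel frag_cmul_distrib2)

lemma lin_foldr:
  assumes "\<And>v. v \<in> set vs \<Longrightarrow> lin (J v)" shows "lin (foldr J vs)"
  using assms by (induction vs) (auto simp: lin_def)

section \<open>Left multiplication by a single circle\<close>

definition unit_ext :: exterior where "unit_ext = frag_of {}"

text \<open>The sign is the cost of moving \<open>v\<close> past the smaller circles of
  \<open>A\<close> into its increasing position.\<close>

definition ins :: "nat set \<Rightarrow> nat set set \<Rightarrow> exterior" where
  "ins v A = (if v \<in> A then 0
     else frag_cmul ((- 1) ^ card {w\<in>A. Min w < Min v}) (frag_of (insert v A)))"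

text \<open>Computations below use these operators in place of the wedge product: together with the
  unit they generate the exterior algebra, and signs then arise one circle at a time.\<close>

definition iota :: "nat set \<Rightarrow> exterior \<Rightarrow> exterior" where
  "iota v = frag_extend (ins v)"

lemma lin_iota [simp]: "lin (iota v)"
  by (simp add: iota_def)

text \<open>Each coefficient of the image comes from at most one coefficient of \<open>x\<close>,
  which makes comparison of coefficients a practical method throughout.\<close>

lemma lookup_iota:
  "Poly_Mapping.lookup (iota v x) B =
     (if v \<in> B then (- 1) ^ card {w\<in>B - {v}. Min w < Min v} * Poly_Mapping.lookup x (B - {v}) else 0)"
proof -
  have "Poly_Mapping.keys x \<subseteq> UNIV" by simp
  then show ?thesis
  proof (induction x rule: frag_induction)
    case zero then show ?case by (simp add: lin_zero)
  next
    case (one A)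
    have l: "Poly_Mapping.lookup (iota v (frag_of A)) B = (if v \<notin> A \<and> insert v A = B then (- 1) ^ card {w\<in>A. Min w < Min v} else 0)"
      unfolding iota_def frag_extend_of ins_def by simp
    show ?case
    proof (cases "v \<in> B \<and> A = B - {v}")
      case True
      then have "v \<notin> A \<and> insert v A = B" by auto
      then show ?thesis unfolding l using True by simp
    next
      case False
      then have "\<not> (v \<notin> A \<and> insert v A = B)" by auto
      then show ?thesis unfolding l using False by auto
    qed
  next
    case (diff x y)
    then show ?case by (simp add: lin_diff[OF lin_iota] lookup_minus algebra_simps)
  qed
qed

text \<open>Circles are ordered by their least vertices; injectivity of \<open>Min\<close> is what
  turns this into a total order on the collection.\<close>

definition keyed :: "nat set set \<Rightarrow> bool" where
  "keyed S \<longleftrightarrow> finite S \<and> inj_on Min S"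

lemma exterior_algebra_0 [simp]: "0 \<in> exterior_algebra S"
  by (simp add: exterior_algebra_def)

lemma exterior_algebra_frag_of [simp]: "frag_of A \<in> exterior_algebra S \<longleftrightarrow> A \<subseteq> S"
  by (simp add: exterior_algebra_def)

lemma exterior_algebra_unit [simp]: "unit_ext \<in> exterior_algebra S"
  by (simp add: unit_ext_def)

lemma exterior_algebra_diff:
  "x \<in> exterior_algebra S \<Longrightarrow> y \<in> exterior_algebra S \<Longrightarrow> x - y \<in> exterior_algebra S"
  using keys_diff[of x y] by (auto simp: exterior_algebra_def)

lemma exterior_algebra_add:
  "x \<in> exterior_algebra S \<Longrightarrow> y \<in> exterior_algebra S \<Longrightarrow> x + y \<in> exterior_algebra S"
  using Poly_Mapping.keys_add[of x y] by (auto simp: exterior_algebra_def)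

lemma exterior_algebra_cmul:
  "x \<in> exterior_algebra S \<Longrightarrow> frag_cmul k x \<in> exterior_algebra S"
  using keys_cmul[of k x] by (auto simp: exterior_algebra_def)

lemma exterior_algebra_mono: "S \<subseteq> S' \<Longrightarrow> exterior_algebra S \<subseteq> exterior_algebra S'"
  by (auto simp: exterior_algebra_def)

lemma exterior_algebra_lookup:
  "x \<in> exterior_algebra S \<longleftrightarrow> (\<forall>A. \<not> A \<subseteq> S \<longrightarrow> Poly_Mapping.lookup x A = 0)"
  by (auto simp: exterior_algebra_def in_keys_iff)

lemma exterior_algebra_iota:
  assumes "v \<in> S" "x \<in> exterior_algebra S" shows "iota v x \<in> exterior_algebra S"
  unfolding exterior_algebra_lookup
proof (intro allI impI)
  fix A assume A: "\<not> A \<subseteq> S"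
  then have "\<not> A - {v} \<subseteq> S" using assms(1) by blast
  then show "Poly_Mapping.lookup (iota v x) A = 0"
    using assms(2) by (simp add: lookup_iota exterior_algebra_lookup)
qed

lemma exterior_basis_induct [consumes 1, case_names basis diff]:
  assumes "x \<in> exterior_algebra S"
    and "\<And>A. A \<subseteq> S \<Longrightarrow> P (frag_of A)"
    and "\<And>x y. P x \<Longrightarrow> P y \<Longrightarrow> P (x - y)"
  shows "P x"
proof -
  have "Poly_Mapping.keys x \<subseteq> Pow S" using assms(1) by (simp add: exterior_algebra_def)
  moreover have "P 0" using assms(2)[of "{}"] assms(3) by (metis diff_self empty_subsetI)
  ultimately show ?thesis
    by (induction x rule: frag_induction) (auto intro: assms)
qed

lemma iota_iota: "iota v (iota v x) = 0"
  by (rule poly_mapping_eqI) (simp add: lookup_iota)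

text \<open>Each of the two circles counts in the sign of the other exactly when it is the smaller
  one, and this happens in only one of the two orders of multiplication.\<close>

lemma iota_anticomm:
  assumes "x \<in> exterior_algebra S" "finite S" "Min v \<noteq> Min w"
  shows "iota v (iota w x) = - iota w (iota v x)"
proof (rule poly_mapping_eqI)
  fix B
  show "Poly_Mapping.lookup (iota v (iota w x)) B = Poly_Mapping.lookup (- iota w (iota v x)) B"
  proof (cases "v \<in> B \<and> w \<in> B \<and> B - {v,w} \<subseteq> S")
    case True
    have vw: "v \<noteq> w" using assms(3) by auto
    define A where "A = B - {v, w}"
    have fA: "finite A" using True assms(2) finite_subset[of A S] by (simp add: A_def)
    have Bv: "B - {v} = insert w A" and Bw: "B - {w} = insert v A" and nA: "v \<notin> A" "w \<notin> A"
      using True vw by (auto simp: A_def)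
    have e: "insert w A - {w} = A" "insert v A - {v} = A" using nA by auto
    have 1: "card {u\<in>insert w A. Min u < Min v} = card {u\<in>A. Min u < Min v} + (if Min w < Min v then 1 else 0)"
    proof -
      have "{u\<in>insert w A. Min u < Min v} = (if Min w < Min v then insert w {u\<in>A. Min u < Min v} else {u\<in>A. Min u < Min v})"
        by auto
      then show ?thesis using fA nA by simp
    qed
    have 2: "card {u\<in>insert v A. Min u < Min w} = card {u\<in>A. Min u < Min w} + (if Min v < Min w then 1 else 0)"
    proof -
      have "{u\<in>insert v A. Min u < Min w} = (if Min v < Min w then insert v {u\<in>A. Min u < Min w} else {u\<in>A. Min u < Min w})"
        by auto
      then show ?thesis using fA nA by simp
    qed
    have vB: "v \<in> B" and wB: "w \<in> B" using True by auto
    have "Poly_Mapping.lookup (iota v (iota w x)) B = (- 1) ^ card {u\<in>insert w A. Min u < Min v} *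
        ((- 1) ^ card {u\<in>A. Min u < Min w} * Poly_Mapping.lookup x A)"
      by (simp only: lookup_iota Bv e if_P[OF vB] insertI1 if_True)
    moreover have "Poly_Mapping.lookup (iota w (iota v x)) B = (- 1) ^ card {u\<in>insert v A. Min u < Min w} *
        ((- 1) ^ card {u\<in>A. Min u < Min v} * Poly_Mapping.lookup x A)"
      by (simp only: lookup_iota Bw e if_P[OF wB] insertI1 if_True)
    ultimately show ?thesis
      unfolding 1 2 using assms(3) by (cases "Min v < Min w") auto
  next
    case False
    have "Poly_Mapping.lookup x (B - {v} - {w}) = 0" if "\<not> B - {v,w} \<subseteq> S"
      using assms(1) that unfolding exterior_algebra_lookup by (metis Diff_insert2)
    moreover have "Poly_Mapping.lookup x (B - {w} - {v}) = 0" if "\<not> B - {v,w} \<subseteq> S"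
      using calculation that by (metis Diff_insert Diff_insert2 )
    ultimately show ?thesis using False by (auto simp: lookup_iota)
  qed
qed

text \<open>The inversions of \<open>v # cs\<close> are those of \<open>cs\<close>, with shifted
  indices, together with one for each circle of \<open>cs\<close> smaller than \<open>v\<close>; the
  latter number is the exponent in \<open>ins\<close>.\<close>

lemma wedge_list_Cons: "wedge_list (v # cs) = iota v (wedge_list cs)"
proof (cases "distinct (v # cs)")
  case True
  then have d: "distinct cs" "v \<notin> set cs" by auto
  let ?I = "{(p, q). p < q \<and> q < length cs \<and> Min (cs ! q) < Min (cs ! p)}"
  let ?Z = "{q. q < length cs \<and> Min (cs ! q) < Min v}"
  have "{(p, q). p < q \<and> q < length (v # cs) \<and> Min ((v # cs) ! q) < Min ((v # cs) ! p)} =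
      (\<lambda>(p, q). (Suc p, Suc q)) ` ?I \<union> (\<lambda>q. (0, Suc q)) ` ?Z" (is "?L = ?R1 \<union> ?R2")
  proof (rule equalityI; rule subsetI)
    fix z assume "z \<in> ?L"
    then obtain p q where z: "z = (p, q)" "p < q" "q < length (v # cs)" "Min ((v # cs) ! q) < Min ((v # cs) ! p)" by auto
    then obtain q' where q: "q = Suc q'" by (cases q) auto
    show "z \<in> ?R1 \<union> ?R2"
    proof (cases p)
      case 0 then show ?thesis using z q by auto
    next
      case (Suc p')
      then have "(p', q') \<in> ?I" using z q by auto
      then have "(\<lambda>(p, q). (Suc p, Suc q)) (p', q') \<in> ?R1" by (rule imageI)
      then show ?thesis using z q Suc by simp
    qed
  next
    fix z assume "z \<in> ?R1 \<union> ?R2" then show "z \<in> ?L" by auto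
  qed
  moreover have "?R1 \<inter> ?R2 = {}" by auto
  moreover have fI: "finite ?I" by (rule finite_subset[of _ "{..<length cs} \<times> {..<length cs}"]) auto
  moreover have "card ?R1 = card ?I" by (rule card_image) (auto simp: inj_on_def)
  moreover have "card ?R2 = card ?Z" by (rule card_image) (auto simp: inj_on_def)
  moreover have "card ?Z = card {w\<in>set cs. Min w < Min v}"
  proof -
    have "bij_betw ((!) cs) ?Z {w\<in>set cs. Min w < Min v}"
      using d by (auto simp: bij_betw_def inj_on_def nth_eq_iff_index_eq in_set_conv_nth)
    then show ?thesis by (rule bij_betw_same_card)
  qed
  moreover have "finite ?Z" by simp
  ultimately have "inversions (v # cs) = inversions cs + card {w\<in>set cs. Min w < Min v}"
    unfolding inversions_def by (simp add: card_Un_disjoint)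
  then show ?thesis using True
    by (simp add: wedge_list_def lin_cmul[OF lin_iota]) (simp add: iota_def ins_def power_add)
next
  case False
  show ?thesis
  proof (cases "distinct cs")
    case True
    then have "v \<in> set cs" using False by auto
    then show ?thesis using False True
      by (simp add: wedge_list_def lin_cmul[OF lin_iota]) (simp add: iota_def ins_def)
  next
    case F: False
    then show ?thesis using False by (simp add: wedge_list_def lin_zero)
  qed
qed

lemma wedge_list_foldr: "wedge_list cs = foldr iota cs unit_ext"
  by (induction cs) (simp_all add: wedge_list_Cons, simp add: wedge_list_def inversions_def unit_ext_def)

section \<open>Increasing lists of circles\<close>

lemma keyed_subset: "keyed S \<Longrightarrow> A \<subseteq> S \<Longrightarrow> keyed A"
  by (auto simp: keyed_def intro: finite_subset inj_on_subset)

lemma increasing_list_empty [simp]: "increasing_list {} = []"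
proof -
  interpret folding_on "{} :: nat set set" "insort_key Min" "[]" by unfold_locales simp
  show ?thesis by (simp add: increasing_list_def sorted_key_list_of_set_def)
qed

text \<open>\<open>sorted_key_list_of_set\<close> is a fold of insertions, so the insertions have to
  commute; they do because distinct circles have distinct keys.\<close>

lemma increasing_list_insert:
  assumes "keyed (insert v A)" "v \<notin> A"
  shows "increasing_list (insert v A) = insort_key Min v (increasing_list A)"
proof -
  have "insort_key Min x (insort_key Min y zs) = insort_key Min y (insort_key Min x zs)"
    if "x \<in> insert v A" "y \<in> insert v A" for x y zs
  proof (cases "x = y")
    case False
    then have "Min x \<noteq> Min y" using assms(1) that by (meson inj_onD keyed_def)
    then show ?thesis by (induction zs) auto
  qed simp
  then interpret folding_on "insert v A" "insort_key Min" "[]"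
    by unfold_locales (auto simp: fun_eq_iff)
  show ?thesis
    using assms insert[of v A] by (simp add: increasing_list_def sorted_key_list_of_set_def keyed_def)
qed

lemma increasing_list_props:
  assumes "keyed A"
  shows "set (increasing_list A) = A \<and> sorted (map Min (increasing_list A)) \<and> distinct (increasing_list A)"
proof -
  have "finite A" using assms by (simp add: keyed_def)
  then show ?thesis using assms
  proof (induction A)
    case (insert v A)
    then have "keyed A" using keyed_subset by auto
    then show ?case using insert
      by (simp add: increasing_list_insert set_insort_key sorted_insort_key distinct_insort)
  qed simp
qed

lemmas set_increasing_list = increasing_list_props[THEN conjunct1]
  and sorted_increasing_list = increasing_list_props[THEN conjunct2, THEN conjunct1]
  and distinct_increasing_list = increasing_list_props[THEN conjunct2, THEN conjunct2]

lemma wedge_list_increasing: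
  assumes "keyed A" shows "wedge_list (increasing_list A) = frag_of A"
proof -
  let ?cs = "increasing_list A"
  have "\<not> Min (?cs ! q) < Min (?cs ! p)" if "p < q" "q < length ?cs" for p q
    using sorted_nth_mono[OF sorted_increasing_list[OF assms], of p q] that by simp
  then have "{(p, q). p < q \<and> q < length ?cs \<and> Min (?cs ! q) < Min (?cs ! p)} = {}" by blast
  then have "inversions ?cs = 0" unfolding inversions_def by (simp only: card.empty)
  then show ?thesis
    by (simp add: wedge_list_def set_increasing_list[OF assms] distinct_increasing_list[OF assms])
qed

text \<open>The universal property of the exterior algebra in operator form: the generators act
  through \<open>J\<close> on a start value \<open>y\<close>. Induced maps, the wedge product and
  the twists are all instances.\<close>

definition extend :: "(nat set \<Rightarrow> exterior \<Rightarrow> exterior) \<Rightarrow> exterior \<Rightarrow> exterior \<Rightarrow> exterior" where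
  "extend J y = frag_extend (\<lambda>A. foldr J (increasing_list A) y)"

lemma lin_extend [simp]: "lin (extend J y)"
  by (simp add: extend_def)

lemma extend_unit [simp]: "extend J y unit_ext = y"
  by (simp add: extend_def unit_ext_def)

lemma exterior_map_extend: "exterior_map f = extend (\<lambda>v. iota (f v)) unit_ext"
  by (simp add: exterior_map_def extend_def wedge_list_foldr foldr_map comp_def)

text \<open>The relations are asked for on \<open>exterior_algebra T\<close> only, because that is
  where the operators act and where \<open>iota_anticomm\<close> supplies them.\<close>

locale anticommuting =
  fixes S T :: "nat set set" and J :: "nat set \<Rightarrow> exterior \<Rightarrow> exterior"
  assumes keyed: "keyed S"
    and lin_J: "v \<in> S \<Longrightarrow> lin (J v)"
    and closed: "v \<in> S \<Longrightarrow> z \<in> exterior_algebra T \<Longrightarrow> J v z \<in> exterior_algebra T"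
    and square: "v \<in> S \<Longrightarrow> z \<in> exterior_algebra T \<Longrightarrow> J v (J v z) = 0"
    and anticomm: "v \<in> S \<Longrightarrow> w \<in> S \<Longrightarrow> z \<in> exterior_algebra T \<Longrightarrow> v \<noteq> w \<Longrightarrow> J v (J w z) = - J w (J v z)"
begin

lemma foldr_closed:
  "set vs \<subseteq> S \<Longrightarrow> y \<in> exterior_algebra T \<Longrightarrow> foldr J vs y \<in> exterior_algebra T"
  by (induction vs) (auto intro: closed)

lemma foldr_absorb:
  assumes "set vs \<subseteq> S" "y \<in> exterior_algebra T" "v \<in> set vs"
  shows "J v (foldr J vs y) = 0"
  using assms
proof (induction vs)
  case (Cons w vs)
  have c: "foldr J vs y \<in> exterior_algebra T" using Cons by (auto intro: foldr_closed)
  show ?case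
  proof (cases "v = w")
    case True then show ?thesis using Cons.prems c square by simp
  next
    case False
    then have "J v (foldr J (w # vs) y) = - J w (J v (foldr J vs y))"
      using Cons.prems c anticomm[of v w] by auto
    then show ?thesis using Cons False lin_J[of w] by (simp add: lin_zero)
  qed
qed simp

text \<open>Moving \<open>v\<close> to its sorted position passes each smaller circle once, and
  every passage changes the sign.\<close>

lemma foldr_insort:
  assumes "set vs \<subseteq> S" "y \<in> exterior_algebra T" "v \<in> S" "v \<notin> set vs" "sorted (map Min vs)"
  shows "J v (foldr J vs y) =
    frag_cmul ((- 1) ^ length (filter (\<lambda>w. Min w < Min v) vs)) (foldr J (insort_key Min v vs) y)"
  using assms
proof (induction vs)
  case (Cons w vs)
  have c: "foldr J vs y \<in> exterior_algebra T" using Cons by (auto intro: foldr_closed)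
  show ?case
  proof (cases "Min v \<le> Min w")
    case True
    then have "filter (\<lambda>u. Min u < Min v) (w # vs) = []" using Cons.prems by (fastforce simp: filter_empty_conv)
    then show ?thesis using True by (simp del: filter.simps)
  next
    case False
    have "J v (foldr J (w # vs) y) = - J w (J v (foldr J vs y))"
      using Cons.prems c anticomm[of v w] by auto
    then show ?thesis using Cons False lin_J[of w] by (simp add: lin_cmul)
  qed
qed simp

lemma extend_closed:
  assumes "x \<in> exterior_algebra S" "y \<in> exterior_algebra T"
  shows "extend J y x \<in> exterior_algebra T"
  using assms(1)
proof (induction x rule: exterior_basis_induct)
  case (basis A)
  then have "set (increasing_list A) \<subseteq> S" by (metis keyed keyed_subset set_increasing_list)
  then show ?case using assms(2) by (simp add: extend_def foldr_closed)
next
  case (diff x y) then show ?case by (simp add: lin_diff[OF lin_extend] exterior_algebra_diff)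
qed

text \<open>For a new circle, the sign in \<open>ins\<close> and the sign of sorting the operators
  by \<open>foldr_insort\<close> are the same; for a circle already present both sides
  vanish.\<close>

lemma extend_iota:
  assumes "x \<in> exterior_algebra S" "y \<in> exterior_algebra T" "v \<in> S"
  shows "extend J y (iota v x) = J v (extend J y x)"
  using assms(1)
proof (induction x rule: exterior_basis_induct)
  case (basis A)
  have kA: "keyed A" "keyed (insert v A)" using basis assms(3) keyed by (auto intro: keyed_subset)
  have sA: "set (increasing_list A) = A" "sorted (map Min (increasing_list A))"
    "distinct (increasing_list A)"
    using kA set_increasing_list sorted_increasing_list distinct_increasing_list by auto
  show ?case
  proof (cases "v \<in> A")
    case True
    then have "J v (foldr J (increasing_list A) y) = 0"
      using basis assms sA by (intro foldr_absorb) auto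
    then show ?thesis using True by (simp add: extend_def iota_def ins_def)
  next
    case False
    have "length (filter (\<lambda>w. Min w < Min v) (increasing_list A)) = card {w\<in>A. Min w < Min v}"
      using sA by (metis distinct_card distinct_filter set_filter)
    then have "J v (foldr J (increasing_list A) y) =
      frag_cmul ((- 1) ^ card {w\<in>A. Min w < Min v}) (foldr J (increasing_list (insert v A)) y)"
      using foldr_insort[of "increasing_list A" y v] basis assms sA False kA
      by (simp add: increasing_list_insert)
    then show ?thesis using False by (simp add: extend_def iota_def ins_def frag_extend_cmul)
  qed
next
  case (diff x z)
  then show ?case
    by (simp add: lin_diff[OF lin_extend] lin_diff[OF lin_iota] lin_diff[OF lin_J[OF assms(3)]])
qed

end

text \<open>The map \<open>f\<close> may identify circles, as a merge does: then both double
  products are zero by \<open>iota_iota\<close>.\<close>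

lemma anticommuting_iota_map:
  assumes "keyed S" "keyed T" "f ` S \<subseteq> T"
  shows "anticommuting S T (\<lambda>v. iota (f v))"
proof
  fix v w z
  assume "v \<in> S" "z \<in> exterior_algebra T"
  then show "iota (f v) z \<in> exterior_algebra T"
    using assms by (auto intro: exterior_algebra_iota)
  assume "w \<in> S" "v \<noteq> w"
  show "iota (f v) (iota (f w) z) = - iota (f w) (iota (f v) z)"
  proof (cases "f v = f w")
    case True then show ?thesis by (simp add: iota_iota)
  next
    case False
    then have "Min (f v) \<noteq> Min (f w)"
      using \<open>v \<in> S\<close> \<open>w \<in> S\<close> assms by (meson image_subset_iff inj_onD keyed_def)
    moreover have "finite T" using assms(2) by (simp add: keyed_def)
    ultimately show ?thesis using \<open>z \<in> exterior_algebra T\<close> iota_anticomm by blast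
  qed
qed (simp_all add: assms(1) iota_iota)

lemmas anticommuting_iota = anticommuting_iota_map[where f = "\<lambda>v. v", simplified]

lemma exterior_map_iota:
  assumes "keyed S" "keyed T" "f ` S \<subseteq> T" "x \<in> exterior_algebra S" "v \<in> S"
  shows "exterior_map f (iota v x) = iota (f v) (exterior_map f x)"
  using anticommuting.extend_iota[OF anticommuting_iota_map[OF assms(1-3)] assms(4) _ assms(5)]
  by (simp add: exterior_map_extend)

lemma exterior_map_closed:
  assumes "keyed S" "keyed T" "f ` S \<subseteq> T" "x \<in> exterior_algebra S"
  shows "exterior_map f x \<in> exterior_algebra T"
  using anticommuting.extend_closed[OF anticommuting_iota_map[OF assms(1-3)] assms(4)]
  by (simp add: exterior_map_extend)

lemma lin_exterior_map [simp]: "lin (exterior_map f)"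
  by (simp add: exterior_map_extend)

lemma exterior_map_unit [simp]: "exterior_map f unit_ext = unit_ext"
  by (simp add: exterior_map_extend)

lemma lin_wedge_left: "lin (\<lambda>x. wedge x y)"
  by (simp add: wedge_def)

lemma lin_wedge_right: "lin (wedge x)"
proof -
  have "Poly_Mapping.keys x \<subseteq> UNIV" by simp
  then show ?thesis
    by (induction x rule: frag_induction)
       (auto simp: wedge_def[abs_def] lin_def frag_extend_diff)
qed

text \<open>Appending lists of factors is composing the folds of \<open>iota\<close>, so no sorting
  has to be analysed for the product of two basis elements.\<close>

lemma wedge_eq_extend:
  assumes "keyed S" "x \<in> exterior_algebra S" "y \<in> exterior_algebra S"
  shows "wedge x y = extend iota y x"
  using assms(2)
proof (induction x rule: exterior_basis_induct)
  case (basis A)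
  have "frag_extend (\<lambda>B. wedge_list (increasing_list A @ increasing_list B)) y = foldr iota (increasing_list A) y"
    using assms(3)
  proof (induction y rule: exterior_basis_induct)
    case (basis B)
    then have "keyed B" using assms(1) keyed_subset by auto
    then show ?case
      using wedge_list_increasing[of B] by (simp add: wedge_list_foldr)
  next
    case (diff x y)
    then show ?case using lin_diff[OF lin_foldr[of "increasing_list A" iota]]
      by (simp add: frag_extend_diff)
  qed
  then show ?case by (simp add: wedge_def extend_def)
next
  case (diff x z) then show ?case by (simp add: lin_diff[OF lin_wedge_left] lin_diff[OF lin_extend])
qed

lemma wedge_unit:
  assumes "keyed S" "y \<in> exterior_algebra S" shows "wedge unit_ext y = y"
  by (simp add: wedge_eq_extend[OF assms(1) _ assms(2)])

lemma wedge_iota: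
  assumes "keyed S" "x \<in> exterior_algebra S" "y \<in> exterior_algebra S" "v \<in> S"
  shows "wedge (iota v x) y = iota v (wedge x y)"
  using anticommuting.extend_iota[OF anticommuting_iota[OF assms(1) assms(1)]] assms
  by (simp add: wedge_eq_extend exterior_algebra_iota)

lemma wedge_closed:
  assumes "keyed S" "x \<in> exterior_algebra S" "y \<in> exterior_algebra S"
  shows "wedge x y \<in> exterior_algebra S"
  using anticommuting.extend_closed[OF anticommuting_iota[OF assms(1) assms(1)]] assms
  by (simp add: wedge_eq_extend)

lemma wedge_generator:
  assumes "keyed S" "v \<in> S" "y \<in> exterior_algebra S"
  shows "wedge (frag_of {v}) y = iota v y"
proof -
  have "frag_of {v} = iota v unit_ext" by (simp add: iota_def ins_def unit_ext_def)
  then show ?thesis using wedge_iota[OF assms(1) _ assms(3,2), of unit_ext] wedge_unit[OF assms(1,3)] by simp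
qed

lemma exterior_induct [consumes 2, case_names unit diff iota]:
  assumes "keyed S" "x \<in> exterior_algebra S"
    and "P unit_ext"
    and "\<And>x y. x \<in> exterior_algebra S \<Longrightarrow> y \<in> exterior_algebra S \<Longrightarrow> P x \<Longrightarrow> P y \<Longrightarrow> P (x - y)"
    and "\<And>x v. v \<in> S \<Longrightarrow> x \<in> exterior_algebra S \<Longrightarrow> P x \<Longrightarrow> P (iota v x)"
  shows "P x"
proof -
  let ?Q = "\<lambda>x. x \<in> exterior_algebra S \<and> P x"
  have Q: "?Q (foldr iota vs unit_ext)" if "set vs \<subseteq> S" for vs
    using that by (induction vs) (auto intro: assms exterior_algebra_iota)
  have "?Q x"
    using assms(2)
  proof (induction x rule: exterior_basis_induct)
    case (basis A)
    then have k: "keyed A" using assms(1) keyed_subset by auto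
    then have "?Q (wedge_list (increasing_list A))"
      unfolding wedge_list_foldr using basis by (intro Q) (simp add: set_increasing_list)
    then show ?case using k by (simp add: wedge_list_increasing)
  qed (auto intro: assms exterior_algebra_diff)
  then show ?thesis by simp
qed

lemma exterior_decompose:
  assumes "keyed S" "v \<in> S" "x \<in> exterior_algebra S"
  obtains x1 x2 where "x1 \<in> exterior_algebra (S - {v})" "x2 \<in> exterior_algebra (S - {v})"
    "x = iota v x1 + x2"
proof -
  have "\<exists>x1\<in>exterior_algebra (S - {v}). \<exists>x2\<in>exterior_algebra (S - {v}). x = iota v x1 + x2"
    using assms(3)
  proof (induction x rule: exterior_basis_induct)
    case (basis A)
    show ?case
    proof (cases "v \<in> A")
      case True
      define k :: int where "k = (- 1) ^ card {w\<in>A - {v}. Min w < Min v}"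
      have "iota v (frag_cmul k (frag_of (A - {v}))) = frag_of A"
        using True by (simp add: lin_cmul, simp add: iota_def ins_def k_def insert_absorb)
      then have "frag_of A = iota v (frag_cmul k (frag_of (A - {v}))) + 0" by simp
      moreover have "frag_cmul k (frag_of (A - {v})) \<in> exterior_algebra (S - {v})"
        using basis by (intro exterior_algebra_cmul) auto
      ultimately show ?thesis using exterior_algebra_0 by blast
    next
      case False
      then have "frag_of A \<in> exterior_algebra (S - {v})" using basis by auto
      moreover have "frag_of A = iota v 0 + frag_of A" by (simp add: lin_zero)
      ultimately show ?thesis using exterior_algebra_0 by blast
    qed
  next
    case (diff x y)
    then obtain x1 x2 y1 y2 where
      "x1 \<in> exterior_algebra (S - {v})" "x2 \<in> exterior_algebra (S - {v})"
      "y1 \<in> exterior_algebra (S - {v})" "y2 \<in> exterior_algebra (S - {v})"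
      "x = iota v x1 + x2" "y = iota v y1 + y2" by auto
    moreover from this have "x - y = iota v (x1 - y1) + (x2 - y2)" by (simp add: lin_diff)
    ultimately show ?case by (meson exterior_algebra_diff)
  qed
  then show ?thesis using that by blast
qed

section \<open>Circles as connected components\<close>

lemma circle_of_self [simp]: "v \<in> circle_of E v"
  by (simp add: circle_of_def)

text \<open>The form in which induction along paths is used everywhere: \<open>f\<close> is taken to
  be membership in a set, another component map, or an operator attached to a vertex.\<close>

lemma circle_of_respects:
  assumes "w \<in> circle_of E v" and "\<And>x y. {x, y} \<in> E \<Longrightarrow> f x = f y"
  shows "f v = f w"
proof -
  have "(v, w) \<in> {(x, y). {x, y} \<in> E}\<^sup>*" using assms(1) by (simp add: circle_of_def)
  then show ?thesis by (induction rule: rtrancl_induct) (auto dest: assms(2))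
qed

lemma circle_of_sym: "w \<in> circle_of E v \<Longrightarrow> v \<in> circle_of E w"
proof -
  have "sym {(x, y). {x, y} \<in> E}" by (auto simp: sym_def insert_commute)
  then show "w \<in> circle_of E v \<Longrightarrow> v \<in> circle_of E w"
    unfolding circle_of_def using sym_rtrancl symD by fastforce
qed

lemma circle_of_trans: "w \<in> circle_of E v \<Longrightarrow> u \<in> circle_of E w \<Longrightarrow> u \<in> circle_of E v"
  unfolding circle_of_def by auto

lemma circle_of_eq: "circle_of E v = circle_of E w \<longleftrightarrow> w \<in> circle_of E v"
proof
  show "circle_of E v = circle_of E w \<Longrightarrow> w \<in> circle_of E v" by simp
  show "w \<in> circle_of E v \<Longrightarrow> circle_of E v = circle_of E w"
    using circle_of_trans circle_of_sym by blast
qed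

lemma circle_of_eqI: "w \<in> circle_of E v \<Longrightarrow> circle_of E w = circle_of E v"
  using circle_of_eq by blast

lemma circle_of_edge: "{x, y} \<in> E \<Longrightarrow> circle_of E x = circle_of E y"
  unfolding circle_of_eq by (auto simp: circle_of_def)

lemma circle_of_mono: "E \<subseteq> E' \<Longrightarrow> circle_of E v \<subseteq> circle_of E' v"
  unfolding circle_of_def by (auto elim: rtrancl_mono[THEN subsetD, rotated])

lemma circle_of_empty [simp]: "circle_of {} v = {v}"
  by (auto simp: circle_of_def)

lemma circle_of_subset:
  assumes "\<Union>E \<subseteq> V" "v \<in> V" shows "circle_of E v \<subseteq> V"
proof
  fix w assume w: "w \<in> circle_of E v"
  have "(v \<in> V) = (w \<in> V)" by (rule circle_of_respects[OF w]) (use assms in blast)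
  then show "w \<in> V" using assms by simp
qed

text \<open>A split is expressed by the same predicate with the two component maps exchanged, so the
  counting is done once for both kinds of surgery.\<close>

definition merged :: "(nat \<Rightarrow> nat set) \<Rightarrow> (nat \<Rightarrow> nat set) \<Rightarrow> nat \<Rightarrow> nat \<Rightarrow> bool" where
  "merged C C' p r \<longleftrightarrow> C p \<noteq> C r \<and>
     (\<forall>v. C' v = (if v \<in> C p \<union> C r then C p \<union> C r else C v))"

lemma circle_of_insert:
  "circle_of (insert {p, q} E) v =
    (if v \<in> circle_of E p \<union> circle_of E q then circle_of E p \<union> circle_of E q else circle_of E v)"
  (is "?L = ?f v")
proof
  let ?U = "circle_of E p \<union> circle_of E q"
  have "?f x = ?f y" if "{x, y} \<in> insert {p, q} E" for x y
  proof (cases "{x, y} = {p, q}")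
    case True then show ?thesis by (auto simp: doubleton_eq_iff)
  next
    case False
    then have "circle_of E x = circle_of E y" using that circle_of_edge by auto
    moreover from this have "x \<in> ?U \<longleftrightarrow> y \<in> ?U" by (metis Un_iff circle_of_eq circle_of_sym)
    ultimately show ?thesis by simp
  qed
  then have eq: "?f v = ?f w" if "w \<in> ?L" for w using that circle_of_respects[of w _ v ?f] by blast
  show "?L \<subseteq> ?f v"
  proof
    fix w assume "w \<in> ?L"
    moreover have "w \<in> ?f w" by simp
    ultimately show "w \<in> ?f v" using eq by blast
  qed
  show "?f v \<subseteq> ?L"
  proof (cases "v \<in> ?U")
    case True
    have m: "circle_of E x \<subseteq> circle_of (insert {p, q} E) x" for x by (rule circle_of_mono) auto
    have pq: "circle_of (insert {p, q} E) p = circle_of (insert {p, q} E) q" by (rule circle_of_edge) simp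
    have "?U \<subseteq> circle_of (insert {p, q} E) p" using m[of p] m[of q] pq by auto
    moreover from this have "circle_of (insert {p, q} E) p = ?L" using True circle_of_eq by blast
    ultimately show ?thesis using True by simp
  next
    case False
    then show ?thesis using circle_of_mono[of E "insert {p, q} E" v] by auto
  qed
qed

lemma circle_of_insert_same:
  assumes "q \<in> circle_of E p" shows "circle_of (insert {p, q} E) = circle_of E"
proof
  fix v
  have "circle_of E q = circle_of E p" using assms by (rule circle_of_eqI)
  then show "circle_of (insert {p, q} E) v = circle_of E v"
    unfolding circle_of_insert by (simp add: circle_of_eqI)
qed

lemma merged_insert:
  "q \<notin> circle_of E p \<Longrightarrow> merged (circle_of E) (circle_of (insert {p, q} E)) p q"
  by (auto simp: merged_def circle_of_insert circle_of_eq)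

lemma merged_image:
  assumes "merged (circle_of E) C' p r" "p \<in> V" "r \<in> V"
  shows "C' ` V = insert (circle_of E p \<union> circle_of E r) (circle_of E ` V - {circle_of E p, circle_of E r})"
proof -
  let ?U = "circle_of E p \<union> circle_of E r"
  have C': "C' v = (if v \<in> ?U then ?U else circle_of E v)" for v
    using assms(1) by (simp add: merged_def)
  have "v \<in> ?U \<longleftrightarrow> circle_of E v = circle_of E p \<or> circle_of E v = circle_of E r" for v
    by (metis Un_iff circle_of_eq circle_of_sym)
  then have "C' v = (if circle_of E v = circle_of E p \<or> circle_of E v = circle_of E r then ?U else circle_of E v)" for v
    using C' by simp
  moreover have "C' p = ?U" using C' by simp
  ultimately show ?thesis using assms(2,3) by (auto simp: image_iff) 
qed

lemma merged_new:
  assumes "merged (circle_of E) C' p r"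
  shows "circle_of E p \<union> circle_of E r \<notin> range (circle_of E)"
proof
  assume "circle_of E p \<union> circle_of E r \<in> range (circle_of E)"
  then obtain v where v: "circle_of E v = circle_of E p \<union> circle_of E r" by auto
  then have "p \<in> circle_of E v" "r \<in> circle_of E v" by auto
  then have "circle_of E p = circle_of E r" by (metis circle_of_eqI)
  then show False using assms by (simp add: merged_def)
qed

lemma merged_card:
  assumes "merged (circle_of E) C' p r" "p \<in> V" "r \<in> V" "finite V"
  shows "card (circle_of E ` V) = Suc (card (C' ` V))"
proof -
  have ne: "circle_of E p \<noteq> circle_of E r" using assms(1) by (simp add: merged_def)
  have "card (C' ` V) = Suc (card (circle_of E ` V - {circle_of E p, circle_of E r}))"
    unfolding merged_image[OF assms(1-3)] using merged_new[OF assms(1)] assms(4)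
    by (subst card_insert_disjoint) auto
  also have "card (circle_of E ` V - {circle_of E p, circle_of E r}) = card (circle_of E ` V) - 2"
    using ne assms by (subst card_Diff_subset) auto
  finally have 1: "card (C' ` V) = Suc (card (circle_of E ` V) - 2)" .
  have "card {circle_of E p, circle_of E r} \<le> card (circle_of E ` V)"
    using assms by (intro card_mono) auto
  then show ?thesis using 1 ne by simp
qed

text \<open>An added edge lowers the number of components by at most one, starting from one
  component for each vertex.\<close>

lemma card_le_circles_plus_edges:
  assumes "finite V" "finite E" "\<forall>e\<in>E. \<exists>x\<in>V. \<exists>y\<in>V. e = {x, y}"
  shows "card V \<le> card (circle_of E ` V) + card E"
  using assms(2,3)
proof (induction E)
  case empty
  have "card ((\<lambda>v. {v}) ` V) = card V" by (rule card_image) auto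
  then show ?case by (simp cong: image_cong)
next
  case (insert e E)
  then obtain x y where xy: "x \<in> V" "y \<in> V" "e = {x, y}" by auto
  have "card (circle_of E ` V) \<le> Suc (card (circle_of (insert e E) ` V))"
  proof (cases "y \<in> circle_of E x")
    case True then show ?thesis using circle_of_insert_same xy by simp
  next
    case False then show ?thesis using merged_card[OF merged_insert] xy assms(1) by simp
  qed
  then show ?case using insert by simp
qed

subsection \<open>Exchanging two edges of a bipartite matching\<close>

text \<open>The colouring carries the information that is needed from planarity: since arcs join
  points of opposite parity, a surgery always changes the number of circles by one.\<close>

definition bipartite_matching :: "nat set \<Rightarrow> (nat \<Rightarrow> bool) \<Rightarrow> nat set set \<Rightarrow> bool" where
  "bipartite_matching V col M \<longleftrightarrow> finite V \<and> \<Union>M = V \<and> disjoint M \<and>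
     (\<forall>e\<in>M. \<exists>x y. e = {x, y} \<and> col x \<and> \<not> col y)"

lemma bipartite_matching_finite: "bipartite_matching V col M \<Longrightarrow> finite M"
  by (simp add: bipartite_matching_def finite_UnionD)

lemma bipartite_matching_card:
  assumes "bipartite_matching V col M"
  shows "card {v\<in>V. col v} = card M" "card {v\<in>V. \<not> col v} = card M"
proof -
  have *: "card {v\<in>V. P v} = card M" if ex: "\<forall>e\<in>M. \<exists>x y. e = {x, y} \<and> P x \<and> \<not> P y" for P
  proof -
    define f where "f e = (THE x. x \<in> e \<and> P x)" for e :: "nat set"
    have f: "f e \<in> e \<and> P (f e) \<and> (\<forall>x\<in>e. P x \<longrightarrow> x = f e)" if e: "e \<in> M" for e
    proof -
      obtain x y where xy: "e = {x, y}" "P x" "\<not> P y" using bspec[OF ex e] by blast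
      then have "f e = x" unfolding f_def by (intro the_equality) auto
      then show ?thesis using xy by auto
    qed
    have "bij_betw f M {v\<in>V. P v}"
    proof (rule bij_betw_imageI)
      show "inj_on f M"
      proof (rule inj_onI)
        fix e e' assume "e \<in> M" "e' \<in> M" "f e = f e'"
        then have "f e \<in> e \<inter> e'" using f[of e] f[of e'] by simp
        moreover have "disjoint M" using assms by (simp add: bipartite_matching_def)
        ultimately show "e = e'" using \<open>e \<in> M\<close> \<open>e' \<in> M\<close> unfolding disjoint_def by blast
      qed
      show "f ` M = {v\<in>V. P v}"
      proof (rule equalityI; rule subsetI)
        fix v assume "v \<in> {v\<in>V. P v}"
        then obtain e where "e \<in> M" "v \<in> e" "P v" using assms by (auto simp: bipartite_matching_def)
        then show "v \<in> f ` M" using f by blast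
      qed (use f assms in \<open>auto simp: bipartite_matching_def\<close>)
    qed
    then show ?thesis using bij_betw_same_card by fastforce
  qed
  have ex: "\<forall>e\<in>M. \<exists>x y. e = {x, y} \<and> col x \<and> \<not> col y" using assms by (simp add: bipartite_matching_def)
  then show "card {v\<in>V. col v} = card M" by (rule *)
  have "\<forall>e\<in>M. \<exists>x y. e = {x, y} \<and> \<not> col x \<and> \<not> \<not> col y" using ex by (metis insert_commute)
  then show "card {v\<in>V. \<not> col v} = card M" by (rule *)
qed

lemma bipartite_matching_restrict:
  assumes M: "bipartite_matching V col M" and "Q \<subseteq> V"
    and closed: "\<And>x y. {x, y} \<in> M \<Longrightarrow> x \<in> Q \<Longrightarrow> y \<in> Q"
  shows "bipartite_matching Q col {e\<in>M. e \<subseteq> Q}"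
proof -
  have "v \<in> \<Union>{e\<in>M. e \<subseteq> Q}" if "v \<in> Q" for v
  proof -
    have "v \<in> \<Union>M" using that assms by (auto simp: bipartite_matching_def)
    then obtain e where e: "e \<in> M" "v \<in> e" by blast
    then obtain w where "e = {v, w}" using M by (fastforce simp: bipartite_matching_def)
    then have "e \<subseteq> Q" using closed e that by blast
    then show ?thesis using e by auto
  qed
  then have "\<Union>{e\<in>M. e \<subseteq> Q} = Q" by blast
  moreover have "finite Q" using M \<open>Q \<subseteq> V\<close> by (auto simp: bipartite_matching_def intro: finite_subset)
  ultimately show ?thesis using M by (simp add: bipartite_matching_def disjoint_def)
qed

text \<open>Within one component, \<open>N\<close> matches all vertices and \<open>M\<close> all but
  the four ends, each edge using one vertex of either colour; so the ends in it are balanced in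
  colour. A component with all four ends would have \<open>2 * card N'\<close> vertices but at most
  \<open>2 * card N' - 2\<close> edges, too few to be connected.\<close>

lemma component_ends:
  assumes N: "bipartite_matching V col N"
    and M: "bipartite_matching (V - {p, q, r, s}) col M"
    and ends: "{p, q, r, s} \<subseteq> V" "col p" "col s" "\<not> col q" "\<not> col r" "p \<noteq> s" "q \<noteq> r"
    and "z \<in> V"
  shows "card (circle_of (M \<union> N) z \<inter> {p, s}) = card (circle_of (M \<union> N) z \<inter> {q, r})"
    and "\<not> {p, q, r, s} \<subseteq> circle_of (M \<union> N) z"
proof -
  define Q where "Q = circle_of (M \<union> N) z"
  define N' where "N' = {e\<in>N. e \<subseteq> Q}"
  define M' where "M' = {e\<in>M. e \<subseteq> Q - {p, q, r, s}}"
  have UN: "\<Union>N = V" "\<Union>M = V - {p, q, r, s}" "finite V"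
    using N M by (simp_all add: bipartite_matching_def)
  have QV: "Q \<subseteq> V" unfolding Q_def by (rule circle_of_subset) (use UN \<open>z \<in> V\<close> in auto)
  have edge: "y \<in> Q" if "{x, y} \<in> M \<union> N" "x \<in> Q" for x y
    using that circle_of_edge[OF that(1)] unfolding Q_def by (metis circle_of_eq)
  have BN: "bipartite_matching Q col N'"
    unfolding N'_def by (rule bipartite_matching_restrict[OF N QV]) (use edge in blast)
  have BM: "bipartite_matching (Q - {p, q, r, s}) col M'"
    unfolding M'_def
  proof (rule bipartite_matching_restrict[OF M])
    fix x y assume "{x, y} \<in> M" "x \<in> Q - {p, q, r, s}"
    moreover from this have "y \<in> V - {p, q, r, s}" unfolding UN(2)[symmetric] by blast
    ultimately show "y \<in> Q - {p, q, r, s}" using edge[of x y] by simp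
  qed (use QV in auto)
  have fQ: "finite Q" by (rule finite_subset[OF QV UN(3)])
  have cN: "card {v\<in>Q. col v} = card N'" "card {v\<in>Q. \<not> col v} = card N'"
    using bipartite_matching_card[OF BN] .
  have cM: "card {v\<in>Q - {p, q, r, s}. col v} = card M'" "card {v\<in>Q - {p, q, r, s}. \<not> col v} = card M'"
    using bipartite_matching_card[OF BM] .
  have s1: "{v\<in>Q. col v} = {v\<in>Q - {p, q, r, s}. col v} \<union> (Q \<inter> {p, s})" using ends by auto
  have s2: "{v\<in>Q. \<not> col v} = {v\<in>Q - {p, q, r, s}. \<not> col v} \<union> (Q \<inter> {q, r})" using ends by auto
  have c1: "card N' = card M' + card (Q \<inter> {p, s})"
    unfolding cN(1)[symmetric] cM(1)[symmetric] s1 using fQ by (subst card_Un_disjoint) auto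
  have c2: "card N' = card M' + card (Q \<inter> {q, r})"
    unfolding cN(2)[symmetric] cM(2)[symmetric] s2 using fQ by (subst card_Un_disjoint) auto
  show "card (circle_of (M \<union> N) z \<inter> {p, s}) = card (circle_of (M \<union> N) z \<inter> {q, r})"
    using c1 c2 by (simp add: Q_def)
  \<comment> \<open>Paths that start in \<open>Q\<close> use only edges contained in
    \<open>Q\<close>, so the restricted matchings already connect it.\<close>
  have "circle_of (M' \<union> N') ` Q \<subseteq> {Q}"
  proof
    fix X assume "X \<in> circle_of (M' \<union> N') ` Q"
    then obtain x where x: "x \<in> Q" "X = circle_of (M' \<union> N') x" by auto
    have Qx: "Q = circle_of (M \<union> N) x" using x unfolding Q_def by (metis circle_of_eqI)
    have "y \<in> X" if "y \<in> Q" for y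
    proof -
      have "(x, y) \<in> {(x, y). {x, y} \<in> M \<union> N}\<^sup>*" using that Qx by (simp add: circle_of_def)
      then have "y \<in> Q \<and> y \<in> X"
      proof (induction rule: rtrancl_induct)
        case base show ?case using x by simp
      next
        case (step y w)
        then have e: "{y, w} \<in> M \<union> N" "y \<in> Q" "w \<in> Q" using edge by auto
        then have "{y, w} \<in> M' \<union> N'" using UN unfolding M'_def N'_def by auto
        then have "circle_of (M' \<union> N') y = circle_of (M' \<union> N') w" by (rule circle_of_edge)
        then show ?case using step e x by (metis circle_of_eq)
      qed
      then show ?thesis by simp
    qed
    moreover have "X \<subseteq> Q" using circle_of_mono[of "M' \<union> N'" "M \<union> N" x] x Qx
      by (auto simp: M'_def N'_def)
    ultimately show "X \<in> {Q}" by auto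
  qed
  then have "card (circle_of (M' \<union> N') ` Q) \<le> 1" using card_mono[of "{Q}"] by fastforce
  moreover have "card Q \<le> card (circle_of (M' \<union> N') ` Q) + card (M' \<union> N')"
  proof (rule card_le_circles_plus_edges[OF fQ])
    show "finite (M' \<union> N')" using BN BM bipartite_matching_finite by auto
    have "\<exists>x y. e = {x, y} \<and> e \<subseteq> Q" if "e \<in> M' \<union> N'" for e
      using BN BM that unfolding bipartite_matching_def by (metis Diff_subset UnE Union_upper order_trans)
    then show "\<forall>e\<in>M' \<union> N'. \<exists>x\<in>Q. \<exists>y\<in>Q. e = {x, y}" by blast
  qed
  moreover have "card Q = card {v\<in>Q. col v} + card {v\<in>Q. \<not> col v}"
    using fQ by (subst card_Un_disjoint[symmetric]) (auto intro: arg_cong[of _ _ card])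
  moreover have "card (M' \<union> N') \<le> card M' + card N'" by (rule card_Un_le)
  ultimately have "2 * card N' \<le> 1 + card M' + card N'" using cN by simp
  moreover have "card (Q \<inter> {p, s}) = 2" if "{p, q, r, s} \<subseteq> Q"
  proof -
    have "Q \<inter> {p, s} = {p, s}" using that by auto
    then show ?thesis using ends by simp
  qed
  ultimately show "\<not> {p, q, r, s} \<subseteq> circle_of (M \<union> N) z" using c1 unfolding Q_def[symmetric] by auto
qed

text \<open>The two sides of the disjunction are the merge and the split; the second one is the first
  one read backwards.\<close>

lemma exchange_edges:
  assumes N: "bipartite_matching V col N"
    and M: "bipartite_matching (V - {p, q, r, s}) col M"
    and ends: "{p, q, r, s} \<subseteq> V" "col p" "col s" "\<not> col q" "\<not> col r" "p \<noteq> s" "q \<noteq> r"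
    and E: "E = M \<union> {{p, q}, {r, s}} \<union> N" and E': "E' = M \<union> {{p, r}, {q, s}} \<union> N"
  shows "merged (circle_of E) (circle_of E') p r \<and> q \<in> circle_of E p \<and> s \<in> circle_of E r \<or>
    merged (circle_of E') (circle_of E) p q \<and> r \<in> circle_of E' p \<and> s \<in> circle_of E' q"
proof -
  define C where "C = circle_of (M \<union> N)"
  have E1: "E = insert {r, s} (insert {p, q} (M \<union> N))" and E1': "E' = insert {q, s} (insert {p, r} (M \<union> N))"
    using E E' by auto
  have card2: "card (X \<inter> {x, y}) = (if x \<in> X then 1 else 0) + (if y \<in> X then 1 else 0)" if "x \<noteq> y" for X and x y :: nat
    using that by (auto simp: Int_insert_right)
  note ce = component_ends[OF N M ends, folded C_def, unfolded card2[OF ends(6)] card2[OF ends(7)]]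
  have cp: "p \<in> C p" "s \<in> C s" by (simp_all add: C_def)
  have "s \<notin> C p" "(q \<in> C p) \<noteq> (r \<in> C p)"
    using ce[of p] ends cp by (auto split: if_splits)
  moreover have "p \<notin> C s" "(q \<in> C s) \<noteq> (r \<in> C s)"
    using ce[of s] ends cp by (auto split: if_splits)
  moreover have eq: "(x \<in> C y) = (C x = C y)" for x y
    unfolding C_def by (metis circle_of_eq circle_of_sym)
  \<comment> \<open>Without the exchanged edges the four ends are joined in pairs. Equal colours
    exclude the pair \<open>p\<close>, \<open>s\<close>, so \<open>p\<close> goes with
    \<open>q\<close> or with \<open>r\<close>, and this decides between merge and split.\<close>
  ultimately consider (a) "q \<in> C p" "s \<in> C r" "r \<notin> C p" | (b) "r \<in> C p" "s \<in> C q" "q \<notin> C p"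
    by metis
  then show ?thesis
  proof cases
    case a
    have 1: "circle_of (insert {p, q} (M \<union> N)) = C"
      using a unfolding C_def by (intro circle_of_insert_same)
    have 2: "circle_of E = C"
      unfolding E1 by (subst circle_of_insert_same) (use a 1 in simp_all)
    let ?F = "insert {p, r} (M \<union> N)"
    have 3: "merged C (circle_of ?F) p r"
      using a unfolding C_def by (intro merged_insert)
    have "circle_of ?F p = C p \<union> C r" "circle_of ?F q = C p \<union> C r"
      using a by (simp_all add: circle_of_insert C_def)
    then have "s \<in> circle_of ?F q" using a by simp
    then have "circle_of E' = circle_of ?F" unfolding E1' by (rule circle_of_insert_same)
    then show ?thesis using 2 3 a by simp
  next
    case b
    have 1: "circle_of (insert {p, r} (M \<union> N)) = C"
      using b unfolding C_def by (intro circle_of_insert_same)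
    have 2: "circle_of E' = C"
      unfolding E1' by (subst circle_of_insert_same) (use b 1 in simp_all)
    let ?F = "insert {p, q} (M \<union> N)"
    have 3: "merged C (circle_of ?F) p q"
      using b unfolding C_def by (intro merged_insert)
    have "circle_of ?F p = C p \<union> C q" "circle_of ?F r = C p \<union> C q"
      using b by (simp_all add: circle_of_insert C_def)
    then have "s \<in> circle_of ?F r" using b by simp
    then have "circle_of E = circle_of ?F" unfolding E1 by (rule circle_of_insert_same)
    then show ?thesis using 2 3 b by simp
  qed
qed

section \<open>The map of a surgery\<close>

lemma merged_cong:
  "merged C C' p r \<Longrightarrow> C p = C p' \<Longrightarrow> C r = C r' \<Longrightarrow> merged C C' p' r'"
  by (simp add: merged_def)

text \<open>A component is recovered from any of its vertices, in particular from the least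
  one.\<close>

lemma keyed_circles:
  assumes "finite V" "\<Union>E \<subseteq> V" shows "keyed (circle_of E ` V)"
  unfolding keyed_def
proof
  show "inj_on Min (circle_of E ` V)"
  proof (rule inj_onI)
    fix X Y assume X: "X \<in> circle_of E ` V" and Y: "Y \<in> circle_of E ` V" and eq: "Min X = Min Y"
    have "Min Z \<in> Z \<and> Z = circle_of E (Min Z)" if Z: "Z \<in> circle_of E ` V" for Z
    proof -
      obtain v where v: "v \<in> V" "Z = circle_of E v" using Z by auto
      then have "finite Z" using circle_of_subset[OF assms(2)] finite_subset[OF _ assms(1)] by auto
      moreover have "Z \<noteq> {}" unfolding v using circle_of_self by blast
      ultimately have "Min Z \<in> Z" by (rule Min_in)
      then show ?thesis using v circle_of_eqI by metis
    qed
    then show "X = Y" using X Y eq by metis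
  qed
qed (use assms in simp)

lemma exterior_map_fixed:
  assumes "keyed S" "x \<in> exterior_algebra S" "\<And>v. v \<in> S \<Longrightarrow> f v = v"
  shows "exterior_map f x = x"
  using assms(1,2)
proof (induction x rule: exterior_induct)
  case (diff x y) then show ?case by (simp add: lin_diff)
next
  case (iota x v)
  then show ?case using exterior_map_iota[of S S f x v] assms by auto
qed simp

lemma lookup_outside: "x \<in> exterior_algebra S \<Longrightarrow> \<not> A \<subseteq> S \<Longrightarrow> Poly_Mapping.lookup x A = 0"
  by (simp add: exterior_algebra_lookup)

lemma lookup_iota_insert:
  assumes "v \<notin> A"
  shows "Poly_Mapping.lookup (iota v x) (insert v A) = (- 1) ^ card {w\<in>A. Min w < Min v} * Poly_Mapping.lookup x A"
  using assms by (simp add: lookup_iota)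

lemma iota_eq_0:
  assumes "x \<in> exterior_algebra S" "v \<notin> S" "iota v x = 0"
  shows "x = 0"
proof (rule poly_mapping_eqI)
  fix A
  show "Poly_Mapping.lookup x A = Poly_Mapping.lookup 0 A"
  proof (cases "A \<subseteq> S")
    case True
    then have "v \<notin> A" using assms by auto
    then show ?thesis using lookup_iota_insert[of v A x] assms(3) by simp
  next
    case False then show ?thesis using assms(1) by (simp add: lookup_outside)
  qed
qed

text \<open>\<open>cotransversal f S \<Q> A\<close>: the circles of \<open>S\<close> outside \<open>A\<close> form a system of
  representatives of the classes \<open>\<Q>\<close>.\<close>

definition represents :: "(nat set \<Rightarrow> nat set) \<Rightarrow> nat set set \<Rightarrow> nat set set \<Rightarrow> bool" where
  "represents f \<Q> X \<longleftrightarrow> (\<forall>Q\<in>\<Q>. \<exists>!x. x \<in> X \<and> f x = Q)"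

definition cotransversal :: "(nat set \<Rightarrow> nat set) \<Rightarrow> nat set set \<Rightarrow> nat set set \<Rightarrow> nat set set \<Rightarrow> bool" where
  "cotransversal f S \<Q> A \<longleftrightarrow> A \<subseteq> S \<and> represents f \<Q> (S - A)"

text \<open>The model is the wedge, over all classes, of the differences of circles along a spanning
  tree of the class: expanded in the basis, each term omits exactly one circle of every class and
  has coefficient 1 or -1. Recording absolute values is enough, since annihilation by differences
  ties the signs together.\<close>

definition regular_element :: "(nat set \<Rightarrow> nat set) \<Rightarrow> nat set set \<Rightarrow> nat set set \<Rightarrow> exterior \<Rightarrow> bool" where
  "regular_element f S \<Q> \<omega> \<longleftrightarrow>
     (\<forall>A. \<bar>Poly_Mapping.lookup \<omega> A\<bar> = (if cotransversal f S \<Q> A then 1 else 0))"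

text \<open>The circles \<open>e1\<close> and \<open>e2\<close> become \<open>E\<close> and their
  classes \<open>Q1\<close> and \<open>Q2\<close> become \<open>U\<close>. As a representative
  \<open>E\<close> stands for both old circles; without it, the representative of \<open>U\<close>
  in \<open>X\<close> serves one old class and the other is left to \<open>e1\<close> or
  \<open>e2\<close>. The last part ensures that two coefficients which are added are never both
  nonzero.\<close>

lemma represents_merge:
  assumes f': "\<And>x. x \<in> X \<Longrightarrow> f' x = (if f x = Q1 \<or> f x = Q2 then U else f x)"
    and X: "f ` X \<subseteq> \<Q>"
    and Q: "Q1 \<in> \<Q>" "Q2 \<in> \<Q>" "Q1 \<noteq> Q2" "U \<notin> \<Q>" "f e1 = Q1" "f e2 = Q2" "f' E = U"
    and e: "e1 \<notin> X" "e2 \<notin> X" "E \<notin> X"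
    and Q': "\<Q>' = insert U (\<Q> - {Q1, Q2})"
  shows "represents f' \<Q>' (insert E X) \<longleftrightarrow> represents f \<Q> (insert e1 (insert e2 X))" (is ?A)
    and "represents f' \<Q>' X \<longleftrightarrow> represents f \<Q> (insert e1 X) \<or> represents f \<Q> (insert e2 X)" (is ?B)
    and "\<not> (represents f \<Q> (insert e1 X) \<and> represents f \<Q> (insert e2 X))" (is ?C)
proof -
  have s: "represents f' \<Q>' Y \<longleftrightarrow> (\<exists>!x. x \<in> Y \<and> f' x = U) \<and> (\<forall>Q\<in>\<Q> - {Q1, Q2}. \<exists>!x. x \<in> Y \<and> f' x = Q)" for Y
    by (auto simp: represents_def Q')
  have split: "(\<forall>Q\<in>\<Q>. P Q) \<longleftrightarrow> P Q1 \<and> P Q2 \<and> (\<forall>Q\<in>\<Q> - {Q1, Q2}. P Q)" for P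
    using Q(1,2) by blast
  have t: "represents f \<Q> Y \<longleftrightarrow> (\<exists>!x. x \<in> Y \<and> f x = Q1) \<and> (\<exists>!x. x \<in> Y \<and> f x = Q2) \<and>
     (\<forall>Q\<in>\<Q> - {Q1, Q2}. \<exists>!x. x \<in> Y \<and> f x = Q)" for Y
    unfolding represents_def by (rule split)
  have r1: "x \<in> X \<and> f' x = Q \<longleftrightarrow> x \<in> X \<and> f x = Q" if "Q \<in> \<Q> - {Q1, Q2}" for Q x
    using f'[of x] that Q(4) by (cases "x \<in> X") (auto split: if_splits)
  have r2: "x \<in> insert E X \<and> f' x = Q \<longleftrightarrow> x \<in> X \<and> f x = Q" if "Q \<in> \<Q> - {Q1, Q2}" for Q x
    using r1[OF that, of x] that Q(4,7) by (cases "x = E") auto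
  have r4: "x \<in> insert e1 X \<and> f x = Q \<longleftrightarrow> x \<in> X \<and> f x = Q" if "Q \<in> \<Q> - {Q1, Q2}" for Q x
    using that Q(5) by (cases "x = e1") auto
  have r5: "x \<in> insert e2 X \<and> f x = Q \<longleftrightarrow> x \<in> X \<and> f x = Q" if "Q \<in> \<Q> - {Q1, Q2}" for Q x
    using that Q(6) by (cases "x = e2") auto
  have r3: "x \<in> insert e1 (insert e2 X) \<and> f x = Q \<longleftrightarrow> x \<in> X \<and> f x = Q" if "Q \<in> \<Q> - {Q1, Q2}" for Q x
    using r4[OF that, of x] r5[OF that, of x] by blast
  have u: "x \<in> X \<and> f' x = U \<longleftrightarrow> x \<in> X \<and> (f x = Q1 \<or> f x = Q2)" for x
    using f' X Q(4) by (metis image_subset_iff)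
  have u1: "x \<in> insert E X \<and> f' x = U \<longleftrightarrow> x = E \<or> x \<in> X \<and> (f x = Q1 \<or> f x = Q2)" for x
    using u[of x] Q(7) by blast
  have a1: "x \<in> insert e1 (insert e2 X) \<and> f x = Q1 \<longleftrightarrow> x = e1 \<or> x \<in> X \<and> f x = Q1" for x
    using Q(3,5,6) by blast
  have a2: "x \<in> insert e1 (insert e2 X) \<and> f x = Q2 \<longleftrightarrow> x = e2 \<or> x \<in> X \<and> f x = Q2" for x
    using Q(3,5,6) by blast
  have b1: "x \<in> insert e1 X \<and> f x = Q1 \<longleftrightarrow> x = e1 \<or> x \<in> X \<and> f x = Q1" for x using Q(5) by blast
  have b2: "x \<in> insert e1 X \<and> f x = Q2 \<longleftrightarrow> x \<in> X \<and> f x = Q2" for x using Q(3,5) by blast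
  have c1: "x \<in> insert e2 X \<and> f x = Q1 \<longleftrightarrow> x \<in> X \<and> f x = Q1" for x using Q(3,6) by blast
  have c2: "x \<in> insert e2 X \<and> f x = Q2 \<longleftrightarrow> x = e2 \<or> x \<in> X \<and> f x = Q2" for x using Q(6) by blast
  have ex1: "(\<exists>!x. x = z \<or> x \<in> X \<and> P x) \<longleftrightarrow> \<not> (\<exists>x\<in>X. P x)" if "z \<notin> X" for z P
    using that by blast
  have "(\<exists>!x. x = E \<or> x \<in> X \<and> (f x = Q1 \<or> f x = Q2)) \<longleftrightarrow>
     (\<exists>!x. x = e1 \<or> x \<in> X \<and> f x = Q1) \<and> (\<exists>!x. x = e2 \<or> x \<in> X \<and> f x = Q2)"
    unfolding ex1[OF e(1)] ex1[OF e(2)] ex1[OF e(3)] by blast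
  moreover have "(\<forall>Q\<in>\<Q> - {Q1, Q2}. \<exists>!x. x \<in> insert E X \<and> f' x = Q) \<longleftrightarrow>
     (\<forall>Q\<in>\<Q> - {Q1, Q2}. \<exists>!x. x \<in> insert e1 (insert e2 X) \<and> f x = Q)"
    by (rule ball_cong[OF refl]) (simp only: r2 r3)
  ultimately show ?A unfolding s t u1 a1 a2 by (simp only: conj_assoc)
  have B1: "(\<exists>!x. x \<in> X \<and> (f x = Q1 \<or> f x = Q2)) \<longleftrightarrow>
     (\<exists>!x. x = e1 \<or> x \<in> X \<and> f x = Q1) \<and> (\<exists>!x. x \<in> X \<and> f x = Q2) \<or>
     (\<exists>!x. x \<in> X \<and> f x = Q1) \<and> (\<exists>!x. x = e2 \<or> x \<in> X \<and> f x = Q2)"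
    unfolding ex1[OF e(1)] ex1[OF e(2)] using Q(3) by blast
  have B2: "(\<forall>Q\<in>\<Q> - {Q1, Q2}. \<exists>!x. x \<in> X \<and> f' x = Q) \<longleftrightarrow>
     (\<forall>Q\<in>\<Q> - {Q1, Q2}. \<exists>!x. x \<in> insert e1 X \<and> f x = Q)"
    and B3: "(\<forall>Q\<in>\<Q> - {Q1, Q2}. \<exists>!x. x \<in> X \<and> f' x = Q) \<longleftrightarrow>
     (\<forall>Q\<in>\<Q> - {Q1, Q2}. \<exists>!x. x \<in> insert e2 X \<and> f x = Q)"
    by (rule ball_cong[OF refl]; simp only: r1 r4 r5)+
  note B4 = trans[OF B2[symmetric] B3]
  show ?B unfolding s t u b1 b2 c1 c2 by (simp only: B1 B2 B4 conj_disj_distribR conj_assoc)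
  show ?C unfolding t b1 b2 c1 c2 ex1[OF e(1)] ex1[OF e(2)] by blast
qed

lemma represents_ex: "represents f \<Q> X \<Longrightarrow> q \<in> \<Q> \<Longrightarrow> \<exists>x\<in>X. f x = q"
  unfolding represents_def by blast

lemma represents_unique:
  "represents f \<Q> X \<Longrightarrow> f x \<in> \<Q> \<Longrightarrow> x \<in> X \<Longrightarrow> y \<in> X \<Longrightarrow> f x = f y \<Longrightarrow> x = y"
  unfolding represents_def by metis

lemma represents_cong:
  "(\<And>x. x \<in> X \<Longrightarrow> f x = g x) \<Longrightarrow> represents f \<Q> X = represents g \<Q> X"
  unfolding represents_def by (intro ball_cong refl ex_cong1 arg_cong[of _ _ Ex1] ext) auto

text \<open>\<open>D\<close> is the diagram and \<open>H\<close> the union of all diagrams up to now, so that the components of \<open>H\<close>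
  are those of the cobordism; \<open>s\<close> counts the splits. In the alternative \<open>\<omega> = 0\<close> the cobordism has
  a component of positive genus.\<close>

definition hull_of :: "nat set set \<Rightarrow> nat set \<Rightarrow> nat set" where
  "hull_of H x = \<Union> (circle_of H ` x)"

lemma hull_of_circle:
  assumes "D \<subseteq> H" shows "hull_of H (circle_of D v) = circle_of H v"
proof -
  have "circle_of H w = circle_of H v" if "w \<in> circle_of D v" for w
    using that circle_of_mono[OF assms, of v] by (intro circle_of_eqI) auto
  then have "circle_of H ` circle_of D v = (\<lambda>_. circle_of H v) ` circle_of D v"
    by (rule image_cong[OF refl])
  moreover have "circle_of D v \<noteq> {}" using circle_of_self[of v D] by blast
  ultimately show ?thesis unfolding hull_of_def by simp
qed

definition cobordism_state :: "nat set \<Rightarrow> nat set set \<Rightarrow> nat set set \<Rightarrow> nat \<Rightarrow> exterior \<Rightarrow> bool" where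
  "cobordism_state V D H s \<omega> \<longleftrightarrow>
    \<omega> \<in> exterior_algebra (circle_of D ` V) \<and>
    (\<forall>v\<in>V. \<forall>w\<in>circle_of H v. iota (circle_of D v) \<omega> = iota (circle_of D w) \<omega>) \<and>
    (\<omega> = 0 \<and> card (circle_of D ` V) < s + card (circle_of H ` V) \<or>
     regular_element (hull_of H) (circle_of D ` V) (circle_of H ` V) \<omega> \<and>
       card (circle_of D ` V) = s + card (circle_of H ` V))"

text \<open>One circle from each class gives a transversal, hence a coefficient 1 or -1. This makes
  the two alternatives in \<open>cobordism_state\<close> exclusive.\<close>

lemma regular_nonzero:
  assumes "D \<subseteq> H" "regular_element (hull_of H) (circle_of D ` V) (circle_of H ` V) \<omega>"
  shows "\<omega> \<noteq> 0"
proof -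
  let ?S = "circle_of D ` V" and ?Q = "circle_of H ` V"
  define g where "g = (\<lambda>Q. SOME v. v \<in> V \<and> circle_of H v = Q)"
  have g: "g Q \<in> V \<and> circle_of H (g Q) = Q" if "Q \<in> ?Q" for Q
  proof -
    from that obtain v where "v \<in> V \<and> circle_of H v = Q" by blast
    then show ?thesis unfolding g_def by (rule someI)
  qed
  let ?X = "(\<lambda>Q. circle_of D (g Q)) ` ?Q"
  have "?X \<subseteq> ?S" using g by auto
  moreover have "represents (hull_of H) ?Q ?X"
    unfolding represents_def
  proof
    fix Q assume "Q \<in> ?Q"
    then show "\<exists>!x. x \<in> ?X \<and> hull_of H x = Q"
      using g hull_of_circle[OF assms(1)] by (intro ex1I[of _ "circle_of D (g Q)"]) auto
  qed
  ultimately have "cotransversal (hull_of H) ?S ?Q (?S - ?X)"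
    unfolding cotransversal_def by (auto simp: double_diff)
  then have "\<bar>Poly_Mapping.lookup \<omega> (?S - ?X)\<bar> = 1" using assms(2) by (simp add: regular_element_def)
  then show ?thesis by auto
qed

section \<open>The effect of one merge or split on a regular element\<close>

locale graph_pair =
  fixes V :: "nat set" and D H D' H' :: "nat set set"
  assumes fin: "finite V" and DH: "D \<subseteq> H" "D' \<subseteq> H'" and HV: "\<Union>H \<subseteq> V" "\<Union>H' \<subseteq> V"
begin

lemma DV: "\<Union>D \<subseteq> V" "\<Union>D' \<subseteq> V" using DH HV Union_mono[of D H] Union_mono[of D' H'] by (metis order_trans)+

lemma keyed_D: "keyed (circle_of D ` V)" "keyed (circle_of D' ` V)"
  using keyed_circles[OF fin] DV by auto

lemma merge_map:
  assumes m: "merged (circle_of D) (circle_of D') u l" and ul: "u \<in> V" "l \<in> V"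
  defines "m \<equiv> \<lambda>s. if s = circle_of D u \<or> s = circle_of D l then circle_of D' u else s"
  shows "m (circle_of D v) = circle_of D' v" and "m ` circle_of D ` V \<subseteq> circle_of D' ` V"
proof -
  show *: "m (circle_of D v) = circle_of D' v" for v
    using m unfolding merged_def m_def by (metis Un_iff circle_of_eq circle_of_self circle_of_sym)
  then show "m ` circle_of D ` V \<subseteq> circle_of D' ` V" by auto
qed

text \<open>Splits plus components of the cobordism minus outgoing circles is the total genus.
  Merging circles of different components preserves it, and the coefficients follow
  \<open>represents_merge\<close>. Merging within one component raises it by one: there
  \<open>\<omega>\<close> is annihilated by the difference of the two circles, and identifying them
  sends it to zero.\<close>

lemma merge_state:
  assumes m: "merged (circle_of D) (circle_of D') u l" and ul: "u \<in> V" "l \<in> V"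
    and H': "circle_of H' = circle_of (insert {u, l} H)"
    and st: "cobordism_state V D H s \<omega>"
    and killed: "\<forall>v\<in>V. \<forall>w\<in>circle_of H' v. iota (circle_of D' v) y = iota (circle_of D' w) y"
    and y: "y = exterior_map (\<lambda>s. if s = circle_of D u \<or> s = circle_of D l then circle_of D' u else s) \<omega>"
  shows "cobordism_state V D' H' s y"
proof -
  define m where "m = (\<lambda>s. if s = circle_of D u \<or> s = circle_of D l then circle_of D' u else s)"
  note mm = merge_map[OF m ul, folded m_def]
  let ?S = "circle_of D ` V" and ?S' = "circle_of D' ` V"
  let ?Q = "circle_of H ` V" and ?Q' = "circle_of H' ` V"
  define e1 e2 E where "e1 = circle_of D u" and "e2 = circle_of D l" and "E = circle_of D' u"
  define R where "R = ?S - {e1, e2}"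
  have ne: "e1 \<noteq> e2" using m by (simp add: merged_def e1_def e2_def)
  have E: "E = e1 \<union> e2" using m by (simp add: merged_def e1_def e2_def E_def)
  have ES: "E \<notin> ?S" using merged_new[OF m] E e1_def e2_def by auto
  have S': "?S' = insert E R" using merged_image[OF m ul] by (simp add: E e1_def e2_def R_def)
  have cS: "card ?S = Suc (card ?S')" using merged_card[OF m ul fin] .
  have kS: "keyed ?S" "keyed ?S'" using keyed_D by auto
  have kR: "keyed R" using kS(1) by (rule keyed_subset) (auto simp: R_def)
  have eS: "e1 \<in> ?S" "e2 \<in> ?S" using ul by (auto simp: e1_def e2_def)
  have m_e: "m e1 = E" "m e2 = E" by (auto simp: m_def e1_def e2_def E_def)
  have w: "\<omega> \<in> exterior_algebra ?S" using st by (simp add: cobordism_state_def)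
  have y': "y = exterior_map m \<omega>" by (simp add: y m_def)
  have yS: "y \<in> exterior_algebra ?S'" unfolding y'
    by (rule exterior_map_closed[OF kS mm(2) w])
  have cQ: "card ?Q = (if l \<in> circle_of H u then card ?Q' else Suc (card ?Q'))"
    unfolding H' using circle_of_insert_same[of l H u] merged_card[OF merged_insert ul fin, of H] by auto
  show ?thesis
  proof (cases "\<omega> = 0")
    case True
    then have "y = 0" by (simp add: y' lin_zero)
    moreover have "card ?S < s + card ?Q"
      using st True regular_nonzero[OF DH(1)] by (auto simp: cobordism_state_def)
    ultimately show ?thesis using yS killed cS cQ by (auto simp: cobordism_state_def split: if_splits)
  next
    case False
    then have reg: "regular_element (hull_of H) ?S ?Q \<omega>" and s: "card ?S = s + card ?Q"
      using st by (auto simp: cobordism_state_def)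
    obtain x1 x2 where x: "x1 \<in> exterior_algebra (?S - {e1})" "x2 \<in> exterior_algebra (?S - {e1})" "\<omega> = iota e1 x1 + x2"
      using exterior_decompose[OF kS(1) eS(1) w] by blast
    have k1: "keyed (?S - {e1})" using kS(1) by (rule keyed_subset) auto
    have e2': "e2 \<in> ?S - {e1}" using eS ne by auto
    have RR: "?S - {e1} - {e2} = R" by (auto simp: R_def)
    obtain \<gamma> \<alpha> where g: "\<gamma> \<in> exterior_algebra R" "\<alpha> \<in> exterior_algebra R" "x1 = iota e2 \<gamma> + \<alpha>"
      using exterior_decompose[OF k1 e2' x(1)] unfolding RR by blast
    obtain \<beta> \<delta> where d: "\<beta> \<in> exterior_algebra R" "\<delta> \<in> exterior_algebra R" "x2 = iota e2 \<beta> + \<delta>"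
      using exterior_decompose[OF k1 e2' x(2)] unfolding RR by blast
    have RS: "R \<subseteq> ?S" "R \<subseteq> ?S'" by (auto simp: R_def S')
    have inS: "z \<in> exterior_algebra ?S" "exterior_map m z = z" if "z \<in> exterior_algebra R" for z
    proof -
      show "z \<in> exterior_algebra ?S" by (rule subsetD[OF exterior_algebra_mono[OF RS(1)] that])
      show "exterior_map m z = z"
        by (rule exterior_map_fixed[OF kR that]) (auto simp: R_def m_def e1_def e2_def)
    qed
    have mi: "exterior_map m (iota v z) = iota (m v) (exterior_map m z)" if "v \<in> ?S" "z \<in> exterior_algebra ?S" for v z
      by (rule exterior_map_iota[OF kS mm(2) that(2,1)])
    \<comment> \<open>Of the four parts with respect to \<open>e1\<close> and \<open>e2\<close>, the
      merge kills the one that contains both circles and adds up the two that contain one of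
      them.\<close>
    have w4: "\<omega> = iota e1 (iota e2 \<gamma>) + iota e1 \<alpha> + iota e2 \<beta> + \<delta>"
      using x g d by (simp add: lin_add)
    have y4: "y = iota E (\<alpha> + \<beta>) + \<delta>"
      unfolding y' w4 using g d eS
      by (simp add: lin_add[OF lin_exterior_map] mi inS exterior_algebra_iota m_e iota_iota lin_add[OF lin_iota])
    have eR: "e1 \<notin> R" "e2 \<notin> R" "E \<notin> R" using ES RS by (auto simp: R_def)
    have nin: "e1 \<notin> B" "e2 \<notin> B" "E \<notin> B" if "B \<subseteq> R" for B using eR that by auto
    have lw: "Poly_Mapping.lookup \<omega> B = Poly_Mapping.lookup \<delta> B"
      "\<bar>Poly_Mapping.lookup \<omega> (insert e1 B)\<bar> = \<bar>Poly_Mapping.lookup \<alpha> B\<bar>"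
      "\<bar>Poly_Mapping.lookup \<omega> (insert e2 B)\<bar> = \<bar>Poly_Mapping.lookup \<beta> B\<bar>" if "B \<subseteq> R" for B
    proof -
      have "Poly_Mapping.lookup \<delta> (insert e1 B) = 0" "Poly_Mapping.lookup \<delta> (insert e2 B) = 0"
        "Poly_Mapping.lookup \<gamma> B = Poly_Mapping.lookup \<gamma> B"
        using d eR by (auto intro!: lookup_outside)
      then show "Poly_Mapping.lookup \<omega> B = Poly_Mapping.lookup \<delta> B"
        "\<bar>Poly_Mapping.lookup \<omega> (insert e1 B)\<bar> = \<bar>Poly_Mapping.lookup \<alpha> B\<bar>"
        "\<bar>Poly_Mapping.lookup \<omega> (insert e2 B)\<bar> = \<bar>Poly_Mapping.lookup \<beta> B\<bar>"
        unfolding w4 using nin[OF that] ne by (simp_all add: lookup_add lookup_iota abs_mult)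
    qed
    show ?thesis
    proof (cases "l \<in> circle_of H u")
      case True
      then have k: "iota e1 \<omega> = iota e2 \<omega>" using st ul by (auto simp: cobordism_state_def e1_def e2_def)
      \<comment> \<open>Every term of \<open>iota e2 \<omega>\<close> contains \<open>e2\<close>, so
        the coefficients of \<open>iota e1 \<omega>\<close> at sets with \<open>e1\<close> and
        without \<open>e2\<close> vanish; up to sign they are the coefficients of
        \<open>\<delta>\<close>.\<close>
      have "\<delta> = 0"
      proof (rule poly_mapping_eqI)
        fix B show "Poly_Mapping.lookup \<delta> B = Poly_Mapping.lookup 0 B"
        proof (cases "B \<subseteq> R")
          case True
          then have "Poly_Mapping.lookup (iota e1 \<omega>) (insert e1 B) = Poly_Mapping.lookup (iota e2 \<omega>) (insert e1 B)"
            using k by simp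
          then show ?thesis using nin[OF True] ne lw(1)[OF True]
            by (simp add: lookup_iota_insert) (simp add: lookup_iota)
        next
          case False then show ?thesis using d lookup_outside by simp
        qed
      qed
      have a12: "iota e1 (iota e2 z) = - iota e2 (iota e1 z)" if "z \<in> exterior_algebra R" for z
      proof -
        have "Min e1 \<noteq> Min e2" using kS(1) eS ne by (meson inj_onD keyed_def)
        then show ?thesis by (rule iota_anticomm[OF that finite_subset[OF RS(1) finite_imageI[OF fin]]])
      qed
      have "iota e1 \<omega> = iota e1 (iota e2 \<beta>)" 
        unfolding w4 using \<open>\<delta> = 0\<close> by (simp add: lin_add[OF lin_iota] iota_iota lin_zero)
      moreover have "iota e2 \<omega> = - iota e1 (iota e2 \<alpha>)"
      proof -
        have "iota e2 (iota e1 (iota e2 \<gamma>)) = - iota e1 (iota e2 (iota e2 \<gamma>))"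
        proof -
          have "Min e2 \<noteq> Min e1" using kS(1) eS ne by (metis inj_onD keyed_def)
          then show ?thesis
            by (rule iota_anticomm[OF exterior_algebra_iota[OF eS(2) inS(1)[OF g(1)]], rotated]) (simp add: fin)
        qed
        then show ?thesis unfolding w4 using \<open>\<delta> = 0\<close> a12[OF g(2)]
          by (simp add: lin_add[OF lin_iota] iota_iota lin_zero)
      qed
      ultimately have z: "iota e1 (iota e2 (\<alpha> + \<beta>)) = 0"
        using k unfolding lin_add[OF lin_iota] by (metis add.right_inverse add.commute)
      have ab: "\<alpha> + \<beta> \<in> exterior_algebra R" using g d exterior_algebra_add by auto
      have "iota e2 (\<alpha> + \<beta>) \<in> exterior_algebra (insert e2 R)"
        using ab exterior_algebra_mono[of R "insert e2 R"] by (intro exterior_algebra_iota) auto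
      \<comment> \<open>Multiplication by a circle is injective on elements that do not involve it;
        this is applied to \<open>e1\<close> and then to \<open>e2\<close>.\<close>
      then have "iota e2 (\<alpha> + \<beta>) = 0" using z eR(1) ne iota_eq_0[OF _ _ z, of "insert e2 R"] by blast
      then have "\<alpha> + \<beta> = 0" using iota_eq_0[OF ab eR(2)] by simp
      then have "y = 0" using y4 \<open>\<delta> = 0\<close> by (simp add: lin_zero)
      then show ?thesis using yS killed cS cQ s True by (auto simp: cobordism_state_def)
    next
      case F: False
      define Q1 Q2 where "Q1 = circle_of H u" and "Q2 = circle_of H l"
      have mH: "merged (circle_of H) (circle_of H') u l" unfolding H' using F by (rule merged_insert)
      have QQ: "?Q' = insert (Q1 \<union> Q2) (?Q - {Q1, Q2})"
        using merged_image[OF mH ul] by (simp add: Q1_def Q2_def)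
      have Q12: "Q1 \<in> ?Q" "Q2 \<in> ?Q" "Q1 \<noteq> Q2" "Q1 \<union> Q2 \<notin> ?Q"
        using ul mH merged_new[OF mH] by (auto simp: Q1_def Q2_def merged_def)
      let ?f = "hull_of H" and ?f' = "hull_of H'"
      have f: "?f e1 = Q1" "?f e2 = Q2" "?f' E = Q1 \<union> Q2"
        using hull_of_circle[OF DH(1)] hull_of_circle[OF DH(2)] mH
        by (simp_all add: e1_def e2_def E_def Q1_def Q2_def merged_def)
      have f': "?f' x = (if ?f x = Q1 \<or> ?f x = Q2 then Q1 \<union> Q2 else ?f x)" if "x \<in> R" for x
      proof -
        have "x \<in> ?S" "x \<in> ?S'" using that RS by auto
        then obtain v where v: "v \<in> V" "x = circle_of D v" by auto
        have "circle_of D' v = x"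
          using mm(1)[of v] v that by (auto simp: m_def R_def e1_def e2_def)
        then have "?f' x = circle_of H' v" "?f x = circle_of H v"
          using hull_of_circle[OF DH(1)] hull_of_circle[OF DH(2)] v by metis+
        moreover have "v \<in> circle_of H w \<longleftrightarrow> circle_of H v = circle_of H w" for w
          by (metis circle_of_eq circle_of_sym)
        ultimately show ?thesis using mH by (simp add: merged_def Q1_def Q2_def)
      qed
      have fQ: "?f ` R \<subseteq> ?Q" using RS hull_of_circle[OF DH(1)] by (auto simp: R_def)
      have rep: "represents ?f' ?Q' (insert E X) \<longleftrightarrow> represents ?f ?Q (insert e1 (insert e2 X))"
        "represents ?f' ?Q' X \<longleftrightarrow> represents ?f ?Q (insert e1 X) \<or> represents ?f ?Q (insert e2 X)"
        "\<not> (represents ?f ?Q (insert e1 X) \<and> represents ?f ?Q (insert e2 X))" if "X \<subseteq> R" for X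
      proof -
        have X: "\<And>x. x \<in> X \<Longrightarrow> ?f' x = (if ?f x = Q1 \<or> ?f x = Q2 then Q1 \<union> Q2 else ?f x)" "?f ` X \<subseteq> ?Q"
          using f' fQ that by blast+
        note r = represents_merge[OF X Q12 f nin[OF that] QQ]
        show "represents ?f' ?Q' (insert E X) \<longleftrightarrow> represents ?f ?Q (insert e1 (insert e2 X))" by (rule r(1))
        show "represents ?f' ?Q' X \<longleftrightarrow> represents ?f ?Q (insert e1 X) \<or> represents ?f ?Q (insert e2 X)" by (rule r(2))
        show "\<not> (represents ?f ?Q (insert e1 X) \<and> represents ?f ?Q (insert e2 X))" by (rule r(3))
      qed
      have reg': "\<bar>Poly_Mapping.lookup \<omega> A\<bar> = (if cotransversal ?f ?S ?Q A then 1 else 0)" for A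
        using reg by (simp add: regular_element_def)
      have "\<bar>Poly_Mapping.lookup y B\<bar> = (if cotransversal ?f' ?S' ?Q' B then 1 else 0)" for B
      proof (cases "B \<subseteq> ?S'")
        case False
        then show ?thesis using yS by (simp add: lookup_outside cotransversal_def)
      next
        case BS: True
        show ?thesis
        proof (cases "E \<in> B")
          case False
          then have BR: "B \<subseteq> R" using BS S' by auto
          have "?S' - B = insert E (R - B)" "?S - B = insert e1 (insert e2 (R - B))"
            using BR eR eS unfolding S' R_def by auto
          then have "cotransversal ?f' ?S' ?Q' B \<longleftrightarrow> cotransversal ?f ?S ?Q B"
            using rep(1)[of "R - B"] BS BR RS by (auto simp: cotransversal_def)
          moreover have "Poly_Mapping.lookup y B = Poly_Mapping.lookup \<omega> B"
            using lw(1)[OF BR] False by (simp add: y4 lookup_add lookup_iota)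
          ultimately show ?thesis using reg' by simp
        next
          case True
          define X where "X = B - {E}"
          have XR: "X \<subseteq> R" and BX: "B = insert E X" using BS S' True by (auto simp: X_def)
          have d1: "?S' - B = R - X" "?S - insert e1 X = insert e2 (R - X)" "?S - insert e2 X = insert e1 (R - X)"
            using XR eR eS ne unfolding S' R_def BX by auto
          have i1: "insert e1 X \<subseteq> ?S" "insert e2 X \<subseteq> ?S" using XR RS eS by auto
          have "Poly_Mapping.lookup \<delta> B = 0" using d eR BX by (intro lookup_outside) auto
          \<comment> \<open>Both old circles feed the coefficient at a set containing
            \<open>E\<close>; by the third part of \<open>represents_merge\<close> at most one of
            the two summands is nonzero.\<close>
          then have "\<bar>Poly_Mapping.lookup y B\<bar> = \<bar>Poly_Mapping.lookup \<alpha> X + Poly_Mapping.lookup \<beta> X\<bar>"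
            using True by (simp add: y4 lookup_add lookup_iota abs_mult X_def)
          moreover have "\<bar>Poly_Mapping.lookup \<alpha> X\<bar> = (if represents ?f ?Q (insert e2 (R - X)) then 1 else 0)"
            using reg'[of "insert e1 X"] lw(2)[OF XR] i1 d1 by (simp add: cotransversal_def)
          moreover have "\<bar>Poly_Mapping.lookup \<beta> X\<bar> = (if represents ?f ?Q (insert e1 (R - X)) then 1 else 0)"
            using reg'[of "insert e2 X"] lw(3)[OF XR] i1 d1 by (simp add: cotransversal_def)
          moreover have "cotransversal ?f' ?S' ?Q' B \<longleftrightarrow>
              represents ?f ?Q (insert e1 (R - X)) \<or> represents ?f ?Q (insert e2 (R - X))"
            using rep(2)[of "R - X"] BS d1 by (auto simp: cotransversal_def)
          ultimately show ?thesis using rep(3)[of "R - X"] by (auto split: if_splits)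
        qed
      qed
      then have "regular_element ?f' ?S' ?Q' y" by (simp add: regular_element_def)
      moreover have "card ?S' = s + card ?Q'" using cS cQ s F by simp
      ultimately show ?thesis using yS killed by (simp add: cobordism_state_def)
    qed
  qed
qed

text \<open>The map sends the split circle to its piece through \<open>u\<close>. For vertices on
  the other piece this is the wrong value; the second alternative records the error, which the
  factor given by the difference of the pieces absorbs.\<close>

lemma split_map:
  assumes m: "merged (circle_of D') (circle_of D) u j" and uj: "u \<in> V" "j \<in> V"
  defines "m \<equiv> \<lambda>s. if s = circle_of D u then circle_of D' u else s"
  shows "m (circle_of D v) = circle_of D' v \<or>
      m (circle_of D v) = circle_of D' u \<and> circle_of D' v = circle_of D' j"
    and "m ` circle_of D ` V \<subseteq> circle_of D' ` V"
proof -
  show *: "m (circle_of D v) = circle_of D' v \<or>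
      m (circle_of D v) = circle_of D' u \<and> circle_of D' v = circle_of D' j" for v
  proof (cases "v \<in> circle_of D' u \<union> circle_of D' j")
    case True
    then have "circle_of D v = circle_of D u" using m by (simp add: merged_def)
    then show ?thesis using True circle_of_eqI[of v D' u] circle_of_eqI[of v D' j] by (auto simp: m_def)
  next
    case False
    then have "circle_of D v = circle_of D' v" using m by (simp add: merged_def)
    moreover have "circle_of D v \<noteq> circle_of D u"
    proof
      assume "circle_of D v = circle_of D u"
      moreover have "v \<in> circle_of D v" by simp
      moreover have "circle_of D u = circle_of D' u \<union> circle_of D' j" using m by (simp add: merged_def)
      ultimately show False using False by blast
    qed
    ultimately show ?thesis by (simp add: m_def)
  qed
  show "m ` circle_of D ` V \<subseteq> circle_of D' ` V" using * uj by fastforce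
qed

text \<open>A split adds a circle to an existing class. Representatives may use either piece in
  place of the old circle but not both, and the difference of the pieces supplies exactly the
  corresponding terms.\<close>

lemma split_state:
  assumes m: "merged (circle_of D') (circle_of D) u j" and uj: "u \<in> V" "j \<in> V"
    and H': "circle_of H' = circle_of H"
    and st: "cobordism_state V D H s \<omega>"
    and killed: "\<forall>v\<in>V. \<forall>w\<in>circle_of H' v. iota (circle_of D' v) y = iota (circle_of D' w) y"
    and Y: "Y = exterior_map (\<lambda>s. if s = circle_of D u then circle_of D' u else s) \<omega>"
    and y: "y = iota (circle_of D' u) Y - iota (circle_of D' j) Y"
  shows "cobordism_state V D' H' (Suc s) y"
proof -
  define m where "m = (\<lambda>s. if s = circle_of D u then circle_of D' u else s)"
  note mm = split_map[OF m uj, folded m_def]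
  let ?S = "circle_of D ` V" and ?S' = "circle_of D' ` V" and ?Q = "circle_of H ` V"
  define e1 e2 E where "e1 = circle_of D' u" and "e2 = circle_of D' j" and "E = circle_of D u"
  define R where "R = ?S' - {e1, e2}"
  have ne: "e1 \<noteq> e2" using m by (simp add: merged_def e1_def e2_def)
  have E: "E = e1 \<union> e2" using m by (simp add: merged_def e1_def e2_def E_def)
  have ES: "E \<notin> ?S'" using merged_new[OF m] E e1_def e2_def by auto
  have S: "?S = insert E R" using merged_image[OF m uj] by (simp add: E e1_def e2_def R_def)
  have cS: "card ?S' = Suc (card ?S)" using merged_card[OF m uj fin] .
  have kS: "keyed ?S" "keyed ?S'" using keyed_D by auto
  have RS: "R \<subseteq> ?S" "R \<subseteq> ?S'" by (auto simp: R_def S)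
  have kR: "keyed R" using kS(1) RS(1) by (rule keyed_subset)
  have eS: "e1 \<in> ?S'" "e2 \<in> ?S'" "E \<in> ?S" using uj by (auto simp: e1_def e2_def E_def)
  have w: "\<omega> \<in> exterior_algebra ?S" using st by (simp add: cobordism_state_def)
  have Y': "Y = exterior_map m \<omega>" by (simp add: Y m_def)
  have YS: "Y \<in> exterior_algebra ?S'" unfolding Y' by (rule exterior_map_closed[OF kS mm(2) w])
  have y': "y = iota e1 Y - iota e2 Y" by (simp add: y e1_def e2_def)
  have yS: "y \<in> exterior_algebra ?S'" unfolding y'
    using YS eS by (intro exterior_algebra_diff exterior_algebra_iota)
  show ?thesis
  proof (cases "\<omega> = 0 \<and> card ?S < s + card ?Q")
    case True
    then have "y = 0" by (simp add: y' Y' lin_zero)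
    then show ?thesis using yS killed cS True by (simp add: cobordism_state_def H')
  next
    case False
    then have reg: "regular_element (hull_of H) ?S ?Q \<omega>" and s: "card ?S = s + card ?Q"
      using st by (auto simp: cobordism_state_def)
    have RR: "?S - {E} = R" using S ES RS by auto
    obtain \<alpha> \<delta> where x: "\<alpha> \<in> exterior_algebra R" "\<delta> \<in> exterior_algebra R" "\<omega> = iota E \<alpha> + \<delta>"
      using exterior_decompose[OF kS(1) eS(3) w] unfolding RR by blast
    have inS: "z \<in> exterior_algebra ?S" "exterior_map m z = z" if "z \<in> exterior_algebra R" for z
    proof -
      show "z \<in> exterior_algebra ?S" by (rule subsetD[OF exterior_algebra_mono[OF RS(1)] that])
      show "exterior_map m z = z"
        by (rule exterior_map_fixed[OF kR that]) (use ES RS in \<open>auto simp: m_def E_def\<close>)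
    qed
    have "exterior_map m (iota E \<alpha>) = iota (m E) (exterior_map m \<alpha>)"
      by (rule exterior_map_iota[OF kS mm(2) inS(1)[OF x(1)] eS(3)])
    then have Y2: "Y = iota e1 \<alpha> + \<delta>"
      unfolding Y' x(3) using inS(2) x by (simp add: lin_add m_def E_def e1_def)
    have y3: "y = iota e1 \<delta> - iota e2 (iota e1 \<alpha>) - iota e2 \<delta>"
      unfolding y' Y2 by (simp add: lin_add[OF lin_iota] iota_iota)
    have eR: "e1 \<notin> R" "e2 \<notin> R" "E \<notin> R" using ES RS by (auto simp: R_def)
    let ?f = "hull_of H" and ?f' = "hull_of H'"
    define Q0 where "Q0 = ?f E"
    have HE: "circle_of H u = circle_of H j"
    proof -
      have "circle_of D u = circle_of D j" using m by (simp add: merged_def)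
      then have "j \<in> circle_of D u" by simp
      then show ?thesis using circle_of_mono[OF DH(1)] circle_of_eqI by blast
    qed
    have f: "?f' e1 = Q0" "?f' e2 = Q0" "?f E = Q0" "Q0 \<in> ?Q"
      using hull_of_circle[OF DH(1)] hull_of_circle[OF DH(2)] H' HE uj
      by (simp_all add: e1_def e2_def E_def Q0_def)
    have f': "?f' x = ?f x" for x by (simp add: hull_of_def H')
    have reg': "\<bar>Poly_Mapping.lookup \<omega> A\<bar> = (if cotransversal ?f ?S ?Q A then 1 else 0)" for A
      using reg by (simp add: regular_element_def)
    have lw: "Poly_Mapping.lookup \<omega> B = Poly_Mapping.lookup \<delta> B"
      "\<bar>Poly_Mapping.lookup \<omega> (insert E B)\<bar> = \<bar>Poly_Mapping.lookup \<alpha> B\<bar>" if "B \<subseteq> R" for B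
    proof -
      have "Poly_Mapping.lookup \<delta> (insert E B) = 0" using x eR by (auto intro!: lookup_outside)
      moreover have "E \<notin> B" using that eR by auto
      ultimately show "Poly_Mapping.lookup \<omega> B = Poly_Mapping.lookup \<delta> B"
        "\<bar>Poly_Mapping.lookup \<omega> (insert E B)\<bar> = \<bar>Poly_Mapping.lookup \<alpha> B\<bar>"
        unfolding x(3) by (simp_all add: lookup_add lookup_iota abs_mult)
    qed
    have swap: "represents ?f ?Q (insert e X) \<longleftrightarrow> represents ?f ?Q (insert E X)"
      if "e \<notin> X" "E \<notin> X" "?f e = Q0" for e X
    proof -
      have *: "(\<exists>!x. x \<in> insert z X \<and> ?f x = Q) \<longleftrightarrow> (if Q = Q0 then \<not> (\<exists>x\<in>X. ?f x = Q) else \<exists>!x. x \<in> X \<and> ?f x = Q)"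
        if "z \<notin> X" "?f z = Q0" for z Q
      proof (cases "Q = Q0")
        case True
        have "(\<exists>!x. x \<in> insert z X \<and> ?f x = Q0) \<longleftrightarrow> \<not> (\<exists>x\<in>X. ?f x = Q0)" using that by blast
        then show ?thesis using True by simp
      next
        case False
        then have "x \<in> insert z X \<and> ?f x = Q \<longleftrightarrow> x \<in> X \<and> ?f x = Q" for x using that by blast
        then show ?thesis using False by simp
      qed
      have "(\<exists>!x. x \<in> insert e X \<and> ?f x = Q) \<longleftrightarrow> (\<exists>!x. x \<in> insert E X \<and> ?f x = Q)" for Q
        unfolding *[OF that(1,3)] *[OF that(2) f(3)] ..
      then show ?thesis by (simp add: represents_def)
    qed
    have "\<bar>Poly_Mapping.lookup y B\<bar> = (if cotransversal ?f ?S' ?Q B then 1 else 0)" for B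
    proof (cases "B \<subseteq> ?S'")
      case False
      then show ?thesis using yS by (simp add: lookup_outside cotransversal_def)
    next
      case BS: True
      define X where "X = B - {e1, e2}"
      have XR: "X \<subseteq> R" using BS by (auto simp: X_def R_def)
      have nX: "e1 \<notin> X" "e2 \<notin> X" "E \<notin> X" using XR eR by auto
      have XS: "X \<subseteq> ?S" "insert E X \<subseteq> ?S" using XR RS eS by auto
      have out: "Poly_Mapping.lookup \<delta> A = 0" "Poly_Mapping.lookup \<alpha> A = 0" if "e1 \<in> A \<or> e2 \<in> A" for A
        using that eR x by (auto intro!: lookup_outside)
      have S'R: "?S' = insert e1 (insert e2 R)" using eS by (auto simp: R_def)
      \<comment> \<open>Representatives are the circles outside \<open>B\<close>. Containing both
        pieces means that another circle represents the class, containing one means that the other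
        piece does, and containing none would give two representatives.\<close>
      consider "e1 \<in> B" "e2 \<in> B" | "e1 \<in> B" "e2 \<notin> B" | "e1 \<notin> B" "e2 \<in> B" | "e1 \<notin> B" "e2 \<notin> B" by blast
      then show ?thesis
      proof cases
        case 1
        then have B: "B - {e2} - {e1} = X" by (auto simp: X_def)
        have "\<bar>Poly_Mapping.lookup y B\<bar> = \<bar>Poly_Mapping.lookup \<alpha> X\<bar>"
          using 1 ne out B by (simp add: y3 lookup_minus lookup_iota abs_mult)
        moreover have "?S' - B = R - X" "?S - insert E X = R - X"
        proof -
          have "B = insert e1 (insert e2 X)" using 1 by (auto simp: X_def)
          then show "?S' - B = R - X" "?S - insert E X = R - X" unfolding S'R S using eR by blast+
        qed
        ultimately show ?thesis using reg'[of "insert E X"] lw(2)[OF XR] BS XS by (simp add: cotransversal_def)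
      next
        case 2
        then have B: "B - {e1} = X" by (auto simp: X_def)
        have "\<bar>Poly_Mapping.lookup y B\<bar> = \<bar>Poly_Mapping.lookup \<delta> X\<bar>"
          using 2 ne out B by (simp add: y3 lookup_minus lookup_iota abs_mult)
        moreover have "?S' - B = insert e2 (R - X)" "?S - X = insert E (R - X)"
        proof -
          have "B = insert e1 X" using 2 B by blast
          then show "?S' - B = insert e2 (R - X)" "?S - X = insert E (R - X)"
            unfolding S'R S using eR ne nX by blast+
        qed
        moreover have "represents ?f ?Q (insert e2 (R - X)) \<longleftrightarrow> represents ?f ?Q (insert E (R - X))"
          using eR f f' by (intro swap) auto
        ultimately show ?thesis using reg'[of X] lw(1)[OF XR] BS XS by (simp add: cotransversal_def)
      next
        case 3
        then have B: "B - {e2} = X" by (auto simp: X_def)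
        have "\<bar>Poly_Mapping.lookup y B\<bar> = \<bar>Poly_Mapping.lookup \<delta> X\<bar>"
          using 3 ne out B nX by (simp add: y3 lookup_minus lookup_iota abs_mult)
        moreover have "?S' - B = insert e1 (R - X)" "?S - X = insert E (R - X)"
        proof -
          have "B = insert e2 X" using 3 B by blast
          then show "?S' - B = insert e1 (R - X)" "?S - X = insert E (R - X)"
            unfolding S'R S using eR ne nX by blast+
        qed
        moreover have "represents ?f ?Q (insert e1 (R - X)) \<longleftrightarrow> represents ?f ?Q (insert E (R - X))"
          using eR f f' by (intro swap) auto
        ultimately show ?thesis using reg'[of X] lw(1)[OF XR] BS XS by (simp add: cotransversal_def)
      next
        case 4
        have "Poly_Mapping.lookup y B = 0" using 4 by (simp add: y3 lookup_minus lookup_iota)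
        moreover have "\<not> represents ?f ?Q (?S' - B)"
        proof
          assume "represents ?f ?Q (?S' - B)"
          then have "\<exists>!x. x \<in> ?S' - B \<and> ?f x = Q0" using f(4) unfolding represents_def by (rule bspec)
          moreover have "e1 \<in> ?S' - B \<and> ?f e1 = Q0" "e2 \<in> ?S' - B \<and> ?f e2 = Q0"
            using 4 eS f f' by auto
          ultimately show False using ne by blast
        qed
        ultimately show ?thesis by (simp add: cotransversal_def)
      qed
    qed
    then have "regular_element ?f' ?S' ?Q y"
      using f' by (simp add: regular_element_def cotransversal_def represents_def)
    moreover have "card ?S' = Suc s + card ?Q" using cS s by simp
    ultimately show ?thesis using yS killed by (simp add: cobordism_state_def H')
  qed
qed

end

text \<open>Before any surgery every class is a single circle that represents itself, so the unit is
  the regular element.\<close>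

lemma initial_state:
  assumes "finite V" "\<Union>D \<subseteq> V"
  shows "cobordism_state V D D 0 unit_ext"
proof -
  let ?S = "circle_of D ` V"
  have "represents (hull_of D) ?S X \<longleftrightarrow> X = ?S" if "X \<subseteq> ?S" for X
  proof -
    have "hull_of D x = x" if "x \<in> ?S" for x using that hull_of_circle[of D D] by auto
    then have "represents (hull_of D) ?S X = represents (\<lambda>x. x) ?S X"
      using that by (intro represents_cong) blast
    also have "\<dots> \<longleftrightarrow> X = ?S" unfolding represents_def using that by blast
    finally show ?thesis .
  qed
  from this[of "?S - A" for A] have "cotransversal (hull_of D) ?S ?S A \<longleftrightarrow> A = {}" for A
    unfolding cotransversal_def by blast
  then have "regular_element (hull_of D) ?S ?S unit_ext"
    by (simp add: regular_element_def unit_ext_def)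
  moreover have "iota (circle_of D v) unit_ext = iota (circle_of D w) unit_ext" if "w \<in> circle_of D v" for v w
    using circle_of_eqI[OF that] by simp
  ultimately show ?thesis unfolding cobordism_state_def by simp
qed

text \<open>A regular element generates the elements of its degree annihilated by all differences of
  circles in one class: such an element is determined by one coefficient, since exchanging two
  circles of a class changes it by a sign that does not depend on the element.\<close>

definition homogeneous :: "nat \<Rightarrow> exterior \<Rightarrow> bool" where
  "homogeneous k x \<longleftrightarrow> (\<forall>A. Poly_Mapping.lookup x A \<noteq> 0 \<longrightarrow> card A = k)"

lemma regular_generates:
  assumes DH: "D \<subseteq> H" and fin: "finite V" and HV: "\<Union>H \<subseteq> V"
    and st: "cobordism_state V D H s \<omega>" and nz: "\<omega> \<noteq> 0"
    and \<eta>: "\<eta> \<in> exterior_algebra (circle_of D ` V)" "homogeneous s \<eta>"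
    and killed: "\<And>v w. v \<in> V \<Longrightarrow> w \<in> circle_of H v \<Longrightarrow> iota (circle_of D v) \<eta> = iota (circle_of D w) \<eta>"
  obtains k where "\<eta> = frag_cmul k \<omega>"
proof -
  let ?S = "circle_of D ` V" and ?Q = "circle_of H ` V" and ?f = "hull_of H"
  have reg: "\<bar>Poly_Mapping.lookup \<omega> A\<bar> = (if cotransversal ?f ?S ?Q A then 1 else 0)" for A
    using st nz by (simp add: cobordism_state_def regular_element_def)
  have cS: "card ?S = s + card ?Q" and w: "\<omega> \<in> exterior_algebra ?S"
    using st nz by (simp_all add: cobordism_state_def)
  have fS: "finite ?S" using fin by simp
  have same: "iota x \<omega> = iota y \<omega>" "iota x \<eta> = iota y \<eta>" if xy: "x \<in> ?S" "y \<in> ?S" "?f x = ?f y" for x y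
  proof -
    obtain u v where u: "u \<in> V" "x = circle_of D u" and v: "v \<in> V" "y = circle_of D v" using xy by auto
    have "circle_of H u = circle_of H v" using xy u v hull_of_circle[OF DH] by simp
    then have "v \<in> circle_of H u" by simp
    then show "iota x \<omega> = iota y \<omega>" "iota x \<eta> = iota y \<eta>"
      using u v killed st by (auto simp: cobordism_state_def)
  qed
  have fQ: "?f x \<in> ?Q" if "x \<in> ?S" for x using that hull_of_circle[OF DH] by auto
  \<comment> \<open>Annihilation by differences forbids two circles of one class outside
    \<open>A\<close>, and the degree leaves exactly as many circles outside \<open>A\<close> as
    there are classes.\<close>
  have supp: "cotransversal ?f ?S ?Q A" if nzA: "Poly_Mapping.lookup \<eta> A \<noteq> 0" for A
  proof -
    have AS: "A \<subseteq> ?S" using nzA \<eta>(1) lookup_outside by blast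
    have cA: "card A = s" using nzA \<eta>(2) by (simp add: homogeneous_def)
    have inj: "inj_on ?f (?S - A)"
    proof (rule inj_onI, rule ccontr)
      fix x y assume xy: "x \<in> ?S - A" "y \<in> ?S - A" "?f x = ?f y" "x \<noteq> y"
      then have "Poly_Mapping.lookup (iota x \<eta>) (insert x A) = Poly_Mapping.lookup (iota y \<eta>) (insert x A)"
        using same[of x y] by simp
      moreover have "Poly_Mapping.lookup (iota y \<eta>) (insert x A) = 0" using xy by (simp add: lookup_iota)
      ultimately show False using xy nzA by (simp add: lookup_iota_insert)
    qed
    have "card (?S - A) = card ?Q" using cS cA AS fS by (simp add: card_Diff_subset finite_subset)
    then have "card (?f ` (?S - A)) = card ?Q" using inj by (simp add: card_image)
    then have im: "?f ` (?S - A) = ?Q" using fQ fin by (intro card_subset_eq) auto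
    have "represents ?f ?Q (?S - A)"
      unfolding represents_def
    proof
      fix Q assume "Q \<in> ?Q"
      then obtain x where "x \<in> ?S - A" "?f x = Q" using im by (metis (no_types, lifting) imageE)
      then show "\<exists>!x. x \<in> ?S - A \<and> ?f x = Q" using inj by (metis (no_types, lifting) inj_onD)
    qed
    then show ?thesis using AS by (simp add: cotransversal_def)
  qed
  \<comment> \<open>The sign comes from positions inside \<open>insert x A\<close> alone, hence is
    the same for both elements.\<close>
  have step: "\<exists>\<epsilon>\<in>{-1, 1::int}. Poly_Mapping.lookup z (insert x (A - {y})) = \<epsilon> * Poly_Mapping.lookup z A \<and>
       Poly_Mapping.lookup z' (insert x (A - {y})) = \<epsilon> * Poly_Mapping.lookup z' A"
    if xy: "y \<in> A" "x \<notin> A" and e: "iota x z = iota y z" "iota x z' = iota y z'" for x y A z z'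
  proof -
    define B where "B = insert x A"
    define p q where "p = (- 1 :: int) ^ card {w\<in>B - {x}. Min w < Min x}" and "q = (- 1 :: int) ^ card {w\<in>B - {y}. Min w < Min y}"
    have pq: "p = 1 \<or> p = -1" "q = 1 \<or> q = -1" unfolding p_def q_def by (metis neg_one_even_power neg_one_odd_power)+
    have BB: "B - {x} = A" "B - {y} = insert x (A - {y})" using xy by (auto simp: B_def)
    have "p * Poly_Mapping.lookup z A = q * Poly_Mapping.lookup z (insert x (A - {y}))"
      "p * Poly_Mapping.lookup z' A = q * Poly_Mapping.lookup z' (insert x (A - {y}))"
      using arg_cong[OF e(1), of "\<lambda>u. Poly_Mapping.lookup u B"] arg_cong[OF e(2), of "\<lambda>u. Poly_Mapping.lookup u B"] xy
      unfolding lookup_iota p_def q_def BB by (auto simp: B_def)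
    then show ?thesis using pq by (intro bexI[of _ "p * q"]) auto
  qed
  have ratio: "Poly_Mapping.lookup \<eta> A * Poly_Mapping.lookup \<omega> B = Poly_Mapping.lookup \<eta> B * Poly_Mapping.lookup \<omega> A"
    if "cotransversal ?f ?S ?Q A" "cotransversal ?f ?S ?Q B" for A B
    using that(1)
  \<comment> \<open>One circle of \<open>A - B\<close> is exchanged at a time against the
    representative of its class, which lies in \<open>B\<close>.\<close>
  proof (induction "card (A - B)" arbitrary: A rule: less_induct)
    case less
    have AS: "A \<subseteq> ?S" "represents ?f ?Q (?S - A)" and BS: "B \<subseteq> ?S" "represents ?f ?Q (?S - B)"
      using less.prems that(2) by (simp_all add: cotransversal_def)
    show ?case
    proof (cases "A \<subseteq> B")
      case True
      have "B \<subseteq> A"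
      proof
        fix x assume x: "x \<in> B"
        show "x \<in> A"
        proof (rule ccontr)
          assume "x \<notin> A"
          have xS: "x \<in> ?S" using x BS(1) by (rule rev_subsetD)
          obtain x' where x': "x' \<in> ?S - B" "?f x' = ?f x"
            using represents_ex[OF BS(2) fQ[OF xS]] by metis
          then have "x' \<in> ?S - A" "x' \<noteq> x" using True x by blast+
          moreover have "x \<in> ?S - A" using xS \<open>x \<notin> A\<close> by blast
          ultimately show False using represents_unique[OF AS(2) fQ[OF xS]] x'(2) by metis
        qed
      qed
      then show ?thesis using True by simp
    next
      case False
      then obtain y where y: "y \<in> A" "y \<notin> B" by auto
      have yS: "y \<in> ?S" using y AS by auto
      obtain x where x: "x \<in> ?S - A" "?f x = ?f y" using represents_ex[OF AS(2) fQ[OF yS]] by metis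
      have xB: "x \<in> B"
      proof (rule ccontr)
        assume "x \<notin> B"
        then have "x \<in> ?S - B" "y \<in> ?S - B" "x \<noteq> y" using x(1) y yS by blast+
        then show False using represents_unique[OF BS(2) fQ[OF yS]] x(2) by metis
      qed
      let ?A = "insert x (A - {y})"
      have SA: "?S - ?A = insert y (?S - A - {x})" using x y yS AS by auto
      have "represents ?f ?Q (?S - ?A)"
        unfolding represents_def SA
      proof
        fix Q assume Q: "Q \<in> ?Q"
        have u: "\<exists>!z. z \<in> ?S - A \<and> ?f z = Q" by (rule bspec[OF AS(2)[unfolded represents_def] Q])
        show "\<exists>!z. z \<in> insert y (?S - A - {x}) \<and> ?f z = Q"
        proof (cases "Q = ?f y")
          case True
          then have "z = x" if "z \<in> ?S - A" "?f z = Q" for z using u x that by blast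
          then show ?thesis using True by (intro ex1I[of _ y]) auto
        next
          case False
          then have "z \<in> insert y (?S - A - {x}) \<and> ?f z = Q \<longleftrightarrow> z \<in> ?S - A \<and> ?f z = Q" for z
            using x by auto
          then show ?thesis using u by simp
        qed
      qed
      then have ct: "cotransversal ?f ?S ?Q ?A" using AS x by (auto simp: cotransversal_def)
      have "?A - B \<subset> A - B" using xB y by auto
      then have "card (?A - B) < card (A - B)" using AS fS by (intro psubset_card_mono) (auto intro: finite_subset)
      then have IH: "Poly_Mapping.lookup \<eta> ?A * Poly_Mapping.lookup \<omega> B = Poly_Mapping.lookup \<eta> B * Poly_Mapping.lookup \<omega> ?A"
        using less.hyps ct by blast
      have xS: "x \<in> ?S" "x \<notin> A" using x(1) by blast+
      obtain \<epsilon> where "\<epsilon> = -1 \<or> \<epsilon> = (1::int)" "Poly_Mapping.lookup \<eta> ?A = \<epsilon> * Poly_Mapping.lookup \<eta> A"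
        "Poly_Mapping.lookup \<omega> ?A = \<epsilon> * Poly_Mapping.lookup \<omega> A"
        using step[OF y(1) xS(2) same(2)[OF xS(1) yS x(2)] same(1)[OF xS(1) yS x(2)]] by blast
      then show ?thesis using IH by auto
    qed
  qed
  obtain B where "Poly_Mapping.lookup \<omega> B \<noteq> 0" using nz by (metis lookup_zero poly_mapping_eqI)
  then have B: "cotransversal ?f ?S ?Q B" "Poly_Mapping.lookup \<omega> B = 1 \<or> Poly_Mapping.lookup \<omega> B = -1"
    using reg[of B] by (auto split: if_splits)
  \<comment> \<open>The coefficient of \<open>\<omega>\<close> at \<open>B\<close> is 1 or -1, so
    multiplying by it divides by it.\<close>
  define k where "k = Poly_Mapping.lookup \<eta> B * Poly_Mapping.lookup \<omega> B"
  have "\<eta> = frag_cmul k \<omega>"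
  proof (rule poly_mapping_eqI)
    fix A
    show "Poly_Mapping.lookup \<eta> A = Poly_Mapping.lookup (frag_cmul k \<omega>) A"
    proof (cases "cotransversal ?f ?S ?Q A")
      case True
      then show ?thesis using ratio[OF True B(1)] B(2) by (auto simp: k_def)
    next
      case False
      then show ?thesis using supp[of A] reg[of A] by auto
    qed
  qed
  then show ?thesis using that by blast
qed

section \<open>The product of two components\<close>

lemma frag_cmul_uminus: "frag_cmul k (- x) = frag_cmul (- k) x"
  by (rule poly_mapping_eqI) simp

lemma bipartite_matching_unique:
  assumes "bipartite_matching V col M" "A \<in> M" "B \<in> M" "x \<in> A" "x \<in> B" shows "A = B"
proof -
  have "disjoint M" using assms(1) by (simp add: bipartite_matching_def)
  then show ?thesis using assms(2-5) by (metis IntI disjointD empty_iff)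
qed

lemma bipartite_matching_edge:
  assumes "bipartite_matching V col M" "{i, j} \<in> M" shows "col i \<noteq> col j"
proof -
  obtain x y where "{i, j} = {x, y}" "col x" "\<not> col y"
    using assms unfolding bipartite_matching_def by meson
  then show ?thesis by (metis doubleton_eq_iff)
qed

text \<open>The reversed colouring is allowed for the sake of the lower copies, which carry the
  opposite colours.\<close>

lemma bipartite_matching_image:
  assumes M: "bipartite_matching V col M" and inj: "inj_on f V"
    and col: "(\<forall>v\<in>V. col' (f v) = col v) \<or> (\<forall>v\<in>V. col' (f v) = (\<not> col v))"
  shows "bipartite_matching (f ` V) col' ((`) f ` M)"
proof -
  have U: "\<Union>M = V" "finite V" "disjoint M" and e: "\<And>e. e \<in> M \<Longrightarrow> \<exists>x y. e = {x, y} \<and> col x \<and> \<not> col y"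
    using M by (auto simp: bipartite_matching_def)
  have "disjoint ((`) f ` M)"
    unfolding disjoint_def
  proof (intro ballI impI)
    fix X Y assume "X \<in> (`) f ` M" "Y \<in> (`) f ` M" "X \<noteq> Y"
    then obtain A B where AB: "A \<in> M" "B \<in> M" "X = f ` A" "Y = f ` B" "A \<noteq> B" by auto
    then have "A \<inter> B = {}" "A \<subseteq> V" "B \<subseteq> V" using U by (auto simp: disjoint_def)
    then show "X \<inter> Y = {}" using inj AB by (metis inj_on_image_Int image_empty)
  qed
  moreover have "\<Union>((`) f ` M) = f ` V" using U by auto
  moreover have "\<exists>x y. e' = {x, y} \<and> col' x \<and> \<not> col' y" if e': "e' \<in> (`) f ` M" for e'
  proof -
    obtain e0 where e0: "e0 \<in> M" "e' = f ` e0" using e' by auto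
    obtain x y where xy: "e0 = {x, y}" "col x" "\<not> col y" using e[OF e0(1)] by auto
    have "x \<in> V" "y \<in> V" using U(1) e0(1) xy(1) by blast+
    then have "col' (f x) \<noteq> col' (f y)" using col xy(2,3) by metis
    moreover have "e' = {f x, f y}" "e' = {f y, f x}" unfolding e0(2) xy(1) by auto
    ultimately show ?thesis by metis
  qed
  ultimately show ?thesis using U(2) by (simp add: bipartite_matching_def)
qed

lemma bipartite_matching_union:
  assumes "bipartite_matching V col M" "bipartite_matching W col N" "V \<inter> W = {}"
  shows "bipartite_matching (V \<union> W) col (M \<union> N)"
  using assms unfolding bipartite_matching_def disjoint_def by (auto 0 3; blast)

lemma bipartite_matching_subset:
  assumes "bipartite_matching V col M" "T \<subseteq> M"
  shows "bipartite_matching (\<Union>T) col T"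
proof -
  have M: "finite (\<Union>M)" "disjoint M" "\<forall>e\<in>M. \<exists>x y. e = {x, y} \<and> col x \<and> \<not> col y"
    using assms(1) by (simp_all add: bipartite_matching_def)
  have "finite (\<Union>T)" by (rule finite_subset[OF Union_mono[OF assms(2)] M(1)])
  moreover have "disjoint T" by (rule pairwise_subset[OF M(2) assms(2)])
  moreover have "\<forall>e\<in>T. \<exists>x y. e = {x, y} \<and> col x \<and> \<not> col y" using M(3) assms(2) by blast
  ultimately show ?thesis by (simp add: bipartite_matching_def)
qed

lemma bipartite_matching_minus:
  assumes M: "bipartite_matching V col M" and T: "T \<subseteq> M"
  shows "bipartite_matching (V - \<Union>T) col (M - T)"
proof -
  have "\<Union>(M - T) = V - \<Union>T"
  proof -
    have "A = B" if "A \<in> M" "B \<in> M" "x \<in> A" "x \<in> B" for x A B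
      using M that unfolding bipartite_matching_def disjoint_def by blast
    moreover have "\<Union>M = V" using M by (simp add: bipartite_matching_def)
    ultimately show ?thesis using T by blast
  qed
  then show ?thesis using bipartite_matching_subset[OF M, of "M - T"] by simp
qed

section \<open>The stacked diagram and its surgeries\<close>

definition vertices :: "nat \<Rightarrow> nat set" where
  "vertices n = upper ` {1..2 * n} \<union> lower ` {1..2 * n}"

text \<open>The two copies of a point get opposite colours, so vertical segments join different
  colours just as arcs do, and every intermediate diagram stays bipartite.\<close>

definition colour :: "nat \<Rightarrow> bool" where
  "colour v \<longleftrightarrow> odd (point v) = even v"

lemma point_upper [simp]: "point (upper i) = i" and point_lower [simp]: "point (lower i) = i"
  by (simp_all add: point_def upper_def lower_def)

lemma even_upper [simp]: "even (upper i)" and odd_lower [simp]: "odd (lower i)"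
  by (simp_all add: upper_def lower_def)

lemma upper_inject [simp]: "upper i = upper j \<longleftrightarrow> i = j" and lower_inject [simp]: "lower i = lower j \<longleftrightarrow> i = j"
  and upper_neq_lower [simp]: "upper i \<noteq> lower j" and lower_neq_upper [simp]: "lower i \<noteq> upper j"
  unfolding upper_def lower_def by presburger+

lemma colour_upper [simp]: "colour (upper i) \<longleftrightarrow> odd i" and colour_lower [simp]: "colour (lower i) \<longleftrightarrow> even i"
  by (simp_all add: colour_def)

lemma inj_upper: "inj_on upper A" and inj_lower: "inj_on lower A"
  by (auto simp: inj_on_def)

definition verticals :: "nat set \<Rightarrow> nat set set" where
  "verticals X = (\<lambda>i. {upper i, lower i}) ` X"

lemma bipartite_matching_verticals:
  assumes "finite X" shows "bipartite_matching (upper ` X \<union> lower ` X) colour (verticals X)"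
  unfolding bipartite_matching_def
proof (intro conjI ballI)
  show "disjoint (verticals X)" by (auto simp: disjoint_def verticals_def)
  fix e assume "e \<in> verticals X"
  then obtain i where i: "e = {upper i, lower i}" by (auto simp: verticals_def)
  show "\<exists>x y. e = {x, y} \<and> colour x \<and> \<not> colour y"
  proof (cases "odd i")
    case True then show ?thesis using i by (intro exI[of _ "upper i"] exI[of _ "lower i"]) auto
  next
    case False then show ?thesis using i by (intro exI[of _ "lower i"] exI[of _ "upper i"]) auto
  qed
qed (use assms in \<open>auto simp: verticals_def\<close>)

abbreviation is_matching :: "nat \<Rightarrow> matching \<Rightarrow> bool" where
  "is_matching n \<equiv> bipartite_matching {1..2 * n} odd"

locale three_matchings =
  fixes n :: nat and c b a :: matching
  assumes mc: "is_matching n c" and mb: "is_matching n b" and ma: "is_matching n a"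
begin

abbreviation "V \<equiv> vertices n"
abbreviation "D \<equiv> diagram c b a"
abbreviation "D0 \<equiv> diagram c b a {}"

definition history :: "nat set set \<Rightarrow> nat set set" where
  "history T = D0 \<union> verticals (\<Union>T)"

abbreviation "S T \<equiv> circle_of (D T) ` V"
abbreviation "cc T \<equiv> circle_of (D T)"

lemma U: "\<Union>c = {1..2 * n}" "\<Union>b = {1..2 * n}" "\<Union>a = {1..2 * n}"
  using mc mb ma by (simp_all add: bipartite_matching_def)

lemma finV [simp]: "finite V" by (simp add: vertices_def)

lemma upper_V [simp]: "i \<in> {1..2 * n} \<Longrightarrow> upper i \<in> V" and lower_V [simp]: "i \<in> {1..2 * n} \<Longrightarrow> lower i \<in> V"
  by (auto simp: vertices_def)

lemma diagram_alt: "D T = (`) upper ` (c \<union> (b - T)) \<union> (`) lower ` ((b - T) \<union> a) \<union> verticals (\<Union>T)"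
  by (simp add: diagram_def verticals_def)

lemma verticals_V: "T \<subseteq> b \<Longrightarrow> \<Union>(verticals (\<Union>T)) \<subseteq> V"
  using U by (force simp: verticals_def vertices_def)

lemma diagram_V: "T \<subseteq> b \<Longrightarrow> \<Union>(D T) \<subseteq> V"
proof -
  assume T: "T \<subseteq> b"
  have "X \<in> c \<union> b \<union> a \<Longrightarrow> X \<subseteq> {1..2 * n}" for X using U by blast
  then have "X \<in> c \<union> b \<union> a \<Longrightarrow> upper ` X \<subseteq> V \<and> lower ` X \<subseteq> V" for X
    by (auto simp: vertices_def)
  then show ?thesis using verticals_V[OF T] unfolding diagram_alt by blast
qed

lemma history_V: "T \<subseteq> b \<Longrightarrow> \<Union>(history T) \<subseteq> V"
  using verticals_V diagram_V[of "{}"] by (simp add: history_def)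

lemma diagram_history: "D T \<subseteq> history T"
  by (auto simp: diagram_alt history_def verticals_def)

lemma keyed_S: "T \<subseteq> b \<Longrightarrow> keyed (S T)"
  using keyed_circles[OF finV diagram_V] .

text \<open>In \<open>exchange_edges\<close> the arcs of \<open>c\<close> and \<open>a\<close> form
  the untouched matching, while \<open>M\<close> consists of the other arcs of \<open>b\<close> and
  the vertical segments. The first end must have the colour true, so for even \<open>i\<close> the
  arc is read backwards.\<close>

lemma surgery_alternatives:
  assumes T: "T \<subseteq> b" and ij: "{i, j} \<in> b" "{i, j} \<notin> T"
  shows "merged (cc T) (cc (insert {i, j} T)) (upper i) (lower i) \<and>
      upper j \<in> cc T (upper i) \<and> lower j \<in> cc T (lower i) \<or>
    merged (cc (insert {i, j} T)) (cc T) (upper i) (upper j) \<and>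
      lower i \<in> cc (insert {i, j} T) (upper i) \<and> lower j \<in> cc (insert {i, j} T) (upper j)"
proof -
  let ?T = "insert {i, j} T"
  have TT: "?T \<subseteq> b" using T ij by auto
  have ijn: "i \<in> {1..2 * n}" "j \<in> {1..2 * n}" using ij(1) U(2) by blast+
  have par: "odd i \<noteq> odd j" by (rule bipartite_matching_edge[OF mb ij(1)])
  let ?N = "(`) upper ` c \<union> (`) lower ` a"
  let ?M = "(`) upper ` (b - ?T) \<union> (`) lower ` (b - ?T) \<union> verticals (\<Union>T)"
  have N: "bipartite_matching V colour ?N"
    unfolding vertices_def
    by (intro bipartite_matching_union bipartite_matching_image[OF mc] bipartite_matching_image[OF ma])
      (auto intro: inj_upper inj_lower)
  have dis: "\<Union>T \<inter> {i, j} = {}"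
    using bipartite_matching_unique[OF mb _ ij(1)] T ij(2) by blast
  have UT: "\<Union>?T = \<Union>T \<union> {i, j}" by auto
  have bT: "bipartite_matching ({1..2 * n} - \<Union>?T) odd (b - ?T)" by (rule bipartite_matching_minus[OF mb TT])
  have finT: "finite (\<Union>T)" using T U by (metis Union_mono finite_atLeastAtMost finite_subset)
  have M1: "bipartite_matching (upper ` ({1..2 * n} - \<Union>?T) \<union> lower ` ({1..2 * n} - \<Union>?T)) colour
      ((`) upper ` (b - ?T) \<union> (`) lower ` (b - ?T))"
    by (intro bipartite_matching_union bipartite_matching_image[OF bT]) (auto intro: inj_upper inj_lower)
  have M2: "bipartite_matching (upper ` ({1..2 * n} - \<Union>?T) \<union> lower ` ({1..2 * n} - \<Union>?T) \<union>
      (upper ` \<Union>T \<union> lower ` \<Union>T)) colour ?M"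
    by (intro bipartite_matching_union M1 bipartite_matching_verticals finT) auto
  have "\<Union>T \<subseteq> {1..2 * n}" using T U by blast
  then have Veq: "upper ` ({1..2 * n} - \<Union>?T) \<union> lower ` ({1..2 * n} - \<Union>?T) \<union> (upper ` \<Union>T \<union> lower ` \<Union>T) =
      V - {upper i, upper j, lower i, lower j}"
    using dis unfolding UT vertices_def by auto
  have M: "bipartite_matching (V - {upper i, upper j, lower i, lower j}) colour ?M"
    using M2 unfolding Veq .
  have bTT: "b - T = insert {i, j} (b - ?T)" using ij by auto
  have E: "D T = ?M \<union> {{upper i, upper j}, {lower i, lower j}} \<union> ?N"
    unfolding diagram_alt bTT image_Un by auto
  have E': "D ?T = ?M \<union> {{upper i, lower i}, {upper j, lower j}} \<union> ?N"
    unfolding diagram_alt UT verticals_def image_Un by auto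
  have sub: "{upper i, upper j, lower i, lower j} \<subseteq> V" using ijn by simp
  show ?thesis
  proof (cases "odd i")
    case True
    then show ?thesis using exchange_edges[OF N M sub _ _ _ _ _ _ E E'] par by auto
  next
    case False
    have perm: "{upper j, upper i, lower j, lower i} = {upper i, upper j, lower i, lower j}" by auto
    have F: "D T = ?M \<union> {{upper j, upper i}, {lower j, lower i}} \<union> ?N"
      unfolding E by (simp add: insert_commute)
    have F': "D ?T = ?M \<union> {{upper j, lower j}, {upper i, lower i}} \<union> ?N"
      unfolding E' by (simp add: insert_commute)
    have "merged (cc T) (cc ?T) (upper j) (lower j) \<and> upper i \<in> cc T (upper j) \<and> lower i \<in> cc T (lower j) \<or>
      merged (cc ?T) (cc T) (upper j) (upper i) \<and> lower j \<in> cc ?T (upper j) \<and> lower i \<in> cc ?T (upper i)"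
      by (rule exchange_edges[OF N _ _ _ _ _ _ _ _ F F']) (use False par M sub perm in auto)
    then show ?thesis
    proof (elim disjE conjE)
      assume a: "merged (cc T) (cc ?T) (upper j) (lower j)" "upper i \<in> cc T (upper j)" "lower i \<in> cc T (lower j)"
      have "cc T (upper j) = cc T (upper i)" "cc T (lower j) = cc T (lower i)"
        using a(2,3) circle_of_eq by blast+
      then show ?thesis using merged_cong[OF a(1)] a(2,3) circle_of_sym by blast
    next
      assume a: "merged (cc ?T) (cc T) (upper j) (upper i)" "lower j \<in> cc ?T (upper j)" "lower i \<in> cc ?T (upper i)"
      have "merged (cc ?T) (cc T) (upper i) (upper j)" using a(1) by (auto simp: merged_def Un_commute)
      then show ?thesis using a by blast
    qed
  qed
qed

text \<open>\<open>\<Phi>\<close> is the composite of the surgeries along \<open>T\<close>, and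
  \<open>s\<close> the number of splits. Each split puts one factor in front, hence the sign when a
  circle passes through. Thus \<open>\<Phi>\<close> is determined by \<open>s\<close> and by its
  value at the unit, which is the element \<open>\<omega>\<close> of the cobordism. The equation
  between cardinalities is the count of circles gained and lost.\<close>

definition stage :: "nat set set \<Rightarrow> nat \<Rightarrow> (exterior \<Rightarrow> exterior) \<Rightarrow> bool" where
  "stage T s \<Phi> \<longleftrightarrow> lin \<Phi> \<and> (\<forall>x\<in>exterior_algebra (S {}). \<Phi> x \<in> exterior_algebra (S T)) \<and>
    (\<forall>v\<in>V. \<forall>x\<in>exterior_algebra (S {}).
        \<Phi> (iota (cc {} v) x) = frag_cmul ((- 1) ^ s) (iota (cc T v) (\<Phi> x))) \<and>
    cobordism_state V (D T) (history T) s (\<Phi> unit_ext) \<and>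
    card (S T) + card T = card (S {}) + 2 * s \<and>
    (s = 0 \<longrightarrow> \<Phi> unit_ext = unit_ext)"

text \<open>Vertices joined in \<open>D0\<close> lie on one circle before the surgeries, and
  \<open>\<Phi>\<close> carries the two equal multiplications to the final diagram; vertical
  segments are present in the final diagram itself.\<close>

lemma stage_killed:
  assumes lin: "lin \<Phi>" and T: "T \<subseteq> b"
    and \<Phi>: "\<forall>v\<in>V. \<forall>x\<in>exterior_algebra (S {}). \<Phi> (iota (cc {} v) x) = frag_cmul ((- 1) ^ s) (iota (cc T v) (\<Phi> x))"
  shows "\<forall>v\<in>V. \<forall>w\<in>circle_of (history T) v. iota (cc T v) (\<Phi> unit_ext) = iota (cc T w) (\<Phi> unit_ext)"
proof (intro ballI)
  fix v w assume v: "v \<in> V" and w: "w \<in> circle_of (history T) v"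
  have cancel: "x = y" if "frag_cmul ((- 1) ^ s) x = frag_cmul ((- 1) ^ s) y" for x y :: exterior
    using arg_cong[OF that, of "frag_cmul ((- 1) ^ s)"] by (simp flip: power_mult_distrib)
  have "iota (cc T x) (\<Phi> unit_ext) = iota (cc T y) (\<Phi> unit_ext)" if xy: "{x, y} \<in> history T" for x y
  proof (cases "{x, y} \<in> D0")
    case True
    then have "cc {} x = cc {} y" by (rule circle_of_edge)
    moreover have "x \<in> V" "y \<in> V" using True diagram_V[of "{}"] by auto
    ultimately show ?thesis using \<Phi> cancel by (metis exterior_algebra_unit)
  next
    case False
    then have "{x, y} \<in> D T" using xy by (simp add: history_def diagram_alt)
    then show ?thesis using circle_of_edge by metis
  qed
  then show "iota (cc T v) (\<Phi> unit_ext) = iota (cc T w) (\<Phi> unit_ext)"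
    using circle_of_respects[OF w, of "\<lambda>x. iota (cc T x) (\<Phi> unit_ext)"] by blast
qed

lemma lin_surgery: "lin (surgery c b a T i j)"
proof (rule linI)
  fix x y
  show "surgery c b a T i j (x - y) = surgery c b a T i j x - surgery c b a T i j y"
    unfolding surgery_def Let_def by (simp add: lin_diff[OF lin_exterior_map] lin_diff[OF lin_wedge_right])
qed

text \<open>A merge is a map of exterior algebras and commutes with generators. A split multiplies
  such a map by a difference of circles, which contributes one more sign.\<close>

lemma stage_step:
  assumes st: "stage T s \<Phi>" and T: "T \<subseteq> b" and ij: "{i, j} \<in> b" "{i, j} \<notin> T"
  shows "\<exists>s'. stage (insert {i, j} T) s' (\<lambda>x. surgery c b a T i j (\<Phi> x))"
proof -
  let ?T = "insert {i, j} T"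
  have TT: "?T \<subseteq> b" using T ij by auto
  have ijV: "upper i \<in> V" "lower i \<in> V" "upper j \<in> V" "lower j \<in> V" using ij(1) U(2) by (blast intro!: upper_V lower_V)+
  have lin: "lin \<Phi>" and cl: "\<And>x. x \<in> exterior_algebra (S {}) \<Longrightarrow> \<Phi> x \<in> exterior_algebra (S T)"
    and tw: "\<And>v x. v \<in> V \<Longrightarrow> x \<in> exterior_algebra (S {}) \<Longrightarrow> \<Phi> (iota (cc {} v) x) = frag_cmul ((- 1) ^ s) (iota (cc T v) (\<Phi> x))"
    and state: "cobordism_state V (D T) (history T) s (\<Phi> unit_ext)"
    and card: "card (S T) + card T = card (S {}) + 2 * s" and s0: "s = 0 \<longrightarrow> \<Phi> unit_ext = unit_ext"
    using st by (simp_all add: stage_def)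
  have finb: "finite b" using mb by (rule bipartite_matching_finite)
  have cT: "card ?T = Suc (card T)" using ij(2) finite_subset[OF T finb] by simp
  have lin': "lin (\<lambda>x. surgery c b a T i j (\<Phi> x))" using lin_compose[OF lin_surgery lin] .
  interpret graph_pair V "D T" "history T" "D ?T" "history ?T"
    by unfold_locales (use diagram_history history_V T TT in auto)
  have verts: "history ?T = insert {upper j, lower j} (insert {upper i, lower i} (history T))"
    by (auto simp: history_def verticals_def)
  have cH: "cc T v \<subseteq> circle_of (history T) v" for v by (rule circle_of_mono[OF diagram_history])
  consider (m) "merged (cc T) (cc ?T) (upper i) (lower i)" "upper j \<in> cc T (upper i)" "lower j \<in> cc T (lower i)"
    | (s) "merged (cc ?T) (cc T) (upper i) (upper j)" "lower i \<in> cc ?T (upper i)" "lower j \<in> cc ?T (upper j)"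
    using surgery_alternatives[OF T ij] by blast
  then show ?thesis
  proof cases
    case m
    let ?m = "\<lambda>s. if s = cc T (upper i) \<or> s = cc T (lower i) then cc ?T (upper i) else s"
    note mm = merge_map[OF m(1) ijV(1,2)]
    have sur: "surgery c b a T i j = exterior_map ?m"
    proof -
      have "cc T (upper i) \<noteq> cc T (lower i)" using m(1) by (simp add: merged_def)
      then show ?thesis unfolding fun_eq_iff surgery_def Let_def by simp
    qed
    \<comment> \<open>In a merge, each copy of the arc lies on one circle, so the first vertical
      segment already connects the ends of the second one.\<close>
    have "circle_of (insert {upper i, lower i} (history T)) (upper j) = circle_of (insert {upper i, lower i} (history T)) (lower j)"
    proof -
      let ?C = "circle_of (insert {upper i, lower i} (history T))"
      have mono: "circle_of (history T) v \<subseteq> ?C v" for v by (rule circle_of_mono) auto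
      have "upper j \<in> ?C (upper i)" "lower j \<in> ?C (lower i)" using m(2,3) cH mono by blast+
      moreover have "?C (upper i) = ?C (lower i)" by (rule circle_of_edge) simp
      ultimately show ?thesis by (metis circle_of_eqI)
    qed
    then have H': "circle_of (history ?T) = circle_of (insert {upper i, lower i} (history T))"
      unfolding verts by (intro circle_of_insert_same) (simp add: circle_of_eq)
    have tw': "\<forall>v\<in>V. \<forall>x\<in>exterior_algebra (S {}). surgery c b a T i j (\<Phi> (iota (cc {} v) x)) =
        frag_cmul ((- 1) ^ s) (iota (cc ?T v) (surgery c b a T i j (\<Phi> x)))"
    proof (intro ballI)
      fix v x assume v: "v \<in> V" and x: "x \<in> exterior_algebra (S {})"
      have "exterior_map ?m (iota (cc T v) (\<Phi> x)) = iota (?m (cc T v)) (exterior_map ?m (\<Phi> x))"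
        by (rule exterior_map_iota[OF keyed_D mm(2) cl[OF x]]) (use v in simp)
      then show "surgery c b a T i j (\<Phi> (iota (cc {} v) x)) =
        frag_cmul ((- 1) ^ s) (iota (cc ?T v) (surgery c b a T i j (\<Phi> x)))"
        unfolding sur tw[OF v x] lin_cmul[OF lin_exterior_map] mm(1) by simp
    qed
    have "cobordism_state V (D ?T) (history ?T) s (surgery c b a T i j (\<Phi> unit_ext))"
      by (rule merge_state[OF m(1) ijV(1,2) H' state]) (use stage_killed[OF lin' TT tw'] sur in auto)
    moreover have "surgery c b a T i j (\<Phi> x) \<in> exterior_algebra (S ?T)" if "x \<in> exterior_algebra (S {})" for x
      unfolding sur by (rule exterior_map_closed[OF keyed_D mm(2) cl[OF that]])
    moreover have "card (S T) = Suc (card (S ?T))" by (rule merged_card[OF m(1) ijV(1,2) finV])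
    moreover have "s = 0 \<longrightarrow> surgery c b a T i j (\<Phi> unit_ext) = unit_ext" using s0 sur by simp
    ultimately have "stage ?T s (\<lambda>x. surgery c b a T i j (\<Phi> x))"
      unfolding stage_def using lin' tw' card cT by simp
    then show ?thesis by blast
  next
    case s
    let ?m = "\<lambda>s. if s = cc T (upper i) then cc ?T (upper i) else s"
    let ?u = "cc ?T (upper i)" and ?w = "cc ?T (upper j)"
    note mm = split_map[OF s(1) ijV(1,3)]
    have same: "cc T (upper i) = cc T (lower i)" "cc T (upper j) = cc T (lower j)"
    proof -
      have C: "cc T v = (if v \<in> ?u \<union> ?w then ?u \<union> ?w else cc ?T v)" for v using s(1) by (simp add: merged_def)
      show "cc T (upper i) = cc T (lower i)" "cc T (upper j) = cc T (lower j)"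
        unfolding C using s(2,3) by auto
    qed
    have uw: "?u \<in> S ?T" "?w \<in> S ?T" using ijV by auto
    define Y where "Y x = exterior_map ?m x" for x
    have linY: "lin Y" by (simp add: Y_def[abs_def])
    have Ycl: "Y x \<in> exterior_algebra (S ?T)" if "x \<in> exterior_algebra (S T)" for x
      unfolding Y_def by (rule exterior_map_closed[OF keyed_D mm(2) that])
    have sur: "surgery c b a T i j x = iota ?u (Y x) - iota ?w (Y x)" if "x \<in> exterior_algebra (S T)" for x
      using same wedge_generator[OF keyed_D(2) uw(1) Ycl[OF that]] wedge_generator[OF keyed_D(2) uw(2) Ycl[OF that]]
      by (simp add: surgery_def Let_def Y_def lin_diff[OF lin_wedge_left])
    have "circle_of (history ?T) = circle_of (history T)"
    proof -
      have 1: "lower i \<in> circle_of (history T) (upper i)" "lower j \<in> circle_of (history T) (upper j)"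
        using same cH circle_of_eq by blast+
      have 2: "circle_of (insert {upper i, lower i} (history T)) = circle_of (history T)"
        using 1 by (intro circle_of_insert_same)
      show ?thesis unfolding verts by (subst circle_of_insert_same) (use 1 2 in simp_all)
    qed
    note H' = this
    have tw': "\<forall>v\<in>V. \<forall>x\<in>exterior_algebra (S {}). surgery c b a T i j (\<Phi> (iota (cc {} v) x)) =
        frag_cmul ((- 1) ^ Suc s) (iota (cc ?T v) (surgery c b a T i j (\<Phi> x)))"
    proof (intro ballI)
      fix v x assume v: "v \<in> V" and x: "x \<in> exterior_algebra (S {})"
      let ?z = "Y (\<Phi> x)"
      have z: "?z \<in> exterior_algebra (S ?T)" by (rule Ycl[OF cl[OF x]])
      have Yi: "Y (iota (cc T v) (\<Phi> x)) = iota (?m (cc T v)) ?z"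
        unfolding Y_def by (rule exterior_map_iota[OF keyed_D mm(2) cl[OF x]]) (use v in simp)
      have vS: "cc ?T v \<in> S ?T" using v by simp
      have fS: "finite (S ?T)" by simp
      have ac: "iota p (iota q z) = - iota q (iota p z)" if "p \<in> S ?T" "q \<in> S ?T" "z \<in> exterior_algebra (S ?T)" for p q z
      proof (cases "p = q")
        case True then show ?thesis by (simp add: iota_iota)
      next
        case False
        then have "Min p \<noteq> Min q" using keyed_D(2) that(1,2) by (meson inj_onD keyed_def)
        then show ?thesis by (rule iota_anticomm[OF that(3) fS])
      qed
      have "iota ?u (iota (?m (cc T v)) ?z) - iota ?w (iota (?m (cc T v)) ?z) =
          - iota (cc ?T v) (iota ?u ?z - iota ?w ?z)"
      proof (cases "?m (cc T v) = cc ?T v")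
        case True
        show ?thesis unfolding True lin_diff[OF lin_iota]
          unfolding ac[OF vS uw(1) z] ac[OF vS uw(2) z] by simp
      next
        \<comment> \<open>Here the map has chosen the wrong piece; both sides reduce to the same
          double product because squares vanish.\<close>
        case False
        then have e: "?m (cc T v) = ?u" "cc ?T v = ?w" using mm(1)[of v] by blast+
        show ?thesis unfolding e lin_diff[OF lin_iota] iota_iota
          unfolding ac[OF uw z] by simp
      qed
      moreover have "iota (cc T v) (\<Phi> x) \<in> exterior_algebra (S T)"
        by (rule exterior_algebra_iota[OF _ cl[OF x]]) (use v in simp)
      ultimately show "surgery c b a T i j (\<Phi> (iota (cc {} v) x)) =
        frag_cmul ((- 1) ^ Suc s) (iota (cc ?T v) (surgery c b a T i j (\<Phi> x)))"
        unfolding tw[OF v x] lin_cmul[OF lin_surgery] by (simp add: sur Yi cl[OF x] frag_cmul_uminus)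
    qed
    have "cobordism_state V (D ?T) (history ?T) (Suc s) (surgery c b a T i j (\<Phi> unit_ext))"
    proof (rule split_state[OF s(1) ijV(1,3) H' state])
      show "surgery c b a T i j (\<Phi> unit_ext) = iota ?u (Y (\<Phi> unit_ext)) - iota ?w (Y (\<Phi> unit_ext))"
        using cl by (simp add: sur)
    qed (use stage_killed[OF lin' TT tw'] in \<open>auto simp: Y_def\<close>)
    moreover have "surgery c b a T i j (\<Phi> x) \<in> exterior_algebra (S ?T)" if "x \<in> exterior_algebra (S {})" for x
      using cl[OF that] uw by (simp add: sur exterior_algebra_diff exterior_algebra_iota Ycl)
    moreover have "card (S ?T) = Suc (card (S T))" by (rule merged_card[OF s(1) ijV(1,3) finV])
    ultimately have "stage ?T (Suc s) (\<lambda>x. surgery c b a T i j (\<Phi> x))"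
      unfolding stage_def using lin' tw' card cT by simp
    then show ?thesis by blast
  qed
qed

lemma oriented_arc:
  assumes R: "orientation b R" and p: "p \<in> {1..2 * n}"
  obtains i j where "oriented_arc R p = (i, j)" "{i, j} \<in> b" "p \<in> {i, j}"
proof -
  obtain A where A: "A \<in> b" "p \<in> A" using p U(2) by blast
  have bij: "bij_betw (\<lambda>(i, j). {i, j}) R b" using R by (simp add: orientation_def)
  then obtain e where e: "e \<in> R" "A = {fst e, snd e}" using A(1) by (auto simp: bij_betw_def)
  have "e' = e" if "e' \<in> R" "fst e' = p \<or> snd e' = p" for e'
  proof -
    have "(\<lambda>(i, j). {i, j}) e' \<in> b" using that(1) bij by (rule bij_betwE[rule_format, rotated])
    moreover have "p \<in> (\<lambda>(i, j). {i, j}) e'" using that(2) by (cases e') auto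
    ultimately have "(\<lambda>(i, j). {i, j}) e' = (\<lambda>(i, j). {i, j}) e"
      using bipartite_matching_unique[OF mb _ A(1) _ A(2)] e(2) by (simp add: split_beta)
    then show ?thesis using bij e(1) that(1) by (meson bij_betw_def inj_onD)
  qed
  moreover have "e \<in> R \<and> (fst e = p \<or> snd e = p)" using e A(2) by auto
  ultimately have "oriented_arc R p = e" unfolding oriented_arc_def by (intro the_equality) blast+
  then show ?thesis using that[of "fst e" "snd e"] e A by simp
qed

text \<open>Every arc is processed at the first of its ends in the list and skipped at the second,
  so the processed arcs are those that meet the points passed so far.\<close>

lemma stage_run:
  assumes R: "orientation b R"
  shows "stage T s \<Phi> \<Longrightarrow> T \<subseteq> b \<Longrightarrow> set ps \<subseteq> {1..2 * n} \<Longrightarrow>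
    \<exists>s'. stage (T \<union> {A\<in>b. A \<inter> set ps \<noteq> {}}) s' (\<lambda>x. surgeries c b a R T ps (\<Phi> x))"
proof (induction ps arbitrary: T s \<Phi>)
  case Nil
  then show ?case by auto
next
  case (Cons p ps)
  obtain i j where ij: "oriented_arc R p = (i, j)" "{i, j} \<in> b" "p \<in> {i, j}"
    using oriented_arc[OF R, of p] Cons.prems by auto
  have un: "A = {i, j}" if "A \<in> b" "p \<in> A" for A
    by (rule bipartite_matching_unique[OF mb that(1) ij(2) that(2) ij(3)])
  have eq: "insert {i, j} T \<union> {A\<in>b. A \<inter> set ps \<noteq> {}} = T \<union> {A\<in>b. A \<inter> set (p # ps) \<noteq> {}}"
  proof -
    have "A \<inter> set (p # ps) \<noteq> {} \<longleftrightarrow> p \<in> A \<or> A \<inter> set ps \<noteq> {}" for A by auto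
    then show ?thesis using un ij(2,3) by blast
  qed
  show ?case
  proof (cases "{i, j} \<in> T")
    case True
    then have "T \<union> {A\<in>b. A \<inter> set ps \<noteq> {}} = T \<union> {A\<in>b. A \<inter> set (p # ps) \<noteq> {}}"
      using eq by (simp add: insert_absorb)
    then show ?thesis using Cons.IH[OF Cons.prems(1,2)] Cons.prems(3) True by (simp add: ij)
  next
    case False
    obtain s' where "stage (insert {i, j} T) s' (\<lambda>x. surgery c b a T i j (\<Phi> x))"
      using stage_step[OF Cons.prems(1,2) ij(2) False] by blast
    then have "\<exists>s''. stage (insert {i, j} T \<union> {A\<in>b. A \<inter> set ps \<noteq> {}}) s''
        (\<lambda>x. surgeries c b a R (insert {i, j} T) ps (surgery c b a T i j (\<Phi> x)))"
      using Cons.prems ij by (intro Cons.IH) auto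
    then show ?thesis unfolding eq using False by (simp add: ij)
  qed
qed

lemma stage_initial: "stage {} 0 (\<lambda>x. x)"
proof -
  have "history {} = D0" by (simp add: history_def verticals_def)
  then show ?thesis
    using initial_state[OF finV diagram_V[of "{}"]] by (simp add: stage_def lin_def)
qed

lemma stage_final:
  assumes "orientation b R" "set ps = {1..2 * n}"
  shows "\<exists>s. stage b s (surgeries c b a R {} ps)"
proof -
  have "{} \<union> {A\<in>b. A \<inter> set ps \<noteq> {}} = b"
  proof -
    have "A \<inter> {1..2 * n} \<noteq> {}" if "A \<in> b" for A
      using that mb U(2) unfolding bipartite_matching_def by blast
    then show ?thesis using assms(2) by auto
  qed
  then show ?thesis using stage_run[OF assms(1) stage_initial, of ps] assms(2) by simp
qed

text \<open>The count of circles in \<open>stage\<close> determines the number of splits, whatever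
  the order of the surgeries.\<close>

lemma stage_degree_unique:
  assumes "stage b s \<Phi>" "stage b s' \<Phi>'" shows "s = s'"
  using assms by (simp add: stage_def)

section \<open>Circles of the initial and of the final diagram\<close>

abbreviation "cb \<equiv> circle_of (c \<union> b)"
abbreviation "ba \<equiv> circle_of (b \<union> a)"
abbreviation "ca \<equiv> circle_of (c \<union> a)"

lemma glue_circles: "glue c b = cb ` {1..2 * n}" "glue b a = ba ` {1..2 * n}" "glue c a = ca ` {1..2 * n}"
  by (simp_all only: glue_def circles_def Union_Un_distrib U Un_absorb)

lemma keyed_glue: "keyed (glue c b)" "keyed (glue b a)" "keyed (glue c a)"
  unfolding glue_circles by (rule keyed_circles; simp add: U)+

lemma initial_circle: "cc {} (upper i) = upper ` cb i" "cc {} (lower i) = lower ` ba i"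
proof -
  \<comment> \<open>Upper copies are the even vertices, so this is the expected component of each
    vertex in the disjoint union of the two diagrams.\<close>
  define f where "f x = (if even x then upper ` cb (point x) else lower ` ba (point x))" for x
  have f: "f x = f y" if "{x, y} \<in> D0" for x y
  proof -
    have "{x, y} \<in> (`) upper ` (c \<union> b) \<or> {x, y} \<in> (`) lower ` (b \<union> a)"
      using that by (simp add: diagram_alt verticals_def)
    then show ?thesis
    proof
      assume "{x, y} \<in> (`) upper ` (c \<union> b)"
      then obtain A where A: "A \<in> c \<union> b" "{x, y} = upper ` A" by auto
      then have "x \<in> upper ` A" "y \<in> upper ` A" by blast+
      then obtain i j where ij: "x = upper i" "y = upper j" "i \<in> A" "j \<in> A" by auto
      have "upper ` A = upper ` {i, j}" using A(2) ij by simp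
      then have "A = {i, j}" by (rule inj_image_eq_iff[THEN iffD1, OF inj_upper])
      then show ?thesis using A(1) circle_of_edge[of i j "c \<union> b"] by (simp add: f_def ij)
    next
      assume "{x, y} \<in> (`) lower ` (b \<union> a)"
      then obtain A where A: "A \<in> b \<union> a" "{x, y} = lower ` A" by auto
      then have "x \<in> lower ` A" "y \<in> lower ` A" by blast+
      then obtain i j where ij: "x = lower i" "y = lower j" "i \<in> A" "j \<in> A" by auto
      have "lower ` A = lower ` {i, j}" using A(2) ij by simp
      then have "A = {i, j}" by (rule inj_image_eq_iff[THEN iffD1, OF inj_lower])
      then show ?thesis using A(1) circle_of_edge[of i j "b \<union> a"] by (simp add: f_def ij)
    qed
  qed
  have self: "w \<in> f w" for w
  proof (cases "even w")
    case True
    then have "w = upper (point w)" by (simp add: upper_def point_def)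
    then show ?thesis using True by (auto simp: f_def)
  next
    case False
    then have "w = lower (point w)" by (simp add: lower_def point_def)
    then show ?thesis using False by (auto simp: f_def)
  qed
  have sub: "cc {} v \<subseteq> f v" for v
    using circle_of_respects[of _ D0 v f] f self by blast
  have "cc {} (upper i) = cc {} (upper j)" if "j \<in> cb i" for i j
  proof (rule circle_of_respects[OF that, of "\<lambda>i. cc {} (upper i)"])
    fix x y assume "{x, y} \<in> c \<union> b"
    then have "upper ` {x, y} \<in> D0" unfolding diagram_alt by blast
    then show "cc {} (upper x) = cc {} (upper y)" by (intro circle_of_edge) simp
  qed
  then have "upper ` cb i \<subseteq> cc {} (upper i)" using circle_of_eq by blast
  then show "cc {} (upper i) = upper ` cb i" using sub[of "upper i"] by (auto simp: f_def)
  have "cc {} (lower i) = cc {} (lower j)" if "j \<in> ba i" for i j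
  proof (rule circle_of_respects[OF that, of "\<lambda>i. cc {} (lower i)"])
    fix x y assume "{x, y} \<in> b \<union> a"
    then have "lower ` {x, y} \<in> D0" unfolding diagram_alt by blast
    then show "cc {} (lower x) = cc {} (lower y)" by (intro circle_of_edge) simp
  qed
  then have "lower ` ba i \<subseteq> cc {} (lower i)" using circle_of_eq by blast
  then show "cc {} (lower i) = lower ` ba i" using sub[of "lower i"] by (auto simp: f_def)
qed

lemma initial_circles: "S {} = (`) upper ` glue c b \<union> (`) lower ` glue b a"
  unfolding vertices_def image_Un image_image initial_circle glue_circles ..

lemma card_initial: "card (S {}) = card (glue c b) + card (glue b a)"
proof -
  have "upper ` X \<noteq> lower ` Y" if "X \<in> glue c b" for X Y
  proof -
    from that obtain i where "X = cb i" unfolding glue_circles by blast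
    then have "i \<in> X" by simp
    then have "upper i \<in> upper ` X" "upper i \<notin> lower ` Y" by auto
    then show ?thesis by metis
  qed
  then have "(`) upper ` glue c b \<inter> (`) lower ` glue b a = {}" by blast
  moreover have "finite (glue c b)" "finite (glue b a)" unfolding glue_circles by simp_all
  moreover have "card ((`) upper ` glue c b) = card (glue c b)" "card ((`) lower ` glue b a) = card (glue b a)"
    by (rule card_image, simp add: inj_on_def inj_image_eq_iff inj_upper inj_lower)+
  ultimately show ?thesis unfolding initial_circles by (simp add: card_Un_disjoint)
qed

lemma final_diagram: "D b = (`) upper ` c \<union> (`) lower ` a \<union> verticals {1..2 * n}"
  by (simp add: diagram_alt U)

lemma point_V: "v \<in> V \<Longrightarrow> point v \<in> {1..2 * n}"
  by (auto simp: vertices_def)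

lemma final_upper: "v \<in> V \<Longrightarrow> cc b v = cc b (upper (point v))"
proof -
  assume v: "v \<in> V"
  then obtain i where i: "i \<in> {1..2 * n}" "v = upper i \<or> v = lower i" by (auto simp: vertices_def)
  have "{upper i, lower i} \<in> D b" unfolding final_diagram verticals_def using i(1) by blast
  then have "cc b (upper i) = cc b (lower i)" by (rule circle_of_edge)
  then show ?thesis using i(2) by (elim disjE) simp_all
qed

lemma final_circle_cong: "j \<in> ca i \<Longrightarrow> i \<in> {1..2 * n} \<Longrightarrow> cc b (upper i) = cc b (upper j)"
proof (rule circle_of_respects[of _ _ _ "\<lambda>i. cc b (upper i)"])
  fix x y assume "{x, y} \<in> c \<union> a"
  then have xy: "x \<in> {1..2 * n}" "y \<in> {1..2 * n}" using U by blast+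
  show "cc b (upper x) = cc b (upper y)"
  proof (cases "{x, y} \<in> c")
    case True
    then have "upper ` {x, y} \<in> D b" unfolding final_diagram by blast
    then show ?thesis by (intro circle_of_edge) simp
  next
    case False
    then have "lower ` {x, y} \<in> D b" using \<open>{x, y} \<in> c \<union> a\<close> unfolding final_diagram by blast
    then have "cc b (lower x) = cc b (lower y)" by (intro circle_of_edge) simp
    then show ?thesis using final_upper[of "lower x"] final_upper[of "lower y"] xy by simp
  qed
qed

lemma final_circle: "v \<in> V \<Longrightarrow> point ` cc b v = ca (point v)"
proof
  assume v: "v \<in> V"
  show "point ` cc b v \<subseteq> ca (point v)"
  proof
    fix i assume "i \<in> point ` cc b v"
    then obtain w where w: "w \<in> cc b v" "i = point w" by auto
    have "ca (point v) = ca (point w)"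
    proof (rule circle_of_respects[OF w(1), of "\<lambda>x. ca (point x)"])
      fix x y assume "{x, y} \<in> D b"
      then consider A where "A \<in> c \<union> a" "{x, y} = upper ` A \<or> {x, y} = lower ` A" | i where "{x, y} = {upper i, lower i}"
        unfolding final_diagram verticals_def by blast
      then show "ca (point x) = ca (point y)"
      proof cases
        case 1
        have "point ` upper ` A = A" "point ` lower ` A = A" by (simp_all add: image_image)
        then have "point ` {x, y} = A" using 1(2) by metis
        then show ?thesis using 1(1) circle_of_edge[of "point x" "point y" "c \<union> a"] by simp
      next
        case 2 then show ?thesis by (auto simp: doubleton_eq_iff)
      qed
    qed
    then show "i \<in> ca (point v)" using w(2) by simp
  qed
  show "ca (point v) \<subseteq> point ` cc b v"
  proof
    fix i assume "i \<in> ca (point v)"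
    then have "cc b v = cc b (upper i)"
      using final_circle_cong[of i "point v"] point_V[OF v] final_upper[OF v] by simp
    then have "upper i \<in> cc b v" by simp
    then show "i \<in> point ` cc b v" by (metis image_eqI point_upper)
  qed
qed

lemma final_circles: "(`) point ` S b = glue c a"
proof -
  have "(`) point ` S b = (\<lambda>v. ca (point v)) ` V" unfolding image_image by (rule image_cong) (simp_all add: final_circle)
  also have "\<dots> = ca ` point ` V" by (simp add: image_image)
  also have "point ` V = {1..2 * n}" by (simp add: vertices_def image_Un image_image)
  finally show ?thesis by (simp add: glue_circles)
qed

lemmas keyed_final = keyed_S[OF order.refl]

text \<open>Inverse to taking points on the circles of the final diagram. A circle is given only as
  a set of points, so its least point serves as base point.\<close>

definition lift :: "nat set \<Rightarrow> nat set" where "lift X = cc b (upper (Min X))"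

lemma lift_circle: "i \<in> {1..2 * n} \<Longrightarrow> lift (ca i) = cc b (upper i)"
proof -
  assume i: "i \<in> {1..2 * n}"
  have "ca i \<subseteq> {1..2 * n}" by (rule circle_of_subset[OF _ i]) (simp add: U)
  then have "finite (ca i)" by (rule finite_subset) simp
  then have "Min (ca i) \<in> ca i" using circle_of_self by (metis Min_in empty_iff)
  then show ?thesis unfolding lift_def using final_circle_cong[OF _ i] by simp
qed

lemma lift_glue: "lift ` glue c a \<subseteq> S b"
proof
  fix X assume "X \<in> lift ` glue c a"
  then obtain i where i: "i \<in> {1..2 * n}" "X = lift (ca i)" unfolding glue_circles by blast
  show "X \<in> S b" unfolding i(2) lift_circle[OF i(1)] using i(1) by simp
qed

lemma lift_point: "X \<in> S b \<Longrightarrow> lift (point ` X) = X"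
proof -
  assume "X \<in> S b"
  then obtain v where v: "v \<in> V" "X = cc b v" by blast
  have "lift (point ` cc b v) = cc b (upper (point v))"
    unfolding final_circle[OF v(1)] by (rule lift_circle[OF point_V[OF v(1)]])
  also have "\<dots> = cc b v" by (rule final_upper[OF v(1), symmetric])
  finally show ?thesis using v(2) by simp
qed

lemma point_lift: "X \<in> glue c a \<Longrightarrow> point ` lift X = X"
proof -
  assume "X \<in> glue c a"
  then obtain i where "i \<in> {1..2 * n}" "X = ca i" unfolding glue_circles by blast
  then show ?thesis using lift_circle[of i] final_circle[of "upper i"] by simp
qed

lemma card_final: "card (S b) = card (glue c a)"
  unfolding final_circles[symmetric] by (rule card_image[symmetric], rule inj_onI) (metis lift_point)

lemma point_S: "(`) point ` S b \<subseteq> glue c a" using final_circles by simp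

lemma exterior_map_lift_point:
  assumes "x \<in> exterior_algebra (S b)" shows "exterior_map lift (exterior_map ((`) point) x) = x"
  using keyed_final assms
proof (induction x rule: exterior_induct)
  case (diff x y) then show ?case by (simp add: lin_diff[OF lin_exterior_map])
next
  case (iota x v)
  have "exterior_map ((`) point) x \<in> exterior_algebra (glue c a)"
    by (rule exterior_map_closed[OF keyed_final keyed_glue(3) point_S iota(2)])
  note 1 = exterior_map_iota[OF keyed_glue(3) keyed_final lift_glue this subsetD[OF point_S imageI[OF iota(1)]]]
  show ?case
    unfolding exterior_map_iota[OF keyed_final keyed_glue(3) point_S iota(2,1)] 1 lift_point[OF iota(1)] iota(3) ..
qed simp_all

lemma exterior_map_point_lift:
  assumes "x \<in> exterior_algebra (glue c a)" shows "exterior_map ((`) point) (exterior_map lift x) = x"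
  using keyed_glue(3) assms
proof (induction x rule: exterior_induct)
  case (diff x y) then show ?case by (simp add: lin_diff[OF lin_exterior_map])
next
  case (iota x v)
  have "exterior_map lift x \<in> exterior_algebra (S b)"
    by (rule exterior_map_closed[OF keyed_glue(3) keyed_final lift_glue iota(2)])
  note 1 = exterior_map_iota[OF keyed_final keyed_glue(3) point_S this subsetD[OF lift_glue imageI[OF iota(1)]]]
  show ?case
    unfolding exterior_map_iota[OF keyed_glue(3) keyed_final lift_glue iota(2,1)] 1 point_lift[OF iota(1)] iota(3) ..
qed simp_all

lemma homogeneous_exterior_map:
  assumes x: "x \<in> exterior_algebra X" and "keyed X" and h: "homogeneous k x"
  shows "homogeneous k (exterior_map f x)"
  unfolding homogeneous_def
proof (intro allI impI)
  fix A assume "Poly_Mapping.lookup (exterior_map f x) A \<noteq> 0"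
  then have "A \<in> Poly_Mapping.keys (exterior_map f x)" by (simp add: in_keys_iff)
  then obtain B where B: "B \<in> Poly_Mapping.keys x" "A \<in> Poly_Mapping.keys (wedge_list (map f (increasing_list B)))"
    unfolding exterior_map_def using keys_frag_extend by fastforce
  have "keyed B" using B(1) x keyed_subset[OF assms(2)] by (auto simp: exterior_algebra_def)
  then have l: "length (increasing_list B) = card B"
    by (metis distinct_card distinct_increasing_list set_increasing_list)
  have "card B = k" using h B(1) by (simp add: homogeneous_def in_keys_iff)
  moreover have "distinct (map f (increasing_list B)) \<and> A = set (map f (increasing_list B))"
    using B(2) by (auto simp: wedge_list_def split: if_splits)
  then have "card A = card B" using l distinct_card by fastforce
  ultimately show "card A = k" by simp
qed

text \<open>A set in the support omits one circle of each class, and by the count in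
  \<open>cobordism_state\<close> the number of the remaining circles is \<open>s\<close>.\<close>

lemma state_homogeneous:
  assumes st: "cobordism_state V (D b) (history b) s \<omega>" shows "homogeneous s \<omega>"
  unfolding homogeneous_def
proof (intro allI impI)
  fix A assume nz: "Poly_Mapping.lookup \<omega> A \<noteq> 0"
  let ?f = "hull_of (history b)" and ?Q = "circle_of (history b) ` V"
  have "regular_element ?f (S b) ?Q \<omega>" and c: "card (S b) = s + card ?Q"
    using st nz by (auto simp: cobordism_state_def)
  then have "cotransversal ?f (S b) ?Q A"
    using nz by (metis abs_0_eq regular_element_def)
  then have AS: "A \<subseteq> S b" and rep: "represents ?f ?Q (S b - A)" by (simp_all add: cotransversal_def)
  have fQ: "?f x \<in> ?Q" if "x \<in> S b" for x using that hull_of_circle[OF diagram_history] by auto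
  have "bij_betw ?f (S b - A) ?Q"
  proof (rule bij_betw_imageI)
    show "inj_on ?f (S b - A)"
      by (rule inj_onI) (meson DiffD1 fQ rep represents_unique)
    show "?f ` (S b - A) = ?Q"
    proof (rule equalityI; rule subsetI)
      fix Q assume "Q \<in> ?Q"
      then obtain x where "x \<in> S b - A" "?f x = Q" using represents_ex[OF rep] by meson
      then show "Q \<in> ?f ` (S b - A)" by (rule rev_image_eqI[OF _ sym])
    next
      fix Q assume "Q \<in> ?f ` (S b - A)"
      then obtain x where "x \<in> S b" "Q = ?f x" by (meson DiffD1 imageE)
      then show "Q \<in> ?Q" using fQ by metis
    qed
  qed
  then have "card (S b - A) = card ?Q" by (rule bij_betw_same_card)
  moreover have "finite (S b)" by simp
  ultimately show "card A = s" using c AS by (metis add_diff_cancel_right' card_Diff_subset card_mono diff_diff_cancel finite_subset)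
qed

section \<open>Stacking elements of two components\<close>

definition stack :: "exterior \<Rightarrow> exterior \<Rightarrow> exterior" where
  "stack x y = wedge (exterior_map ((`) upper) x) (exterior_map ((`) lower) y)"

lemma upper_S: "(`) upper ` glue c b \<subseteq> S {}" and lower_S: "(`) lower ` glue b a \<subseteq> S {}"
  unfolding initial_circles by auto

lemma keyed_S0: "keyed (S {})" by (rule keyed_S) simp

lemma stack_closed:
  assumes "x \<in> exterior_algebra (glue c b)" "y \<in> exterior_algebra (glue b a)"
  shows "stack x y \<in> exterior_algebra (S {})"
  unfolding stack_def
  by (intro wedge_closed[OF keyed_S0] exterior_map_closed[OF keyed_glue(1) keyed_S0 upper_S assms(1)]
      exterior_map_closed[OF keyed_glue(2) keyed_S0 lower_S assms(2)])

lemma stack_iota_left: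
  assumes "x \<in> exterior_algebra (glue c b)" "y \<in> exterior_algebra (glue b a)" "i \<in> {1..2 * n}"
  shows "stack (iota (cb i) x) y = iota (cc {} (upper i)) (stack x y)"
proof -
  have "cb i \<in> glue c b" using assms(3) by (simp add: glue_circles)
  then have "exterior_map ((`) upper) (iota (cb i) x) = iota (cc {} (upper i)) (exterior_map ((`) upper) x)"
    using exterior_map_iota[OF keyed_glue(1) keyed_S0 upper_S assms(1)] by (simp add: initial_circle)
  moreover have "cc {} (upper i) \<in> S {}" using assms(3) by simp
  ultimately show ?thesis
    unfolding stack_def using wedge_iota[OF keyed_S0]
      exterior_map_closed[OF keyed_glue(1) keyed_S0 upper_S assms(1)]
      exterior_map_closed[OF keyed_glue(2) keyed_S0 lower_S assms(2)] by simp
qed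

lemma stack_unit:
  assumes "y \<in> exterior_algebra (glue b a)"
  shows "stack unit_ext y = exterior_map ((`) lower) y"
  unfolding stack_def
  using wedge_unit[OF keyed_S0 exterior_map_closed[OF keyed_glue(2) keyed_S0 lower_S assms]] by simp

text \<open>Moving a lower circle past a general left factor would cost a sign that depends on its
  degree; with the unit on the left there is none. The left factor can be taken apart first by
  \<open>stack_iota_left\<close>.\<close>

lemma stack_iota_right:
  assumes "y \<in> exterior_algebra (glue b a)" "i \<in> {1..2 * n}"
  shows "stack unit_ext (iota (ba i) y) = iota (cc {} (lower i)) (stack unit_ext y)"
proof -
  have "ba i \<in> glue b a" using assms(2) by (simp add: glue_circles)
  then show ?thesis
    using exterior_map_iota[OF keyed_glue(2) keyed_S0 lower_S assms(1)] exterior_algebra_iota assms(1)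
    by (simp add: stack_unit initial_circle)
qed

lemma stack_unit_unit [simp]: "stack unit_ext unit_ext = unit_ext"
  by (simp add: stack_unit)

end

section \<open>Products of components and their values at the units\<close>

definition admissible_rule :: "nat \<Rightarrow> rule \<Rightarrow> matching \<Rightarrow> matching \<Rightarrow> matching \<Rightarrow> bool" where
  "admissible_rule n C c b a \<longleftrightarrow> orientation b (snd (C c b a)) \<and> set (fst (C c b a)) = {1..2 * n}"

context three_matchings
begin

lemma lin_surgeries: "lin (surgeries c b a R T ps)"
proof (induction ps arbitrary: T)
  case Nil show ?case by (simp add: lin_def)
next
  case (Cons p ps)
  obtain i j where "oriented_arc R p = (i, j)" by (cases "oriented_arc R p")
  then show ?case
    using Cons lin_surgery[of T i j] by (cases "{i, j} \<in> T") (simp_all add: lin_def)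
qed

lemma component_mult_stack:
  "component_mult C c b a x y =
    exterior_map ((`) point) (surgeries c b a (snd (C c b a)) {} (fst (C c b a)) (stack x y))"
  by (simp add: component_mult_def stack_def)

lemma lin_mult_left: "lin (\<lambda>x. component_mult C c b a x y)"
proof -
  have "lin (\<lambda>x. stack x y)" unfolding stack_def
    by (rule lin_compose[OF lin_wedge_left lin_exterior_map])
  then show ?thesis unfolding component_mult_stack
    by (intro lin_compose[OF lin_exterior_map] lin_compose[OF lin_surgeries])
qed

lemma lin_mult_right: "lin (component_mult C c b a x)"
proof -
  have "lin (\<lambda>y. stack x y)" unfolding stack_def
    by (rule lin_compose[OF lin_wedge_right lin_exterior_map])
  then have "lin (\<lambda>y. component_mult C c b a x y)" unfolding component_mult_stack
    by (intro lin_compose[OF lin_exterior_map] lin_compose[OF lin_surgeries])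
  then show ?thesis .
qed

lemma card_b: "card b = n"
proof -
  have "{v\<in>{1..2 * n}. odd v} \<union> {v\<in>{1..2 * n}. \<not> odd v} = {1..2 * n}" by blast
  then have "card {v\<in>{1..2 * n}. odd v} + card {v\<in>{1..2 * n}. \<not> odd v} = card {1..2 * n}"
    by (subst card_Un_disjoint[symmetric]) auto
  then show ?thesis using bipartite_matching_card[OF mb] by simp
qed

lemma rule_stage:
  assumes "admissible_rule n C c b a"
  obtains s where "stage b s (surgeries c b a (snd (C c b a)) {} (fst (C c b a)))"
    "card (glue c a) + n = card (glue c b) + card (glue b a) + 2 * s"
proof -
  obtain s where s: "stage b s (surgeries c b a (snd (C c b a)) {} (fst (C c b a)))"
    using stage_final[of "snd (C c b a)" "fst (C c b a)"] assms by (auto simp: admissible_rule_def)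
  moreover from s have "card (glue c a) + n = card (glue c b) + card (glue b a) + 2 * s"
    by (simp add: stage_def card_final card_initial card_b)
  ultimately show ?thesis using that by blast
qed

lemma mult_closed:
  assumes C: "admissible_rule n C c b a"
    and xy: "x \<in> exterior_algebra (glue c b)" "y \<in> exterior_algebra (glue b a)"
  shows "component_mult C c b a x y \<in> exterior_algebra (glue c a)"
proof -
  obtain s where "stage b s (surgeries c b a (snd (C c b a)) {} (fst (C c b a)))" by (rule rule_stage[OF C])
  then show ?thesis unfolding component_mult_stack
    using stack_closed[OF xy] by (intro exterior_map_closed[OF keyed_final keyed_glue(3) point_S]) (simp add: stage_def)
qed

lemma mult_twist:
  assumes s: "stage b s \<Phi>" and z: "z \<in> exterior_algebra (S {})" and v: "v \<in> V"
  shows "exterior_map ((`) point) (\<Phi> (iota (cc {} v) z)) =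
    frag_cmul ((- 1) ^ s) (iota (ca (point v)) (exterior_map ((`) point) (\<Phi> z)))"
proof -
  have \<Phi>: "\<Phi> z \<in> exterior_algebra (S b)" "\<Phi> (iota (cc {} v) z) = frag_cmul ((- 1) ^ s) (iota (cc b v) (\<Phi> z))"
    using s z v by (simp_all add: stage_def)
  have "exterior_map ((`) point) (iota (cc b v) (\<Phi> z)) = iota (point ` cc b v) (exterior_map ((`) point) (\<Phi> z))"
    by (rule exterior_map_iota[OF keyed_final keyed_glue(3) point_S \<Phi>(1)]) (use v in simp)
  then show ?thesis unfolding \<Phi>(2) by (simp add: lin_cmul[OF lin_exterior_map] final_circle[OF v])
qed

lemma mult_iota_left:
  assumes C: "admissible_rule n C c b a" and s: "card (glue c a) + n = card (glue c b) + card (glue b a) + 2 * s"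
    and xy: "x \<in> exterior_algebra (glue c b)" "y \<in> exterior_algebra (glue b a)" and i: "i \<in> {1..2 * n}"
  shows "component_mult C c b a (iota (cb i) x) y = frag_cmul ((- 1) ^ s) (iota (ca i) (component_mult C c b a x y))"
proof -
  obtain s' where st: "stage b s' (surgeries c b a (snd (C c b a)) {} (fst (C c b a)))"
    "card (glue c a) + n = card (glue c b) + card (glue b a) + 2 * s'" by (rule rule_stage[OF C])
  then have "s' = s" using s by simp
  then show ?thesis unfolding component_mult_stack stack_iota_left[OF xy i]
    using mult_twist[OF st(1) stack_closed[OF xy], of "upper i"] i by simp
qed

lemma mult_iota_right:
  assumes C: "admissible_rule n C c b a" and s: "card (glue c a) + n = card (glue c b) + card (glue b a) + 2 * s"
    and y: "y \<in> exterior_algebra (glue b a)" and i: "i \<in> {1..2 * n}"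
  shows "component_mult C c b a unit_ext (iota (ba i) y) =
    frag_cmul ((- 1) ^ s) (iota (ca i) (component_mult C c b a unit_ext y))"
proof -
  obtain s' where st: "stage b s' (surgeries c b a (snd (C c b a)) {} (fst (C c b a)))"
    "card (glue c a) + n = card (glue c b) + card (glue b a) + 2 * s'" by (rule rule_stage[OF C])
  then have "s' = s" using s by simp
  then show ?thesis unfolding component_mult_stack stack_iota_right[OF y i]
    using mult_twist[OF st(1) stack_closed[OF exterior_algebra_unit y], of "lower i"] i by simp
qed

text \<open>Whether the value at the unit vanishes is decided by counts common to both composites.
  If it does not, \<open>regular_generates\<close> makes the two values proportional and their
  coefficients of absolute value 1 make the factor a sign. Equivariance carries this from the unit
  to all elements.\<close>

lemma stage_sign:
  assumes st: "stage b s \<Phi>" and st': "stage b s \<Phi>'"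
  obtains \<tau> where "\<tau> = 1 \<or> \<tau> = (-1 :: int)" "\<And>z. z \<in> exterior_algebra (S {}) \<Longrightarrow> \<Phi>' z = frag_cmul \<tau> (\<Phi> z)"
proof -
  let ?w = "\<Phi> unit_ext" and ?w' = "\<Phi>' unit_ext"
  have state: "cobordism_state V (D b) (history b) s ?w" "cobordism_state V (D b) (history b) s ?w'"
    using st st' by (simp_all add: stage_def)
  have lins: "lin \<Phi>" "lin \<Phi>'" using st st' by (simp_all add: stage_def)
  have "\<exists>\<tau>. (\<tau> = 1 \<or> \<tau> = (-1 :: int)) \<and> ?w' = frag_cmul \<tau> ?w"
  proof (cases "?w = 0")
    case True
    then have "card (S b) < s + card (circle_of (history b) ` V)"
      using state(1) regular_nonzero[OF diagram_history] by (auto simp: cobordism_state_def)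
    then have "?w' = 0" using state(2) by (simp add: cobordism_state_def)
    then show ?thesis using True by (intro exI[of _ 1]) simp
  next
    case False
    then have reg: "regular_element (hull_of (history b)) (S b) (circle_of (history b) ` V) ?w"
      and c: "card (S b) = s + card (circle_of (history b) ` V)"
      using state(1) by (simp_all add: cobordism_state_def)
    then have reg': "regular_element (hull_of (history b)) (S b) (circle_of (history b) ` V) ?w'"
      using state(2) by (simp add: cobordism_state_def)
    obtain k where k: "?w' = frag_cmul k ?w"
    proof (rule regular_generates[OF diagram_history finV history_V state(1) False])
      show "?w' \<in> exterior_algebra (S b)" using state(2) by (simp add: cobordism_state_def)
      show "homogeneous s ?w'" by (rule state_homogeneous[OF state(2)])
      show "iota (cc b v) ?w' = iota (cc b w) ?w'" if "v \<in> V" "w \<in> circle_of (history b) v" for v w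
        using state(2) that by (simp add: cobordism_state_def)
    qed simp
    obtain A where A: "Poly_Mapping.lookup ?w A \<noteq> 0" using False by (metis lookup_zero poly_mapping_eqI)
    have "\<bar>Poly_Mapping.lookup ?w' A\<bar> = \<bar>Poly_Mapping.lookup ?w A\<bar>" "\<bar>Poly_Mapping.lookup ?w A\<bar> = 1"
      using reg reg' A by (auto simp: regular_element_def split: if_splits)
    then have "\<bar>k\<bar> = 1" by (simp add: k abs_mult)
    then show ?thesis using k by (intro exI[of _ k]) auto
  qed
  then obtain \<tau> where \<tau>: "\<tau> = 1 \<or> \<tau> = (-1 :: int)" "?w' = frag_cmul \<tau> ?w" by blast
  have "\<Phi>' z = frag_cmul \<tau> (\<Phi> z)" if "z \<in> exterior_algebra (S {})" for z
    using keyed_S0 that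
  proof (induction z rule: exterior_induct)
    case unit show ?case by (rule \<tau>(2))
  next
    case (diff x y)
    then show ?case using lins lin_diff[OF lin_scale[of "\<lambda>x. x" \<tau>], of "\<Phi> x" "\<Phi> y"] by (simp add: lin_diff lin_def)
  next
    case (iota x v)
    obtain u where u: "u \<in> V" "v = cc {} u" using iota(1) by blast
    have "\<Phi>' (iota v x) = frag_cmul ((- 1) ^ s) (iota (cc b u) (\<Phi>' x))" "\<Phi> (iota v x) = frag_cmul ((- 1) ^ s) (iota (cc b u) (\<Phi> x))"
      using st st' u iota(2) by (simp_all add: stage_def)
    then show ?case using iota(3) by (simp add: lin_cmul[OF lin_iota] mult.commute)
  qed
  then show ?thesis using that \<tau>(1) by blast
qed

lemma mult_sign:
  assumes C: "admissible_rule n C c b a" and C': "admissible_rule n C' c b a"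
  obtains \<tau> where "\<tau> = 1 \<or> \<tau> = (-1 :: int)"
    "\<And>x y. x \<in> exterior_algebra (glue c b) \<Longrightarrow> y \<in> exterior_algebra (glue b a) \<Longrightarrow>
      component_mult C' c b a x y = frag_cmul \<tau> (component_mult C c b a x y)"
proof -
  obtain s where s: "stage b s (surgeries c b a (snd (C c b a)) {} (fst (C c b a)))" by (rule rule_stage[OF C])
  obtain s' where s': "stage b s' (surgeries c b a (snd (C' c b a)) {} (fst (C' c b a)))" by (rule rule_stage[OF C'])
  have "s' = s" by (rule stage_degree_unique[OF s' s])
  then obtain \<tau> where "\<tau> = 1 \<or> \<tau> = (-1 :: int)" "\<And>z. z \<in> exterior_algebra (S {}) \<Longrightarrow>
      surgeries c b a (snd (C' c b a)) {} (fst (C' c b a)) z = frag_cmul \<tau> (surgeries c b a (snd (C c b a)) {} (fst (C c b a)) z)"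
    using stage_sign[OF s] s' by blast
  then show ?thesis using that[of \<tau>] stack_closed
    by (simp add: component_mult_stack lin_cmul[OF lin_exterior_map])
qed

lemma mult_unit_no_split:
  assumes C: "admissible_rule n C c b a" and "card (glue c a) + n = card (glue c b) + card (glue b a)"
  shows "component_mult C c b a unit_ext unit_ext = unit_ext"
proof -
  obtain s where s: "stage b s (surgeries c b a (snd (C c b a)) {} (fst (C c b a)))"
    "card (glue c a) + n = card (glue c b) + card (glue b a) + 2 * s" by (rule rule_stage[OF C])
  then have "s = 0" using assms by simp
  then show ?thesis using s by (simp add: component_mult_stack stage_def)
qed

lemma mult_unit_nonzero:
  assumes s: "stage b s \<Phi>" and nz: "\<Phi> unit_ext \<noteq> 0"
  shows "exterior_map ((`) point) (\<Phi> unit_ext) \<noteq> 0"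
proof
  assume "exterior_map ((`) point) (\<Phi> unit_ext) = 0"
  moreover have "exterior_map lift (exterior_map ((`) point) (\<Phi> unit_ext)) = \<Phi> unit_ext"
    by (rule exterior_map_lift_point) (use s in \<open>simp add: stage_def\<close>)
  ultimately show False using nz by (simp add: lin_zero)
qed

text \<open>The vertical segments join every point to its lower copy, so each component of the
  cobordism meets a circle of the lower diagram.\<close>

lemma card_history: "card (circle_of (history b) ` V) \<le> card (glue b a)"
proof -
  let ?h = "\<lambda>X. circle_of (history b) (lower (Min X))"
  have low: "circle_of (history b) (lower i) = circle_of (history b) (lower j)" if "j \<in> ba i" for i j
  proof (rule circle_of_respects[OF that, of "\<lambda>i. circle_of (history b) (lower i)"])
    fix x y assume "{x, y} \<in> b \<union> a"
    then have "lower ` {x, y} \<in> history b" unfolding history_def diagram_alt by blast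
    then show "circle_of (history b) (lower x) = circle_of (history b) (lower y)" by (intro circle_of_edge) simp
  qed
  have "circle_of (history b) ` V \<subseteq> ?h ` glue b a"
  proof
    fix X assume "X \<in> circle_of (history b) ` V"
    then obtain v where v: "v \<in> V" "X = circle_of (history b) v" by blast
    define i where "i = point v"
    have i: "i \<in> {1..2 * n}" using point_V[OF v(1)] by (simp add: i_def)
    have "{upper i, lower i} \<in> history b" unfolding history_def verticals_def U using i by blast
    then have e: "circle_of (history b) (upper i) = circle_of (history b) (lower i)" by (rule circle_of_edge)
    have "v = upper i \<or> v = lower i" using v(1) by (auto simp: vertices_def i_def)
    then have X: "X = circle_of (history b) (lower i)" using v(2) e by metis
    have "ba i \<subseteq> {1..2 * n}" by (rule circle_of_subset[OF _ i]) (simp add: U)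
    then have "finite (ba i)" by (rule finite_subset) simp
    then have "Min (ba i) \<in> ba i" using circle_of_self by (metis Min_in empty_iff)
    then have "X = ?h (ba i)" unfolding X by (rule low)
    moreover have "ba i \<in> glue b a" unfolding glue_circles using i by blast
    ultimately show "X \<in> ?h ` glue b a" by (rule image_eqI)
  qed
  moreover have "finite (glue b a)" unfolding glue_circles by simp
  ultimately show ?thesis by (meson card_image_le card_mono finite_imageI order_trans)
qed

text \<open>With one split, vanishing would require \<open>cg c a\<close> to be less than one plus
  the number of components, which is at most \<open>cg b a\<close>; this contradicts
  \<open>lt\<close>.\<close>

lemma mult_unit_one_split:
  assumes C: "admissible_rule n C c b a" and "card (glue c a) + n = card (glue c b) + card (glue b a) + 2"
    and lt: "card (glue b a) < card (glue c a)"
  shows "component_mult C c b a unit_ext unit_ext \<noteq> 0"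
proof -
  obtain s where s: "stage b s (surgeries c b a (snd (C c b a)) {} (fst (C c b a)))" (is "stage b s ?\<Phi>")
    "card (glue c a) + n = card (glue c b) + card (glue b a) + 2 * s" by (rule rule_stage[OF C])
  then have "s = 1" using assms by simp
  then have "\<not> card (S b) < s + card (circle_of (history b) ` V)"
    using lt card_history by (simp add: card_final)
  then have "?\<Phi> unit_ext \<noteq> 0"
    using s(1) regular_nonzero[OF diagram_history] by (auto simp: stage_def cobordism_state_def)
  then show ?thesis using mult_unit_nonzero[OF s(1)] by (simp add: component_mult_stack)
qed

text \<open>The ends of an arc of \<open>b\<close> lie on one circle of the right factor, and
  multiplying the right unit by it can be computed at either end.\<close>

lemma mult_unit_killed:
  assumes C: "admissible_rule n C c b a" and "{i, j} \<in> b"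
  shows "iota (ca i) (component_mult C c b a unit_ext unit_ext) = iota (ca j) (component_mult C c b a unit_ext unit_ext)"
proof -
  obtain s where s: "card (glue c a) + n = card (glue c b) + card (glue b a) + 2 * s" by (rule rule_stage[OF C])
  have ij: "i \<in> {1..2 * n}" "j \<in> {1..2 * n}" using assms(2) U(2) by blast+
  have "ba i = ba j" using assms(2) by (intro circle_of_edge) simp
  then have "frag_cmul ((- 1) ^ s) (iota (ca i) (component_mult C c b a unit_ext unit_ext)) =
      frag_cmul ((- 1) ^ s) (iota (ca j) (component_mult C c b a unit_ext unit_ext))"
    using mult_iota_right[OF C s exterior_algebra_unit ij(1)] mult_iota_right[OF C s exterior_algebra_unit ij(2)] by simp
  from arg_cong[OF this, of "frag_cmul ((- 1) ^ s)"] show ?thesis by (simp flip: power_mult_distrib)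
qed

lemma mult_unit_homogeneous:
  assumes C: "admissible_rule n C c b a" and s: "card (glue c a) + n = card (glue c b) + card (glue b a) + 2 * s"
  shows "homogeneous s (component_mult C c b a unit_ext unit_ext)"
proof -
  obtain s' where st: "stage b s' (surgeries c b a (snd (C c b a)) {} (fst (C c b a)))" (is "stage b s' ?\<Phi>")
    "card (glue c a) + n = card (glue c b) + card (glue b a) + 2 * s'" by (rule rule_stage[OF C])
  then have "s' = s" using s by simp
  then have state: "cobordism_state V (D b) (history b) s (?\<Phi> unit_ext)" using st(1) by (simp add: stage_def)
  then have "?\<Phi> unit_ext \<in> exterior_algebra (S b)" by (simp add: cobordism_state_def)
  then show ?thesis
    using homogeneous_exterior_map[OF _ keyed_final state_homogeneous[OF state]] by (simp add: component_mult_stack)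
qed

text \<open>Transports \<open>regular_generates\<close> along \<open>lift\<close>. The arcs of
  \<open>c\<close> and \<open>a\<close> impose no condition, as their ends share a circle of the
  result, so annihilation has to be checked along the arcs of \<open>b\<close>.\<close>

lemma mult_unit_generates:
  assumes C: "admissible_rule n C c b a" and s: "card (glue c a) + n = card (glue c b) + card (glue b a) + 2 * s"
    and nz: "component_mult C c b a unit_ext unit_ext \<noteq> 0"
    and \<eta>: "\<eta> \<in> exterior_algebra (glue c a)" "homogeneous s \<eta>"
    and killed: "\<And>i j. {i, j} \<in> b \<Longrightarrow> iota (ca i) \<eta> = iota (ca j) \<eta>"
  obtains k where "\<eta> = frag_cmul k (component_mult C c b a unit_ext unit_ext)"
proof -
  obtain s' where st: "stage b s' (surgeries c b a (snd (C c b a)) {} (fst (C c b a)))" (is "stage b s' ?\<Phi>")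
    "card (glue c a) + n = card (glue c b) + card (glue b a) + 2 * s'" by (rule rule_stage[OF C])
  then have "s' = s" using s by simp
  then have state: "cobordism_state V (D b) (history b) s (?\<Phi> unit_ext)" using st(1) by (simp add: stage_def)
  have U_eq: "component_mult C c b a unit_ext unit_ext = exterior_map ((`) point) (?\<Phi> unit_ext)"
    by (simp add: component_mult_stack)
  have nz': "?\<Phi> unit_ext \<noteq> 0" using nz by (auto simp: U_eq lin_zero)
  let ?\<eta> = "exterior_map lift \<eta>"
  have lift_iota: "iota (cc b (upper i)) ?\<eta> = exterior_map lift (iota (ca i) \<eta>)" if "i \<in> {1..2 * n}" for i
  proof -
    have "ca i \<in> glue c a" unfolding glue_circles using that by blast
    then show ?thesis using exterior_map_iota[OF keyed_glue(3) keyed_final lift_glue \<eta>(1)] lift_circle[OF that] by simp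
  qed
  have pt: "iota (ca i) \<eta> = iota (ca j) \<eta>" if "{i, j} \<in> c \<union> b \<union> a" for i j
  proof (cases "{i, j} \<in> b")
    case True then show ?thesis by (rule killed)
  next
    case False
    then have "ca i = ca j" using that by (intro circle_of_edge) blast
    then show ?thesis by simp
  qed
  have edge: "iota (cc b x) ?\<eta> = iota (cc b y) ?\<eta>" if xy: "{x, y} \<in> history b" for x y
  proof -
    have xyV: "x \<in> V" "y \<in> V" using xy history_V[OF order.refl] by blast+
    have "point x = point y \<or> {point x, point y} \<in> c \<union> b \<union> a"
    proof -
      consider A where "A \<in> c \<union> b \<union> a" "{x, y} = upper ` A \<or> {x, y} = lower ` A" | i where "{x, y} = {upper i, lower i}"
        using xy unfolding history_def diagram_alt verticals_def by blast
      then show ?thesis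
      proof cases
        case 1
        have "point ` upper ` A = A" "point ` lower ` A = A" by (simp_all add: image_image)
        then have "point ` {x, y} = A" using 1(2) by metis
        then show ?thesis using 1(1) by simp
      next
        case 2 then show ?thesis by (auto simp: doubleton_eq_iff)
      qed
    qed
    then have "iota (ca (point x)) \<eta> = iota (ca (point y)) \<eta>" using pt by metis
    then show ?thesis
      using lift_iota[OF point_V[OF xyV(1)]] lift_iota[OF point_V[OF xyV(2)]] final_upper[OF xyV(1)] final_upper[OF xyV(2)]
      by simp
  qed
  obtain k where "?\<eta> = frag_cmul k (?\<Phi> unit_ext)"
  proof (rule regular_generates[OF diagram_history finV history_V state nz'])
    show "?\<eta> \<in> exterior_algebra (S b)" by (rule exterior_map_closed[OF keyed_glue(3) keyed_final lift_glue \<eta>(1)])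
    show "homogeneous s ?\<eta>" by (rule homogeneous_exterior_map[OF \<eta>(1) keyed_glue(3) \<eta>(2)])
    show "iota (cc b v) ?\<eta> = iota (cc b w) ?\<eta>" if "w \<in> circle_of (history b) v" for v w
      using circle_of_respects[OF that, of "\<lambda>x. iota (cc b x) ?\<eta>"] edge by blast
  qed simp
  then have "exterior_map ((`) point) ?\<eta> = frag_cmul k (component_mult C c b a unit_ext unit_ext)"
    by (simp add: U_eq lin_cmul[OF lin_exterior_map])
  then show ?thesis using that exterior_map_point_lift[OF \<eta>(1)] by simp
qed

end

section \<open>Crossingless matchings\<close>

abbreviation "cm \<equiv> crossingless_matchings"

lemma cm_facts:
  assumes "a \<in> cm n"
  shows "\<Union>a = {1..2 * n}" "disjoint a" "\<And>A. A \<in> a \<Longrightarrow> card A = 2"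
    "\<And>i j k l. {i, k} \<in> a \<Longrightarrow> {j, l} \<in> a \<Longrightarrow> \<not> (i < j \<and> j < k \<and> k < l)"
  using assms by (simp_all add: crossingless_matchings_def partition_on_def)

lemma cm_unique: "a \<in> cm n \<Longrightarrow> A \<in> a \<Longrightarrow> B \<in> a \<Longrightarrow> x \<in> A \<Longrightarrow> x \<in> B \<Longrightarrow> A = B"
  using cm_facts(2) by (metis IntI disjointD empty_iff)

lemma cm_mate:
  assumes "a \<in> cm n" "i \<in> {1..2 * n}"
  obtains p where "{i, p} \<in> a" "p \<noteq> i" "p \<in> {1..2 * n}"
proof -
  obtain A where A: "A \<in> a" "i \<in> A" using assms cm_facts(1)[OF assms(1)] by blast
  then have "card A = 2" using cm_facts(3) assms(1) by blast
  then obtain p where "A = {i, p}" "p \<noteq> i" using A(2) by (metis card_2_iff doubleton_eq_iff insertE singletonD)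
  moreover have "p \<in> {1..2 * n}" using A calculation cm_facts(1)[OF assms(1)] by blast
  ultimately show ?thesis using that A by blast
qed

lemma cm_distinct: "a \<in> cm n \<Longrightarrow> {i, p} \<in> a \<Longrightarrow> i \<noteq> p"
  using cm_facts(3)[of a n "{i, p}"] by auto

lemma cm_range: "a \<in> cm n \<Longrightarrow> {i, p} \<in> a \<Longrightarrow> i \<in> {1..2 * n} \<and> p \<in> {1..2 * n}"
  using cm_facts(1) by blast

lemma cm_sides:
  assumes a: "a \<in> cm n" and e: "{i, p} \<in> a" "{u, v} \<in> a" "{i, p} \<noteq> {u, v}" "u < v"
  shows "(u < i \<and> i < v) \<longleftrightarrow> (u < p \<and> p < v)"
proof -
  have "{i, p} \<inter> {u, v} = {}" using cm_unique[OF a e(1,2)] e(3) by blast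
  then have d: "i \<noteq> u" "i \<noteq> v" "p \<noteq> u" "p \<noteq> v" by auto
  have sw: "{p, i} \<in> a" "{v, u} \<in> a" using e by (simp_all add: insert_commute)
  show ?thesis
    using d e(4) cm_facts(4)[OF a e(1,2)] cm_facts(4)[OF a e(2,1)] cm_facts(4)[OF a sw(1) e(2)] cm_facts(4)[OF a e(2) sw(1)]
    by linarith
qed

text \<open>The points strictly below an arc are matched among themselves, hence even in
  number.\<close>

lemma cm_parity:
  assumes a: "a \<in> cm n" and e: "{i, k} \<in> a" "i < k"
  shows "odd i \<noteq> odd k"
proof -
  define A where "A = {B\<in>a. B \<subseteq> {i<..<k}}"
  have "\<Union>A = {i<..<k}"
  proof
    show "{i<..<k} \<subseteq> \<Union>A"
    proof
      fix m assume m: "m \<in> {i<..<k}"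
      then have "m \<in> {1..2 * n}" using cm_range[OF a e(1)] by auto
      then obtain p where p: "{m, p} \<in> a" by (rule cm_mate[OF a])
      have "{m, p} \<noteq> {i, k}" using m by (auto simp: doubleton_eq_iff)
      then have "i < p \<and> p < k" using cm_sides[OF a p e(1) _ e(2)] m by auto
      then have "{m, p} \<in> A" using p m by (auto simp: A_def)
      then show "m \<in> \<Union>A" by blast
    qed
  qed (auto simp: A_def)
  moreover have "2 * card A = card (\<Union>A)"
  proof (rule card_partition)
    have "finite a" using cm_facts(1)[OF a] by (metis finite_UnionD finite_atLeastAtMost)
    then show "finite A" by (simp add: A_def)
    show "finite (\<Union>A)" unfolding calculation by simp
    show "\<And>c. c \<in> A \<Longrightarrow> card c = 2" using cm_facts(3)[OF a] by (simp add: A_def)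
    show "\<And>c1 c2. c1 \<in> A \<Longrightarrow> c2 \<in> A \<Longrightarrow> c1 \<noteq> c2 \<Longrightarrow> c1 \<inter> c2 = {}"
      using cm_facts(2)[OF a] by (simp add: A_def disjoint_def)
  qed
  ultimately have "2 * card A = k - Suc i" by simp
  then have "k = 2 * card A + Suc i" using e(2) by simp
  then show ?thesis by simp
qed

lemma cm_is_matching:
  assumes a: "a \<in> cm n" shows "is_matching n a"
  unfolding bipartite_matching_def
proof (intro conjI ballI)
  fix A assume A: "A \<in> a"
  then obtain i k where ik: "A = {i, k}" "i \<noteq> k" using cm_facts(3)[OF a] by (metis card_2_iff)
  then have "odd i \<noteq> odd k" using cm_parity[OF a, of i k] cm_parity[OF a, of k i] A
    by (metis insert_commute linorder_neqE_nat)
  then show "\<exists>x y. A = {x, y} \<and> odd x \<and> \<not> odd y" using ik by (metis insert_commute)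
qed (use cm_facts[OF a] in simp_all)

lemma finite_cm: "finite (cm n)"
  by (rule finite_subset[of _ "Pow (Pow {1..2 * n})"])
     (auto simp: crossingless_matchings_def partition_on_def)

lemma cm_three: "c \<in> cm n \<Longrightarrow> b \<in> cm n \<Longrightarrow> a \<in> cm n \<Longrightarrow> three_matchings n c b a"
  by (intro three_matchings.intro cm_is_matching)

lemma glue_commute: "glue x y = glue y x"
  by (simp add: glue_def Un_commute)

lemma glue_eq: "x \<in> cm n \<Longrightarrow> y \<in> cm n \<Longrightarrow> glue x y = circle_of (x \<union> y) ` {1..2 * n}"
  using three_matchings.glue_circles(1)[OF cm_three] by blast

abbreviation cg :: "matching \<Rightarrow> matching \<Rightarrow> nat" where "cg x y \<equiv> card (glue x y)"

lemma circle_of_arc: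
  assumes "a \<in> cm n" "A \<in> a" "v \<in> A" shows "circle_of a v = A"
proof
  let ?f = "\<lambda>w. \<Union>{B\<in>a. w \<in> B}"
  have f: "?f w = B" if "B \<in> a" "w \<in> B" for w B
    using cm_unique[OF assms(1) _ that(1) _ that(2)] that by blast
  show "circle_of a v \<subseteq> A"
  proof
    fix w assume w: "w \<in> circle_of a v"
    have "?f v = ?f w"
    proof (rule circle_of_respects[OF w])
      fix x y assume "{x, y} \<in> a"
      then show "?f x = ?f y" using f[of "{x, y}" x] f[of "{x, y}" y] by simp
    qed
    then have "?f w = A" using f[OF assms(2,3)] by simp
    moreover have "w \<in> {1..2 * n}"
      using circle_of_subset[of a "{1..2 * n}" v] w assms cm_facts(1)[OF assms(1)] by blast
    then obtain B where "B \<in> a" "w \<in> B" using cm_facts(1)[OF assms(1)] by blast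
    ultimately show "w \<in> A" using f by blast
  qed
  show "A \<subseteq> circle_of a v"
  proof
    fix w assume w: "w \<in> A"
    show "w \<in> circle_of a v"
    proof (cases "w = v")
      case False
      have "card A = 2" using cm_facts(3) assms by blast
      then have "A = {v, w}" using w assms(3) False by (metis card_2_iff doubleton_eq_iff insertE singletonD)
      then have "circle_of a v = circle_of a w" using assms(2) by (intro circle_of_edge) simp
      then show ?thesis by simp
    qed simp
  qed
qed

lemma glue_self: assumes "a \<in> cm n" shows "glue a a = a"
proof -
  have "glue a a = circle_of a ` \<Union>a" by (simp add: glue_def circles_def)
  also have "\<dots> = a"
  proof (rule equalityI; rule subsetI)
    fix X assume "X \<in> circle_of a ` \<Union>a"
    then show "X \<in> a" using circle_of_arc[OF assms] by auto
  next
    fix A assume A: "A \<in> a"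
    then have "card A = 2" using cm_facts(3) assms by blast
    then obtain v where "v \<in> A" by fastforce
    then show "A \<in> circle_of a ` \<Union>a" using circle_of_arc[OF assms A] A by blast
  qed
  finally show ?thesis .
qed

lemma card_cm: "a \<in> cm n \<Longrightarrow> card a = n"
  using three_matchings.card_b[OF cm_three] by blast

lemma cg_self: "a \<in> cm n \<Longrightarrow> cg a a = n"
  by (simp add: glue_self card_cm)

text \<open>Every circle contains an arc of \<open>x\<close>. With \<open>n\<close> circles,
  distinct arcs of \<open>x\<close> lie on distinct circles, while the ends of an arc of
  \<open>y\<close> share a circle; so that arc is one of \<open>x\<close>.\<close>

lemma cg_eq_n:
  assumes x: "x \<in> cm n" and y: "y \<in> cm n" and g: "cg x y = n" shows "x = y"
proof -
  let ?h = "\<lambda>X. circle_of (x \<union> y) (Min X)"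
  have h: "?h A = circle_of (x \<union> y) i" if "A \<in> x" "i \<in> A" for A i
  proof -
    have "card A = 2" using cm_facts(3)[OF x that(1)] .
    then have "Min A \<in> A" using that(2) by (intro Min_in) (auto simp: card_2_iff)
    then have "Min A \<in> circle_of x i" using circle_of_arc[OF x that] by simp
    then show ?thesis using circle_of_mono[of x "x \<union> y" i] by (intro circle_of_eqI) auto
  qed
  have "?h ` x = glue x y"
    unfolding glue_eq[OF x y]
  proof (rule equalityI; rule subsetI)
    fix X assume "X \<in> ?h ` x"
    then obtain A where A: "A \<in> x" "X = ?h A" by blast
    then have "card A = 2" using cm_facts(3)[OF x] by blast
    then obtain i where "i \<in> A" by fastforce
    then show "X \<in> circle_of (x \<union> y) ` {1..2 * n}" using h A cm_facts(1)[OF x] by blast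
  next
    fix X assume "X \<in> circle_of (x \<union> y) ` {1..2 * n}"
    then obtain i where i: "i \<in> {1..2 * n}" "X = circle_of (x \<union> y) i" by blast
    then obtain A where "A \<in> x" "i \<in> A" using cm_facts(1)[OF x] by blast
    then show "X \<in> ?h ` x" using h i by blast
  qed
  moreover have "finite x" using cm_facts(1)[OF x] by (metis finite_UnionD finite_atLeastAtMost)
  ultimately have inj: "inj_on ?h x" using g card_cm[OF x] by (intro eq_card_imp_inj_on) simp_all
  have yx: "B \<in> x" if B: "B \<in> y" for B
  proof -
    obtain i k where ik: "B = {i, k}" "i \<noteq> k" using cm_facts(3)[OF y B] by (metis card_2_iff)
    obtain p where p: "{i, p} \<in> x" using cm_mate[OF x, of i] cm_range[OF y, of i k] B ik by metis
    obtain q where q: "{k, q} \<in> x" using cm_mate[OF x, of k] cm_range[OF y, of i k] B ik by metis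
    have "circle_of (x \<union> y) i = circle_of (x \<union> y) k" using B ik by (intro circle_of_edge) simp
    then have "?h {i, p} = ?h {k, q}" using h[OF p, of i] h[OF q, of k] by simp
    then have "{i, p} = {k, q}" using inj p q by (meson inj_onD)
    then have "p = k" using ik(2) by (metis doubleton_eq_iff)
    then show ?thesis using p ik by simp
  qed
  moreover have "A \<in> y" if A: "A \<in> x" for A
  proof -
    have "card A = 2" using cm_facts(3)[OF x A] .
    then obtain i where i: "i \<in> A" by fastforce
    then have "i \<in> \<Union>y" using A cm_facts(1)[OF x] cm_facts(1)[OF y] by blast
    then obtain B where "B \<in> y" "i \<in> B" by blast
    then show ?thesis using cm_unique[OF x A yx i] by blast
  qed
  ultimately show ?thesis by blast
qed

subsection \<open>Moves\<close>

definition exchange :: "matching \<Rightarrow> nat \<Rightarrow> nat \<Rightarrow> nat \<Rightarrow> nat \<Rightarrow> matching" where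
  "exchange a i p k q = a - {{i, p}, {k, q}} \<union> {{i, k}, {p, q}}"

text \<open>The points strictly between \<open>i\<close> and \<open>k\<close> are matched among
  themselves; geometrically, \<open>i\<close> and \<open>k\<close> border a common region of the
  half-plane.\<close>

definition saturated :: "matching \<Rightarrow> nat \<Rightarrow> nat \<Rightarrow> bool" where
  "saturated a i k \<longleftrightarrow> (\<forall>u v. {u, v} \<in> a \<and> i < u \<and> u < k \<longrightarrow> i < v \<and> v < k)"

text \<open>By saturation no old arc separates \<open>i\<close> from \<open>k\<close>, hence none
  separates their mates \<open>p\<close> and \<open>q\<close> either, so both new arcs cross no old
  one. They do not cross each other because neither \<open>p\<close> nor \<open>q\<close> lies
  between \<open>i\<close> and \<open>k\<close>.\<close>

lemma exchange_cm:
  assumes a: "a \<in> cm n" and e: "{i, p} \<in> a" "{k, q} \<in> a" and "i < k" "p \<noteq> k" and sat: "saturated a i k"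
  shows "exchange a i p k q \<in> cm n"
proof -
  have ne: "{i, p} \<noteq> {k, q}" using assms by (auto simp: doubleton_eq_iff)
  then have dj: "{i, p} \<inter> {k, q} = {}" using cm_unique[OF a e] by blast
  have d: "i \<noteq> p" "k \<noteq> q" using cm_distinct[OF a] e by auto
  have e': "{p, i} \<in> a" "{q, k} \<in> a" using e by (simp_all add: insert_commute)
  have out: "\<not> (i < p \<and> p < k)" "\<not> (i < q \<and> q < k)"
    using sat e' unfolding saturated_def by (meson less_irrefl)+
  let ?R = "a - {{i, p}, {k, q}}"
  have old: "u \<notin> {i, p, k, q}" "v \<notin> {i, p, k, q}" "(i < u \<and> u < k) \<longleftrightarrow> (i < v \<and> v < k)"
    "u < v \<Longrightarrow> (u < i \<and> i < v) \<longleftrightarrow> (u < p \<and> p < v)" "u < v \<Longrightarrow> (u < k \<and> k < v) \<longleftrightarrow> (u < q \<and> q < v)"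
    if uv: "{u, v} \<in> ?R" for u v
  proof -
    have uva: "{u, v} \<in> a" "{v, u} \<in> a" "{u, v} \<noteq> {i, p}" "{u, v} \<noteq> {k, q}" using uv by (auto simp: insert_commute)
    show "u \<notin> {i, p, k, q}" "v \<notin> {i, p, k, q}"
      using cm_unique[OF a uva(1) e(1)] cm_unique[OF a uva(1) e(2)] uva by blast+
    show "(i < u \<and> u < k) \<longleftrightarrow> (i < v \<and> v < k)" using sat uva(1,2) unfolding saturated_def by meson
    show "u < v \<Longrightarrow> (u < i \<and> i < v) \<longleftrightarrow> (u < p \<and> p < v)" "u < v \<Longrightarrow> (u < k \<and> k < v) \<longleftrightarrow> (u < q \<and> q < v)"
      using cm_sides[OF a e(1) uva(1)] cm_sides[OF a e(2) uva(1)] uva by metis+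
  qed
  have nd: "{i, k} \<inter> {p, q} = {}" "p \<noteq> q" using dj d assms by auto
  have RU: "\<Union>?R = {1..2 * n} - {i, p, k, q}"
    using bipartite_matching_minus[OF cm_is_matching[OF a], of "{{i, p}, {k, q}}"] e
    by (auto simp: bipartite_matching_def)
  have rng: "{i, p, k, q} \<subseteq> {1..2 * n}" using cm_range[OF a e(1)] cm_range[OF a e(2)] by auto
  have "\<Union>{{i, k}, {p, q}} = {i, p, k, q}" by auto
  then have "\<Union>(exchange a i p k q) = ({1..2 * n} - {i, p, k, q}) \<union> {i, p, k, q}"
    unfolding exchange_def Union_Un_distrib RU by (rule arg_cong)
  then have U: "\<Union>(exchange a i p k q) = {1..2 * n}" using rng by blast
  have disR: "disjoint ?R" by (rule pairwise_subset[OF cm_facts(2)[OF a]]) auto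
  have Rn: "A \<inter> {i, p, k, q} = {}" if "A \<in> ?R" for A using Union_upper[OF that] unfolding RU by blast
  have dis: "disjoint (exchange a i p k q)"
    unfolding disjoint_def exchange_def
  proof (intro ballI impI)
    fix A B assume A: "A \<in> ?R \<union> {{i, k}, {p, q}}" and B: "B \<in> ?R \<union> {{i, k}, {p, q}}" and AB: "A \<noteq> B"
    have sub: "X \<subseteq> {i, p, k, q}" if "X \<in> {{i, k}, {p, q}}" for X using that by auto
    show "A \<inter> B = {}"
    proof (cases "A \<in> ?R")
      case AR: True
      show ?thesis
      proof (cases "B \<in> ?R")
        case True then show ?thesis using disjointD[OF disR AR] AB by metis
      next
        case False
        then have "B \<subseteq> {i, p, k, q}" using B sub by (metis UnE)
        then show ?thesis using Rn[OF AR] by blast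
      qed
    next
      case False
      then have A': "A \<in> {{i, k}, {p, q}}" using A by (metis UnE)
      show ?thesis
      proof (cases "B \<in> ?R")
        case True then show ?thesis using Rn[OF True] sub[OF A'] by blast
      next
        case False
        then have "B \<in> {{i, k}, {p, q}}" using B by (metis UnE)
        then show ?thesis using A' nd(1) AB by auto
      qed
    qed
  qed
  have c2: "card A = 2" if "A \<in> exchange a i p k q" for A
  proof -
    have "A \<in> a \<or> A = {i, k} \<or> A = {p, q}" using that by (auto simp: exchange_def)
    then show ?thesis using cm_facts(3)[OF a] \<open>i < k\<close> nd(2) by auto
  qed
  have part: "partition_on {1..2 * n} (exchange a i p k q)"
    unfolding partition_on_def using U dis c2 by fastforce
  have sep: "(u < i \<and> i < v) = (u < k \<and> k < v)" if "{u, v} \<in> ?R" "u < v" for u v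
  proof -
    have ne: "u \<noteq> i" "u \<noteq> k" "v \<noteq> i" "v \<noteq> k" using old(1,2)[OF that(1)] by auto
    note c = old(3)[OF that(1)]
    show ?thesis
    proof (cases "u < i \<and> i < v")
      case True
      then show ?thesis using ne c that(2) \<open>i < k\<close> by linarith
    next
      case False
      then show ?thesis using ne c that(2) \<open>i < k\<close> by linarith
    qed
  qed
  have sep': "(u < p \<and> p < v) = (u < q \<and> q < v)" if "{u, v} \<in> ?R" "u < v" for u v
    using sep[OF that] old(4,5)[OF that(1)] that(2) by metis
  have cross: "\<not> (i' < j' \<and> j' < k' \<and> k' < l')"
    if X: "{i', k'} \<in> exchange a i p k q" and Y: "{j', l'} \<in> exchange a i p k q" for i' j' k' l'
  proof
    assume lt: "i' < j' \<and> j' < k' \<and> k' < l'"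
    have X': "{i', k'} \<in> ?R \<or> i' = i \<and> k' = k \<or> (i' = p \<and> k' = q \<or> i' = q \<and> k' = p)"
      using X lt \<open>i < k\<close> by (auto simp: exchange_def doubleton_eq_iff)
    have Y': "{j', l'} \<in> ?R \<or> j' = i \<and> l' = k \<or> (j' = p \<and> l' = q \<or> j' = q \<and> l' = p)"
      using Y lt \<open>i < k\<close> by (auto simp: exchange_def doubleton_eq_iff)
    show False
    proof (cases "{i', k'} \<in> ?R")
      case R1: True
      show False
      proof (cases "{j', l'} \<in> ?R")
        case True
        then show False using cm_facts(4)[OF a, of i' k' j' l'] R1 lt by blast
      next
        case False
        have "i' < k'" using lt by simp
        note o = sep[OF R1 this] sep'[OF R1 this]
        from False Y' consider "j' = i" "l' = k" | "j' = p" "l' = q" | "j' = q" "l' = p" by blast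
        then show False
        proof cases
          case 1 then show False using o(1) lt by linarith
        next
          case 2 then show False using o(2) lt by linarith
        next
          case 3 then show False using o(2) lt by linarith
        qed
      qed
    next
      case F1: False
      show False
      proof (cases "{j', l'} \<in> ?R")
        case True
        have "j' < l'" using lt by simp
        note o = sep[OF True this] sep'[OF True this]
        from F1 X' consider "i' = i" "k' = k" | "i' = p" "k' = q" | "i' = q" "k' = p" by blast
        then show False
        proof cases
          case 1 then show False using o(1) lt by linarith
        next
          case 2 then show False using o(2) lt by linarith
        next
          case 3 then show False using o(2) lt by linarith
        qed
      next
        case False
        then consider "j' = i" "l' = k" | "j' = p" "l' = q" | "j' = q" "l' = p" using Y' by blast
        note Y1 = this
        from F1 X' consider "i' = i" "k' = k" | "i' = p" "k' = q" | "i' = q" "k' = p" by blast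
        then show False
        proof cases
          case 1
          from Y1 show False by cases (use 1 lt out in simp_all)
        next
          case 2
          from Y1 show False by cases (use 2 lt out in simp_all)
        next
          case 3
          from Y1 show False by cases (use 3 lt out in simp_all)
        qed
      qed
    qed
  qed
  show ?thesis
    unfolding crossingless_matchings_def using part c2 cross by blast
qed

lemma bipartite_matching_neg: "bipartite_matching V col M \<Longrightarrow> bipartite_matching V (\<lambda>v. \<not> col v) M"
  unfolding bipartite_matching_def by (metis insert_commute)

text \<open>\<open>exchange_edges\<close> again, with \<open>y\<close> as the untouched matching.
  Which alternative holds is read off from whether \<open>i\<close> and \<open>k\<close> share a
  circle before the exchange.\<close>

lemma exchange_circles:
  assumes a: "a \<in> cm n" and e: "{i, p} \<in> a" "{k, q} \<in> a" "{i, p} \<noteq> {k, q}"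
    and a': "exchange a i p k q \<in> cm n" and y: "y \<in> cm n"
  shows "cg a y = Suc (cg (exchange a i p k q) y) \<and> k \<notin> circle_of (a \<union> y) i \<or>
    cg (exchange a i p k q) y = Suc (cg a y) \<and> k \<in> circle_of (a \<union> y) i"
proof -
  let ?V = "{1..2 * n}" and ?M = "a - {{i, p}, {k, q}}"
  let ?E = "?M \<union> {{i, p}, {k, q}} \<union> y" and ?E' = "?M \<union> {{i, k}, {p, q}} \<union> y"
  have sub: "{i, p, k, q} \<subseteq> ?V" using cm_range[OF a e(1)] cm_range[OF a e(2)] by auto
  have EE: "a \<union> y = ?E" "exchange a i p k q \<union> y = ?E'" using e by (auto simp: exchange_def)
  have "{i, k} \<in> exchange a i p k q" by (simp add: exchange_def)
  then have par: "odd i \<noteq> odd k" by (rule bipartite_matching_edge[OF cm_is_matching[OF a']])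
  have par': "odd i \<noteq> odd p" "odd k \<noteq> odd q" using bipartite_matching_edge[OF cm_is_matching[OF a]] e by auto
  have dj: "{i, p} \<inter> {k, q} = {}" using cm_unique[OF a e(1,2)] e(3) by blast
  have m: "is_matching n y" by (rule cm_is_matching[OF y])
  have "\<Union>{{i, p}, {k, q}} = {i, p, k, q}" by auto
  then have M: "bipartite_matching (?V - {i, p, k, q}) odd ?M"
    using bipartite_matching_minus[OF cm_is_matching[OF a], of "{{i, p}, {k, q}}"] e by auto
  have alt: "merged (circle_of ?E) (circle_of ?E') i k \<and> p \<in> circle_of ?E i \<and> q \<in> circle_of ?E k \<or>
    merged (circle_of ?E') (circle_of ?E) i p \<and> k \<in> circle_of ?E' i \<and> q \<in> circle_of ?E' p"
  proof (cases "odd i")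
    case True
    show ?thesis
      by (rule exchange_edges[OF m M sub]) (use True par par' dj in auto)
  next
    case False
    show ?thesis
      by (rule exchange_edges[OF bipartite_matching_neg[OF m] bipartite_matching_neg[OF M] sub]) (use False par par' dj in auto)
  qed
  have cgs: "cg a y = card (circle_of ?E ` ?V)" "cg (exchange a i p k q) y = card (circle_of ?E' ` ?V)"
    unfolding glue_eq[OF a y] glue_eq[OF a' y] EE by simp_all
  have iV: "i \<in> ?V" "k \<in> ?V" "p \<in> ?V" using sub by auto
  from alt show ?thesis
  proof (elim disjE conjE)
    assume mg: "merged (circle_of ?E) (circle_of ?E') i k"
    then have "k \<notin> circle_of ?E i" unfolding merged_def circle_of_eq by blast
    then show ?thesis using merged_card[OF mg iV(1,2)] unfolding cgs EE by simp
  next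
    assume mg: "merged (circle_of ?E') (circle_of ?E) i p" and k: "k \<in> circle_of ?E' i"
    have "circle_of ?E i = circle_of ?E' i \<union> circle_of ?E' p" using mg by (simp add: merged_def)
    then have "k \<in> circle_of ?E i" using k by blast
    then show ?thesis using merged_card[OF mg iV(1,3)] unfolding cgs EE by simp
  qed
qed

text \<open>Taking \<open>y = a\<close> in \<open>exchange_circles\<close> shows that a move has
  \<open>n - 1\<close> circles with its source: \<open>i\<close> and \<open>k\<close> lie on
  different arcs of \<open>a\<close>.\<close>

lemma cap_move:
  assumes a: "a \<in> cm n" and ik: "i \<in> {1..2 * n}" "k \<in> {1..2 * n}" "i < k" "{i, k} \<notin> a" and sat: "saturated a i k"
  obtains p q where "{i, p} \<in> a" "{k, q} \<in> a" "{i, p} \<noteq> {k, q}" "exchange a i p k q \<in> cm n"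
    "Suc (cg a (exchange a i p k q)) = n"
    "\<forall>y\<in>cm n. cg a y = Suc (cg (exchange a i p k q) y) \<or> cg (exchange a i p k q) y = Suc (cg a y)"
    "\<forall>y\<in>cm n. k \<in> circle_of (a \<union> y) i \<longrightarrow> cg (exchange a i p k q) y = Suc (cg a y)"
proof -
  obtain p where p: "{i, p} \<in> a" by (rule cm_mate[OF a ik(1)])
  obtain q where q: "{k, q} \<in> a" by (rule cm_mate[OF a ik(2)])
  have "p \<noteq> k" using p ik(4) by auto
  then have ne: "{i, p} \<noteq> {k, q}" using ik(3) by (auto simp: doubleton_eq_iff)
  have ex: "exchange a i p k q \<in> cm n" by (rule exchange_cm[OF a p q ik(3) \<open>p \<noteq> k\<close> sat])
  note c = exchange_circles[OF a p q ne ex]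
  have "circle_of (a \<union> a) i = {i, p}" using circle_of_arc[OF a p] by simp
  then have "k \<notin> circle_of (a \<union> a) i" using \<open>p \<noteq> k\<close> ik(3) by auto
  then have "cg a a = Suc (cg (exchange a i p k q) a)" using c[OF a] by blast
  then have "Suc (cg a (exchange a i p k q)) = n" using cg_self[OF a] by (simp add: glue_commute)
  then show ?thesis using that[OF p q ne ex] c by blast
qed

lemma cap_circle: "{i, k} \<in> y \<Longrightarrow> k \<in> circle_of (a \<union> y) i"
  using circle_of_edge[of i k "a \<union> y"] circle_of_eq by blast

text \<open>The move creates an arc of \<open>b\<close> and destroys two arcs outside
  \<open>b\<close>. Since the ends of the new arc share a circle with \<open>b\<close>, the number
  of circles with \<open>b\<close> rises, which means that the face \<open>(d, d', b)\<close> has no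
  split.\<close>

lemma move_towards:
  assumes d: "d \<in> cm n" and b: "b \<in> cm n" and ne: "d \<noteq> b"
  obtains d' where "d' \<in> cm n" "Suc (cg d d') = n" "cg d' b = Suc (cg d b)"
    "\<forall>y\<in>cm n. cg d y = Suc (cg d' y) \<or> cg d' y = Suc (cg d y)"
    "card (b - d') < card (b - d)"
proof -
  define P where "P m \<longleftrightarrow> (\<exists>i k. {i, k} \<in> b \<and> {i, k} \<notin> d \<and> i < k \<and> m = k - i)" for m
  have ex: "\<exists>m. P m"
  proof (rule ccontr)
    assume neg: "\<not> ?thesis"
    have "A \<in> d" if A: "A \<in> b" for A
    proof -
      obtain i k where "A = {i, k}" "i \<noteq> k" using cm_facts(3)[OF b A] by (metis card_2_iff)
      then obtain i k where "A = {i, k}" "i < k" by (metis insert_commute linorder_neqE_nat)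
      then show ?thesis using neg A unfolding P_def by blast
    qed
    then have sub: "b \<subseteq> d" by blast
    have "A \<in> b" if A: "A \<in> d" for A
    proof -
      have "card A = 2" using cm_facts(3)[OF d A] .
      then obtain i where i: "i \<in> A" by fastforce
      then have "i \<in> \<Union>b" using A cm_facts(1)[OF d] cm_facts(1)[OF b] by blast
      then obtain B where "B \<in> b" "i \<in> B" by blast
      then show ?thesis using cm_unique[OF d A _ i] sub by blast
    qed
    then show False using sub ne by blast
  qed
  \<comment> \<open>For a shortest arc of \<open>b\<close> missing from \<open>d\<close>, all arcs
    of \<open>b\<close> below it belong to \<open>d\<close>, and this gives the saturation that the
    move needs.\<close>
  obtain m where m: "P m" "\<And>m'. m' < m \<Longrightarrow> \<not> P m'" using exists_least_iff[of P] ex by metis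
  then obtain i k where ik: "{i, k} \<in> b" "{i, k} \<notin> d" "i < k" "m = k - i" unfolding P_def by blast
  have small: "{u, v} \<in> d" if "{u, v} \<in> b" "i < u" "u < k" "i < v" "v < k" for u v
  proof (cases "u < v")
    case True
    then have "v - u < m" using that ik by simp
    then show ?thesis using m(2) that(1) True unfolding P_def by blast
  next
    case False
    then have "v < u" using cm_distinct[OF b that(1)] by simp
    moreover from this have "u - v < m" using that ik by simp
    moreover have "{v, u} \<in> b" using that by (simp add: insert_commute)
    ultimately have "{v, u} \<in> d" using m(2) \<open>v < u\<close> unfolding P_def by blast
    then show ?thesis by (simp add: insert_commute)
  qed
  have sat: "saturated d i k"
    unfolding saturated_def
  proof (intro allI impI)
    fix u v assume uv: "{u, v} \<in> d \<and> i < u \<and> u < k"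
    then have "u \<in> {1..2 * n}" using cm_range[OF d] by blast
    then obtain w where w: "{u, w} \<in> b" by (rule cm_mate[OF b])
    have "{u, w} \<noteq> {i, k}" using uv by (auto simp: doubleton_eq_iff)
    then have iw: "i < w \<and> w < k" using cm_sides[OF b w ik(1) _ ik(3)] uv by blast
    then have "{u, w} \<in> d" using small w uv by blast
    then have "{u, w} = {u, v}" using cm_unique[OF d _ _ , of "{u, w}" "{u, v}" u] uv by blast
    then have "w = v" by (metis doubleton_eq_iff)
    then show "i < v \<and> v < k" using iw by simp
  qed
  have rng: "i \<in> {1..2 * n}" "k \<in> {1..2 * n}" using cm_range[OF b ik(1)] by auto
  obtain p q where pq: "{i, p} \<in> d" "{k, q} \<in> d" "{i, p} \<noteq> {k, q}" "exchange d i p k q \<in> cm n"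
    "Suc (cg d (exchange d i p k q)) = n"
    "\<forall>y\<in>cm n. cg d y = Suc (cg (exchange d i p k q) y) \<or> cg (exchange d i p k q) y = Suc (cg d y)"
    "\<forall>y\<in>cm n. k \<in> circle_of (d \<union> y) i \<longrightarrow> cg (exchange d i p k q) y = Suc (cg d y)"
    by (rule cap_move[OF d rng ik(3,2) sat])
  have "{i, p} \<notin> b"
  proof
    assume "{i, p} \<in> b"
    then have "{i, p} = {i, k}" using cm_unique[OF b _ ik(1), of "{i, p}" i] by blast
    then show False using pq(1) ik(2) by simp
  qed
  moreover have "{k, q} \<notin> b"
  proof
    assume "{k, q} \<in> b"
    then have "{k, q} = {i, k}" using cm_unique[OF b _ ik(1), of "{k, q}" k] by blast
    then show False using pq(2) ik(2) by simp
  qed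
  ultimately have "b - exchange d i p k q \<subset> b - d" using ik(1,2) by (auto simp: exchange_def)
  moreover have "finite b" using cm_facts(1)[OF b] by (metis finite_UnionD finite_atLeastAtMost)
  ultimately have "card (b - exchange d i p k q) < card (b - d)" by (intro psubset_card_mono) auto
  then show ?thesis using that[OF pq(4,5) pq(7)[rule_format, OF b cap_circle[OF ik(1)]] pq(6)] by blast
qed

lemma cap_move_exchange:
  assumes a: "a \<in> cm n" and e: "{i, p} \<in> a" "{k, q} \<in> a" and ik: "i < k" "p \<noteq> k" and sat: "saturated a i k"
  shows "exchange a i p k q \<in> cm n" "Suc (cg a (exchange a i p k q)) = n"
    "\<forall>y\<in>cm n. cg a y = Suc (cg (exchange a i p k q) y) \<or> cg (exchange a i p k q) y = Suc (cg a y)"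
    "\<forall>y\<in>cm n. k \<in> circle_of (a \<union> y) i \<longrightarrow> cg (exchange a i p k q) y = Suc (cg a y)"
proof -
  have u: "p' = p" if "{i, p'} \<in> a" for p'
    using cm_unique[OF a that e(1), of i] by (auto simp: doubleton_eq_iff)
  have w: "q' = q" if "{k, q'} \<in> a" for q'
    using cm_unique[OF a that e(2), of k] by (auto simp: doubleton_eq_iff)
  have "{i, k} \<notin> a" using u[of k] ik by auto
  then obtain p' q' where "{i, p'} \<in> a" "{k, q'} \<in> a"
    and *: "exchange a i p' k q' \<in> cm n" "Suc (cg a (exchange a i p' k q')) = n"
    "\<forall>y\<in>cm n. cg a y = Suc (cg (exchange a i p' k q') y) \<or> cg (exchange a i p' k q') y = Suc (cg a y)"
    "\<forall>y\<in>cm n. k \<in> circle_of (a \<union> y) i \<longrightarrow> cg (exchange a i p' k q') y = Suc (cg a y)"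
    using cap_move[OF a _ _ ik(1) _ sat] cm_range[OF a e(1)] cm_range[OF a e(2)] by metis
  then have "p' = p" "q' = q" using u w by auto
  then show "exchange a i p k q \<in> cm n" "Suc (cg a (exchange a i p k q)) = n"
    "\<forall>y\<in>cm n. cg a y = Suc (cg (exchange a i p k q) y) \<or> cg (exchange a i p k q) y = Suc (cg a y)"
    "\<forall>y\<in>cm n. k \<in> circle_of (a \<union> y) i \<longrightarrow> cg (exchange a i p k q) y = Suc (cg a y)"
    using * by simp_all
qed

section \<open>The standard matching and its neighbours\<close>

definition cap :: "nat \<Rightarrow> nat set" where "cap m = {2 * m + 1, 2 * m + 2}"

definition std :: "nat \<Rightarrow> matching" where "std n = cap ` {..<n}"

lemma doubleton_cap: "{u, v} = cap m \<longleftrightarrow> u = 2 * m + 1 \<and> v = 2 * m + 2 \<or> u = 2 * m + 2 \<and> v = 2 * m + 1"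
  by (auto simp: cap_def doubleton_eq_iff)

lemma cap_disjoint: "m \<noteq> m' \<Longrightarrow> cap m \<inter> cap m' = {}"
proof -
  have "(x - 1) div 2 = l" if "x \<in> cap l" for x l using that by (auto simp: cap_def)
  then show "m \<noteq> m' \<Longrightarrow> cap m \<inter> cap m' = {}" by blast
qed

lemma cap_inject [simp]: "cap m = cap m' \<longleftrightarrow> m = m'"
proof -
  have "cap m \<noteq> {}" by (simp add: cap_def)
  then show ?thesis using cap_disjoint[of m m'] by auto
qed

lemma std_cm: "std n \<in> cm n"
proof -
  have c2: "card A = 2" if "A \<in> std n" for A using that by (auto simp: std_def cap_def)
  have dis: "disjoint (std n)"
    unfolding disjoint_def
  proof (intro ballI impI)
    fix A B assume "A \<in> std n" "B \<in> std n" and AB: "A \<noteq> B"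
    then obtain l m where "A = cap l" "B = cap m" unfolding std_def by blast
    then show "A \<inter> B = {}" using AB cap_disjoint[of l m] by metis
  qed
  have U: "\<Union>(std n) = {1..2 * n}"
  proof (rule equalityI; rule subsetI)
    fix x assume "x \<in> \<Union>(std n)"
    then obtain m where "m < n" "x \<in> cap m" unfolding std_def by blast
    then show "x \<in> {1..2 * n}" by (auto simp: cap_def)
  next
    fix x assume x: "x \<in> {1..2 * n}"
    then have "x = 2 * ((x - 1) div 2) + 1 \<or> x = 2 * ((x - 1) div 2) + 2" by (auto; presburger)
    then have "x \<in> cap ((x - 1) div 2)" by (auto simp: cap_def)
    moreover have "(x - 1) div 2 < n" using x by auto
    ultimately show "x \<in> \<Union>(std n)" unfolding std_def by blast
  qed
  have "\<not> (i < j \<and> j < k \<and> k < l)" if ik: "{i, k} \<in> std n" for i j k l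
  proof -
    obtain m where "{i, k} = cap m" using ik by (auto simp: std_def)
    then show ?thesis by (auto simp: doubleton_cap)
  qed
  then show ?thesis
    unfolding crossingless_matchings_def partition_on_def using c2 dis U by fastforce
qed

lemma cap_in_std: "m < n \<Longrightarrow> cap m \<in> std n" by (simp add: std_def)

text \<open>The exchange takes place at the facing ends of the caps \<open>r\<close> and
  \<open>s\<close>, which are \<open>2 * r + 2\<close> and \<open>2 * s + 1\<close>; this is why the
  arc of \<open>r\<close> is given backwards.\<close>

definition tau :: "nat \<Rightarrow> nat \<Rightarrow> nat \<Rightarrow> matching" where
  "tau n r s = exchange (std n) (2 * r + 2) (2 * r + 1) (2 * s + 1) (2 * s + 2)"

lemma tau_eq: "tau n r s = std n - {cap r, cap s} \<union> {{2 * r + 2, 2 * s + 1}, {2 * r + 1, 2 * s + 2}}"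
  by (simp add: tau_def exchange_def cap_def insert_commute)

lemma tau_facts:
  assumes "r < s" "s < n"
  shows "tau n r s \<in> cm n" "Suc (cg (std n) (tau n r s)) = n"
    "\<forall>y\<in>cm n. cg (std n) y = Suc (cg (tau n r s) y) \<or> cg (tau n r s) y = Suc (cg (std n) y)"
proof -
  have e: "{2 * r + 2, 2 * r + 1} \<in> std n" "{2 * s + 1, 2 * s + 2} \<in> std n"
    using cap_in_std[of r n] cap_in_std[of s n] assms by (simp_all add: cap_def insert_commute)
  have sat: "saturated (std n) (2 * r + 2) (2 * s + 1)"
    unfolding saturated_def
  proof (intro allI impI)
    fix u v assume uv: "{u, v} \<in> std n \<and> 2 * r + 2 < u \<and> u < 2 * s + 1"
    then have lt: "2 * r + 2 < u" "u < 2 * s + 1" by auto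
    from uv obtain m where "{u, v} = cap m" by (auto simp: std_def)
    then show "2 * r + 2 < v \<and> v < 2 * s + 1" using lt unfolding doubleton_cap by presburger
  qed
  have "2 * r + 2 < 2 * s + 1" "2 * r + 1 \<noteq> 2 * s + 1" using assms by auto
  note m = cap_move_exchange[OF std_cm e this sat, folded tau_def]
  show "tau n r s \<in> cm n" "Suc (cg (std n) (tau n r s)) = n"
    "\<forall>y\<in>cm n. cg (std n) y = Suc (cg (tau n r s) y) \<or> cg (tau n r s) y = Suc (cg (std n) y)"
    using m by simp_all
qed

lemma cm_subset_eq: "x \<in> cm n \<Longrightarrow> y \<in> cm n \<Longrightarrow> x \<subseteq> y \<Longrightarrow> x = y"
proof -
  assume x: "x \<in> cm n" and y: "y \<in> cm n" and "x \<subseteq> y"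
  moreover have "finite y" using cm_facts(1)[OF y] by (metis finite_UnionD finite_atLeastAtMost)
  ultimately show ?thesis using card_cm[OF x] card_cm[OF y] by (intro card_subset_eq) simp_all
qed

text \<open>Adjacent points have nothing between them, so saturation is vacuous and a cap can be
  created in any matching; the other caps are disjoint from it and survive.\<close>

lemma cap_move_cap:
  assumes x: "x \<in> cm n" and m: "m < n" "cap m \<notin> x"
  obtains x' where "x' \<in> cm n" "cap m \<in> x'" "Suc (cg x x') = n"
    "\<forall>y\<in>cm n. cg x y = Suc (cg x' y) \<or> cg x' y = Suc (cg x y)"
    "\<forall>y\<in>cm n. cap m \<in> y \<longrightarrow> cg x' y = Suc (cg x y)"
    "\<And>l. cap l \<in> x \<Longrightarrow> cap l \<in> x'"
    "\<exists>p q. {2 * m + 1, p} \<in> x \<and> {2 * m + 2, q} \<in> x \<and> x' = exchange x (2 * m + 1) p (2 * m + 2) q"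
proof -
  have rng: "2 * m + 1 \<in> {1..2 * n}" "2 * m + 2 \<in> {1..2 * n}" using m by auto
  have "saturated x (2 * m + 1) (2 * m + 2)" by (auto simp: saturated_def)
  moreover have "{2 * m + 1, 2 * m + 2} \<notin> x" using m(2) by (simp add: cap_def)
  moreover have "2 * m + 1 < 2 * m + 2" by simp
  ultimately obtain p q where pq: "{2 * m + 1, p} \<in> x" "{2 * m + 2, q} \<in> x" "{2 * m + 1, p} \<noteq> {2 * m + 2, q}"
    and ex: "exchange x (2 * m + 1) p (2 * m + 2) q \<in> cm n" "Suc (cg x (exchange x (2 * m + 1) p (2 * m + 2) q)) = n"
    "\<forall>y\<in>cm n. cg x y = Suc (cg (exchange x (2 * m + 1) p (2 * m + 2) q) y) \<or>
      cg (exchange x (2 * m + 1) p (2 * m + 2) q) y = Suc (cg x y)"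
    "\<forall>y\<in>cm n. 2 * m + 2 \<in> circle_of (x \<union> y) (2 * m + 1) \<longrightarrow>
      cg (exchange x (2 * m + 1) p (2 * m + 2) q) y = Suc (cg x y)"
    using cap_move[OF x rng] by metis
  let ?x' = "exchange x (2 * m + 1) p (2 * m + 2) q"
  show ?thesis
  proof (rule that[of ?x'])
    show "cap m \<in> ?x'" by (simp add: exchange_def cap_def)
    show "\<forall>y\<in>cm n. cap m \<in> y \<longrightarrow> cg ?x' y = Suc (cg x y)"
      using ex(4) cap_circle unfolding cap_def by blast
    show "cap l \<in> ?x'" if l: "cap l \<in> x" for l
    proof -
      have "l \<noteq> m" using l m(2) by auto
      then have "cap l \<inter> cap m = {}" by (rule cap_disjoint)
      then have "cap l \<noteq> {2 * m + 1, p}" "cap l \<noteq> {2 * m + 2, q}" unfolding cap_def by blast+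
      then show ?thesis using l by (simp add: exchange_def)
    qed
  qed (use pq ex in blast)+
qed

text \<open>A neighbour of \<open>std n\<close> lacks some cap. Creating it raises the number of
  circles with \<open>std n\<close> to \<open>n\<close>, so the result is \<open>std n\<close>; the
  second arc produced by the exchange is then a cap too, and the neighbour is read off
  backwards.\<close>

lemma near_std:
  assumes t: "t \<in> cm n" "Suc (cg (std n) t) = n"
  obtains r s where "r < s" "s < n" "t = tau n r s"
proof -
  have "t \<noteq> std n" using t cg_self[OF t(1)] by auto
  then have "\<not> std n \<subseteq> t" using cm_subset_eq[OF std_cm t(1)] by auto
  then obtain m where m: "m < n" "cap m \<notin> t" by (auto simp: std_def)
  obtain x' p q where x': "x' \<in> cm n" "\<forall>y\<in>cm n. cap m \<in> y \<longrightarrow> cg x' y = Suc (cg t y)"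
    and pq: "{2 * m + 1, p} \<in> t" "{2 * m + 2, q} \<in> t" "x' = exchange t (2 * m + 1) p (2 * m + 2) q"
    using cap_move_cap[OF t(1) m] by metis
  have "cg x' (std n) = Suc (cg t (std n))" using x'(2) std_cm cap_in_std[OF m(1)] by blast
  then have "cg x' (std n) = n" using t(2) glue_commute[of t] by simp
  then have e: "x' = std n" by (rule cg_eq_n[OF x'(1) std_cm])
  have "{p, q} \<in> x'" by (simp add: pq(3) exchange_def)
  then obtain l where l: "l < n" "{p, q} = cap l" unfolding e by (auto simp: std_def)
  \<comment> \<open>Parity tells which end of the cap \<open>l\<close> is \<open>p\<close>.\<close>
  have "odd (2 * m + 1) \<noteq> odd p" by (rule bipartite_matching_edge[OF cm_is_matching[OF t(1)] pq(1)])
  then have pl: "p = 2 * l + 2" "q = 2 * l + 1" using l(2) unfolding doubleton_cap by auto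
  have "{2 * m + 1, p} \<noteq> {2 * m + 1, 2 * m + 2}" using pq(1) m(2) by (metis cap_def)
  then have lm: "l \<noteq> m" using pl by auto
  have tx: "t = x' - {cap m, cap l} \<union> {{2 * m + 1, 2 * l + 2}, {2 * m + 2, 2 * l + 1}}"
  proof -
    have a: "cap m \<notin> t" by (rule m(2))
    have b: "cap l \<notin> t"
    proof
      assume "cap l \<in> t"
      then have "cap l = {2 * m + 1, p}" using cm_unique[OF t(1) _ pq(1), of "cap l" p] pl by (auto simp: cap_def)
      then have "2 * m + 1 \<in> cap l" by simp
      then show False using lm by (auto simp: cap_def)
    qed
    have "{2 * m + 1, 2 * m + 2} = cap m" "{p, q} = cap l" using l by (simp_all add: cap_def)
    then show ?thesis unfolding pq(3) exchange_def using a b pq(1,2) pl by auto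
  qed
  show ?thesis
  proof (cases "m < l")
    case True
    have "t = tau n m l" unfolding tau_eq tx e by (simp add: insert_commute)
    then show ?thesis using that True l by blast
  next
    case False
    then have "l < m" using lm by simp
    moreover have "t = tau n l m" unfolding tau_eq tx e by (simp add: insert_commute)
    ultimately show ?thesis using that m by blast
  qed
qed

text \<open>\<open>Y\<close> replaces three caps by the two arcs joining facing ends and one long
  arc around them. It is a common neighbour of the three moves between these caps and thus the
  fourth corner of the squares on \<open>std n\<close> and two of the moves.\<close>

lemma three_cycle:
  assumes "r < s" "s < t" "t < n"
  defines "Y \<equiv> exchange (tau n r s) (2 * s + 2) (2 * r + 1) (2 * t + 1) (2 * t + 2)"
  shows "Y \<in> cm n" "Suc (cg (tau n r s) Y) = n" "Suc (cg (tau n s t) Y) = n" "Suc (cg (tau n r t) Y) = n"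
    "Suc (Suc (cg (std n) Y)) = n"
    "Suc (Suc (cg (tau n r s) (tau n s t))) = n" "Suc (Suc (cg (tau n r s) (tau n r t))) = n"
    "Suc (Suc (cg (tau n s t) (tau n r t))) = n"
proof -
  have lt: "r < t" "s < n" "r < n" using assms by auto
  note rs = tau_facts[OF assms(1) lt(2)] and st = tau_facts[OF assms(2,3)] and rt = tau_facts[OF lt(1) assms(3)]
  have arcs: "{2 * s + 2, 2 * r + 1} \<in> tau n r s" "{2 * r + 2, 2 * s + 1} \<in> tau n r s" "cap t \<in> tau n r s"
    "{2 * s + 2, 2 * t + 1} \<in> tau n s t" "cap r \<in> tau n s t"
    "{2 * r + 2, 2 * t + 1} \<in> tau n r t" "cap s \<in> tau n r t"
    unfolding tau_eq using assms lt cap_in_std by (simp_all add: insert_commute)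
  have sat: "saturated (tau n r s) (2 * s + 2) (2 * t + 1)"
    unfolding saturated_def
  proof (intro allI impI)
    fix u v assume uv: "{u, v} \<in> tau n r s \<and> 2 * s + 2 < u \<and> u < 2 * t + 1"
    have "{u, v} \<noteq> {2 * r + 2, 2 * s + 1}" "{u, v} \<noteq> {2 * r + 1, 2 * s + 2}"
      using uv assms(1) by (auto simp: doubleton_eq_iff)
    then obtain m where m: "{u, v} = cap m" using uv by (auto simp: tau_eq std_def)
    from uv have lt: "2 * s + 2 < u" "u < 2 * t + 1" by auto
    from m show "2 * s + 2 < v \<and> v < 2 * t + 1" using lt unfolding doubleton_cap by presburger
  qed
  have capt: "{2 * t + 1, 2 * t + 2} \<in> tau n r s" using arcs(3) by (simp add: cap_def)
  have "2 * s + 2 < 2 * t + 1" "2 * r + 1 \<noteq> 2 * t + 1" using assms by auto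
  note Y = cap_move_exchange[OF rs(1) arcs(1) capt this sat, folded Y_def]
  show Ycm: "Y \<in> cm n" and YT: "Suc (cg (tau n r s) Y) = n" using Y by auto
  \<comment> \<open>Along a move the count changes by exactly one, and the value \<open>n\<close>
    would force equality by \<open>cg_eq_n\<close>; so it drops to \<open>n - 2\<close>.\<close>
  have pm: "Suc (Suc (cg z w)) = n" if zw: "z \<in> cm n" "w \<in> cm n" "z \<noteq> w" and alt: "cg u w = Suc (cg z w) \<or> cg z w = Suc (cg u w)"
    and "Suc (cg u w) = n" for z w u
    using alt that(5) cg_eq_n[OF zw(1,2)] zw(3) by auto
  have cross: "A = B" if "A \<in> z" "B \<in> z" "x \<in> A" "x \<in> B" "z \<in> cm n" for A B x z
    using cm_unique[OF that(5) that(1,2,3,4)] .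
  have capt_not: "cap t \<notin> tau n s t" "cap t \<notin> tau n r t" "cap r \<notin> tau n r t"
  proof -
    have "cap t \<noteq> {2 * s + 2, 2 * t + 1}" "cap t \<noteq> {2 * r + 2, 2 * t + 1}" "cap r \<noteq> {2 * r + 2, 2 * t + 1}"
      using assms by (auto simp: cap_def doubleton_eq_iff)
    then show "cap t \<notin> tau n s t" "cap t \<notin> tau n r t" "cap r \<notin> tau n r t"
      using cross[OF _ arcs(4) _ _ st(1), of "cap t" "2 * t + 1"] cross[OF _ arcs(6) _ _ rt(1), of "cap t" "2 * t + 1"]
        cross[OF _ arcs(6) _ _ rt(1), of "cap r" "2 * r + 2"] by (auto simp: cap_def)
  qed
  show g1: "Suc (Suc (cg (tau n r s) (tau n s t))) = n"
    using pm[OF st(1) rs(1) _ st(3)[rule_format, OF rs(1)]] rs(2) capt_not(1) arcs(3) by (metis glue_commute)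
  show g2: "Suc (Suc (cg (tau n r s) (tau n r t))) = n"
    using pm[OF rt(1) rs(1) _ rt(3)[rule_format, OF rs(1)]] rs(2) capt_not(2) arcs(3) by (metis glue_commute)
  show g3: "Suc (Suc (cg (tau n s t) (tau n r t))) = n"
    using pm[OF rt(1) st(1) _ rt(3)[rule_format, OF st(1)]] st(2) capt_not(3) arcs(5) by (metis glue_commute)
  have "cg Y (tau n s t) = Suc (cg (tau n r s) (tau n s t))"
    using Y(4) st(1) cap_circle[OF arcs(4)] by blast
  then show "Suc (cg (tau n s t) Y) = n" using g1 by (simp add: glue_commute)
  \<comment> \<open>A chain of three arcs puts the two points of the exchange on one circle, so the
    exchange splits it.\<close>
  let ?C = "circle_of (tau n r s \<union> tau n r t)"
  have "?C (2 * s + 2) = ?C (2 * s + 1)" using arcs(7) by (intro circle_of_edge) (simp add: cap_def insert_commute)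
  also have "\<dots> = ?C (2 * r + 2)" using arcs(2) by (intro circle_of_edge) (simp add: insert_commute)
  also have "\<dots> = ?C (2 * t + 1)" using arcs(6) by (intro circle_of_edge) simp
  finally have "2 * t + 1 \<in> ?C (2 * s + 2)" using circle_of_eq by blast
  then have "cg Y (tau n r t) = Suc (cg (tau n r s) (tau n r t))" using Y(4) rt(1) by blast
  then show "Suc (cg (tau n r t) Y) = n" using g2 by (simp add: glue_commute)
  have "{2 * s + 2, 2 * t + 1} \<in> Y" by (simp add: Y_def exchange_def)
  moreover have "{2 * s + 2, 2 * t + 1} \<notin> std n"
  proof
    assume "{2 * s + 2, 2 * t + 1} \<in> std n"
    then obtain m where "{2 * s + 2, 2 * t + 1} = cap m" by (auto simp: std_def)
    then show False using \<open>s < t\<close> unfolding doubleton_cap by presburger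
  qed
  ultimately have "Y \<noteq> std n" by auto
  then show "Suc (Suc (cg (std n) Y)) = n"
    using pm[OF Ycm std_cm _ Y(3)[rule_format, OF std_cm]] rs(2) by (metis glue_commute)
qed

section \<open>Rigidity\<close>

text \<open>\<open>\<rho>\<close> is the quotient of the sign functions of two multiplications and \<open>nz d b a\<close> says that
  the product of the units of the components \<open>(d, b)\<close> and \<open>(b, a)\<close> does not vanish. The assumptions
  \<open>cocycle_left\<close> and \<open>cocycle_right\<close> are the cocycle condition on \<open>(d, c, b, a)\<close> when one of the
  four faces has no split.\<close>

locale rigid_signs =
  fixes n :: nat and \<rho> :: "matching \<Rightarrow> matching \<Rightarrow> matching \<Rightarrow> int" and nz :: "matching \<Rightarrow> matching \<Rightarrow> matching \<Rightarrow> bool"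
  assumes no_split: "d \<in> cm n \<Longrightarrow> b \<in> cm n \<Longrightarrow> a \<in> cm n \<Longrightarrow> cg d a + n = cg d b + cg b a \<Longrightarrow> \<rho> d b a = 1"
    and cocycle_left: "d \<in> cm n \<Longrightarrow> c \<in> cm n \<Longrightarrow> b \<in> cm n \<Longrightarrow> a \<in> cm n \<Longrightarrow>
      cg d b + n = cg d c + cg c b \<Longrightarrow> nz d b a \<Longrightarrow> nz c b a \<and> \<rho> d b a = \<rho> d c a * \<rho> c b a"
    and cocycle_right: "d \<in> cm n \<Longrightarrow> c \<in> cm n \<Longrightarrow> b \<in> cm n \<Longrightarrow> a \<in> cm n \<Longrightarrow>
      cg c a + n = cg c b + cg b a \<Longrightarrow> nz d c a \<Longrightarrow> nz d b a \<and> \<rho> d c b * \<rho> d b a = \<rho> d c a"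
    and one_split: "d \<in> cm n \<Longrightarrow> b \<in> cm n \<Longrightarrow> a \<in> cm n \<Longrightarrow>
      cg d a + n = cg d b + cg b a + 2 \<Longrightarrow> cg b a < cg d a \<Longrightarrow> nz d b a"
    and base: "2 \<le> n \<Longrightarrow> \<rho> (std n) (tau n 0 1) (std n) = 1" "2 \<le> n \<Longrightarrow> \<rho> (tau n 0 1) (std n) (tau n 0 1) = 1"
begin

definition lam :: "matching \<Rightarrow> matching \<Rightarrow> int" where "lam x y = \<rho> x y x"

text \<open>The cocycle relation on \<open>(d, d', d, a)\<close>: the face \<open>(d', d, a)\<close>
  has no split and the sign at \<open>(d, d, a)\<close> is trivial. Hence the sign of a move that
  splits depends only on the move.\<close>

lemma elementary:
  assumes "d \<in> cm n" "d' \<in> cm n" "a \<in> cm n" "Suc (cg d d') = n" "cg d a = Suc (cg d' a)"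
  shows "nz d d' a \<and> \<rho> d d' a = lam d d'"
proof -
  have nz: "nz d d' a" using assms by (intro one_split) simp_all
  have "\<rho> d d' d * \<rho> d d a = \<rho> d d' a"
    using cocycle_right[of d d' d a] nz assms by (simp add: glue_commute[of d' d])
  moreover have "\<rho> d d a = 1" using assms cg_self by (intro no_split) simp_all
  ultimately show ?thesis using nz by (simp add: lam_def)
qed

text \<open>Both values equal \<open>\<rho> x y' x'\<close>: the left one through
  \<open>\<rho> x y x'\<close> and the relation on \<open>(x, y, y', x')\<close>, the right one
  through \<open>(x, x', y', x')\<close>. The other signs involved come from faces without
  splits.\<close>

lemma square:
  assumes cms: "x \<in> cm n" "y \<in> cm n" "x' \<in> cm n" "y' \<in> cm n"
    and sides: "Suc (cg x y) = n" "Suc (cg x' y') = n" "Suc (cg x x') = n" "Suc (cg y y') = n"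
    and diagonals: "Suc (Suc (cg x y')) = n" "Suc (Suc (cg y x')) = n"
  shows "lam x y = lam x' y'"
proof -
  note gc = glue_commute[of y' x'] glue_commute[of x' x]
  have 1: "nz x y x'" "\<rho> x y x' = lam x y" using elementary[of x y x'] assms by auto
  have 2: "nz x y' x'" "\<rho> x y y' * \<rho> x y' x' = \<rho> x y x'"
    using cocycle_right[of x y y' x'] 1(1) assms gc by auto
  have "\<rho> x y y' = 1" using assms by (intro no_split) simp_all
  then have 3: "\<rho> x y' x' = \<rho> x y x'" using 2(2) by simp
  have "\<rho> x y' x' = \<rho> x x' x' * \<rho> x' y' x'"
    using cocycle_left[of x x' y' x'] 2(1) assms by auto
  moreover have "\<rho> x x' x' = 1" using assms cg_self by (intro no_split) simp_all
  ultimately show ?thesis using 1(2) 3 by (simp add: lam_def)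
qed

text \<open>In a square on \<open>std n\<close>, two moves and \<open>Y\<close>, the side from
  \<open>std n\<close> to one move equals the side from the other move to \<open>Y\<close>. Two
  moves compared with the same third one therefore have the same value.\<close>

lemma lam_triple:
  assumes "r < s" "s < t" "t < n"
  shows "lam (std n) (tau n r s) = lam (std n) (tau n r t)" "lam (std n) (tau n s t) = lam (std n) (tau n r t)"
    "lam (tau n r s) (std n) = lam (tau n r t) (std n)" "lam (tau n s t) (std n) = lam (tau n r t) (std n)"
proof -
  define Y where "Y = exchange (tau n r s) (2 * s + 2) (2 * r + 1) (2 * t + 1) (2 * t + 2)"
  note Y = three_cycle[OF assms, folded Y_def]
  have lt: "r < t" "s < n" using assms by auto
  note rs = tau_facts(1,2)[OF assms(1) lt(2)] and st = tau_facts(1,2)[OF assms(2,3)] and rt = tau_facts(1,2)[OF lt(1) assms(3)]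
  have sq: "lam (std n) z = lam w Y" "lam z (std n) = lam Y w"
    if "z \<in> cm n" "w \<in> cm n" "Suc (cg (std n) z) = n" "Suc (cg (std n) w) = n" "Suc (cg z Y) = n" "Suc (cg w Y) = n"
      "Suc (Suc (cg z w)) = n" for z w
  proof -
    show "lam (std n) z = lam w Y"
      using that Y(5) by (intro square std_cm Y(1)) (simp_all add: glue_commute)
    show "lam z (std n) = lam Y w"
      using that Y(5) by (intro square std_cm Y(1)) (simp_all add: glue_commute)
  qed
  note gc = glue_commute[of "tau n r t" "tau n r s"] glue_commute[of "tau n s t" "tau n r s"] glue_commute[of "tau n r t" "tau n s t"]
  note a = sq[OF rs(1) st(1) rs(2) st(2) Y(2,3,6)] sq[OF rt(1) st(1) rt(2) st(2) Y(4,3) Y(8)[unfolded gc(3)[symmetric]]]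
    sq[OF st(1) rs(1) st(2) rs(2) Y(3,2) Y(6)[unfolded gc(2)[symmetric]]] sq[OF rt(1) rs(1) rt(2) rs(2) Y(4,2) Y(7)[unfolded gc(1)[symmetric]]]
  show "lam (std n) (tau n r s) = lam (std n) (tau n r t)" "lam (std n) (tau n s t) = lam (std n) (tau n r t)"
    "lam (tau n r s) (std n) = lam (tau n r t) (std n)" "lam (tau n s t) (std n) = lam (tau n r t) (std n)"
    using a by simp_all
qed

lemma lam_tau:
  assumes "r < s" "s < n" shows "lam (std n) (tau n r s) = 1" "lam (tau n r s) (std n) = 1"
proof -
  have b: "lam (std n) (tau n 0 1) = 1" "lam (tau n 0 1) (std n) = 1" using base assms by (simp_all add: lam_def)
  have 0: "lam (std n) (tau n 0 s) = 1 \<and> lam (tau n 0 s) (std n) = 1" if "0 < s" "s < n" for s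
  proof (cases "s = 1")
    case False
    then show ?thesis using lam_triple[of 0 1 s] that b by simp
  qed (use b in simp)
  have "lam (std n) (tau n r s) = 1 \<and> lam (tau n r s) (std n) = 1"
  proof (cases "r = 0")
    case False
    then show ?thesis using lam_triple[of 0 r s] 0[of s] assms by simp
  qed (use 0 assms in simp)
  then show "lam (std n) (tau n r s) = 1" "lam (tau n r s) (std n) = 1" by auto
qed

text \<open>A cap missing from both ends of an edge can be created at both; this gives a square
  whose opposite edge has fewer missing caps. When no cap is missing from both, one end is
  \<open>std n\<close>.\<close>

lemma lam_edge: "x \<in> cm n \<Longrightarrow> y \<in> cm n \<Longrightarrow> Suc (cg x y) = n \<Longrightarrow> lam x y = 1"
proof (induction "card {m. m < n \<and> cap m \<notin> x}" arbitrary: x y rule: less_induct)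
  case less
  note x = less.prems(1) and y = less.prems(2) and g = less.prems(3)
  have all: "z = std n" if "z \<in> cm n" "\<And>m. m < n \<Longrightarrow> cap m \<in> z" for z
    using cm_subset_eq[OF std_cm that(1)] that(2) by (auto simp: std_def)
  show ?case
  proof (cases "\<exists>m<n. cap m \<notin> x \<and> cap m \<notin> y")
    case True
    then obtain m where m: "m < n" "cap m \<notin> x" "cap m \<notin> y" by blast
    obtain x' where x': "x' \<in> cm n" "cap m \<in> x'" "Suc (cg x x') = n"
      "\<forall>y\<in>cm n. cg x y = Suc (cg x' y) \<or> cg x' y = Suc (cg x y)"
      "\<forall>y\<in>cm n. cap m \<in> y \<longrightarrow> cg x' y = Suc (cg x y)" "\<And>l. cap l \<in> x \<Longrightarrow> cap l \<in> x'"
      by (rule cap_move_cap[OF x m(1,2)]) blast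
    obtain y' where y': "y' \<in> cm n" "cap m \<in> y'" "Suc (cg y y') = n"
      "\<forall>x\<in>cm n. cg y x = Suc (cg y' x) \<or> cg y' x = Suc (cg y x)"
      by (rule cap_move_cap[OF y m(1,3)]) blast
    have d1: "Suc (Suc (cg x y')) = n"
      using y'(4)[rule_format, OF x] g cg_eq_n[OF y'(1) x] y'(2) m(2) glue_commute[of x] by auto
    have d2: "Suc (Suc (cg y x')) = n"
      using x'(4)[rule_format, OF y] g cg_eq_n[OF x'(1) y] x'(2) m(3) glue_commute[of y] by auto
    have s: "Suc (cg x' y') = n" using x'(5) y'(1,2) d1 by simp
    have "{m. m < n \<and> cap m \<notin> x'} \<subset> {m. m < n \<and> cap m \<notin> x}" using x'(2,6) m by blast
    then have "card {m. m < n \<and> cap m \<notin> x'} < card {m. m < n \<and> cap m \<notin> x}" by (intro psubset_card_mono) simp_all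
    then have "lam x' y' = 1" using less.hyps x'(1) y'(1) s by blast
    then show ?thesis using square[OF x y x'(1) y'(1) g s x'(3) y'(3) d1 d2] by simp
  next
    case False
    \<comment> \<open>Every cap now lies in \<open>x\<close> or in \<open>y\<close>. If
      \<open>y\<close> has one that \<open>x\<close> lacks, creating it turns \<open>x\<close> into
      \<open>y\<close>, so \<open>y\<close> also has the caps of \<open>x\<close>, hence all of
      them.\<close>
    have "x = std n \<or> y = std n"
    proof (cases "\<exists>m<n. cap m \<in> y \<and> cap m \<notin> x")
      case True
      then obtain m where m: "m < n" "cap m \<in> y" "cap m \<notin> x" by blast
      obtain x' where x': "x' \<in> cm n" "\<forall>y\<in>cm n. cap m \<in> y \<longrightarrow> cg x' y = Suc (cg x y)" "\<And>l. cap l \<in> x \<Longrightarrow> cap l \<in> x'"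
        by (rule cap_move_cap[OF x m(1,3)]) blast
      have "cg x' y = n" using x'(2) y m(2) g by simp
      then have "x' = y" by (rule cg_eq_n[OF x'(1) y])
      then have "y = std n" using all[OF y] False x'(3) by blast
      then show ?thesis by simp
    next
      case F: False
      then have "x = std n" using all[OF x] False by blast
      then show ?thesis by simp
    qed
    then show ?thesis
    proof
      assume e: "x = std n"
      then obtain r s where "r < s" "s < n" "y = tau n r s" using near_std[OF y] g by blast
      then show ?thesis using lam_tau e by simp
    next
      assume e: "y = std n"
      then obtain r s where "r < s" "s < n" "x = tau n r s" using near_std[OF x] g glue_commute[of x] by metis
      then show ?thesis using lam_tau e by simp
    qed
  qed
qed

text \<open>Walking from \<open>d\<close> towards \<open>b\<close> by moves that gain circles with
  \<open>b\<close> keeps the face \<open>(d, d', b)\<close> free of splits. The cocycle relation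
  then peels off the sign of one move, which is trivial by \<open>no_split\<close> or by
  \<open>lam_edge\<close>.\<close>

theorem signs_trivial: "d \<in> cm n \<Longrightarrow> b \<in> cm n \<Longrightarrow> a \<in> cm n \<Longrightarrow> nz d b a \<Longrightarrow> \<rho> d b a = 1"
proof (induction "card (b - d)" arbitrary: d rule: less_induct)
  case less
  note d = less.prems(1) and b = less.prems(2) and a = less.prems(3) and nz = less.prems(4)
  show ?case
  proof (cases "d = b")
    case True
    then show ?thesis using no_split[OF b b a] cg_self[OF b] by simp
  next
    case False
    obtain d' where d': "d' \<in> cm n" "Suc (cg d d') = n" "cg d' b = Suc (cg d b)"
      "\<forall>y\<in>cm n. cg d y = Suc (cg d' y) \<or> cg d' y = Suc (cg d y)" "card (b - d') < card (b - d)"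
      by (rule move_towards[OF d b False])
    have s: "cg d b + n = cg d d' + cg d' b" using d'(2,3) by simp
    have c: "nz d' b a" "\<rho> d b a = \<rho> d d' a * \<rho> d' b a"
      using cocycle_left[OF d d'(1) b a s nz] by auto
    have "\<rho> d' b a = 1" using less.hyps[OF d'(5) d'(1) b a c(1)] .
    moreover have "\<rho> d d' a = 1"
    proof (cases "cg d' a = Suc (cg d a)")
      case True
      then show ?thesis using d'(2) by (intro no_split[OF d d'(1) a]) simp
    next
      case False
      then have "cg d a = Suc (cg d' a)" using d'(4) a by blast
      then show ?thesis using elementary[OF d d'(1) a d'(2)] lam_edge[OF d d'(1,2)] by simp
    qed
    ultimately show ?thesis using c(2) by simp
  qed
qed

end

section \<open>Twists\<close>

text \<open>Left multiplications by integer combinations of circles. The inductive form reduces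
  anticommutation to generators.\<close>

inductive degree_one :: "nat set set \<Rightarrow> (exterior \<Rightarrow> exterior) \<Rightarrow> bool" for S where
  generator: "v \<in> S \<Longrightarrow> degree_one S (iota v)"
| add: "degree_one S J \<Longrightarrow> degree_one S K \<Longrightarrow> degree_one S (\<lambda>z. J z + K z)"
| scale: "degree_one S J \<Longrightarrow> degree_one S (\<lambda>z. frag_cmul k (J z))"

lemma degree_one_lin: "degree_one S J \<Longrightarrow> lin J"
  by (induction rule: degree_one.induct) (auto intro: lin_plus lin_scale)

lemma degree_one_closed: "degree_one S J \<Longrightarrow> z \<in> exterior_algebra S \<Longrightarrow> J z \<in> exterior_algebra S"
  by (induction rule: degree_one.induct) (auto intro: exterior_algebra_iota exterior_algebra_add exterior_algebra_cmul)

lemma degree_one_iota: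
  assumes "keyed S" "degree_one S J" "v \<in> S" "z \<in> exterior_algebra S"
  shows "J (iota v z) = - iota v (J z)"
  using assms(2)
proof (induction rule: degree_one.induct)
  case (generator w)
  show ?case
  proof (cases "w = v")
    case True then show ?thesis by (simp add: iota_iota)
  next
    case False
    then have "Min w \<noteq> Min v" using assms(1,3) generator by (meson inj_onD keyed_def)
    then show ?thesis using iota_anticomm[OF assms(4)] assms(1) unfolding keyed_def by blast
  qed
next
  case (add J K) then show ?case by (simp add: lin_add[OF lin_iota])
next
  case (scale J k) then show ?case by (simp add: lin_cmul[OF lin_iota] frag_cmul_uminus)
qed

lemma degree_one_anticomm:
  assumes "keyed S" "degree_one S K" "degree_one S J" "z \<in> exterior_algebra S"
  shows "J (K z) = - K (J z)"
  using assms(2)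
proof (induction rule: degree_one.induct)
  case (generator v) then show ?case by (rule degree_one_iota[OF assms(1,3) _ assms(4)])
next
  case (add K L) then show ?case by (simp add: lin_add[OF degree_one_lin[OF assms(3)]])
next
  case (scale K k) then show ?case by (simp add: lin_cmul[OF degree_one_lin[OF assms(3)]] frag_cmul_uminus)
qed

text \<open>Anticommutation with itself gives \<open>2 * J (J z) = 0\<close>, and integer
  coefficients have no torsion.\<close>

lemma degree_one_square:
  assumes "keyed S" "degree_one S J" "z \<in> exterior_algebra S"
  shows "J (J z) = 0"
proof -
  have e: "J (J z) = - J (J z)" by (rule degree_one_anticomm[OF assms(1,2,2,3)])
  show ?thesis
  proof (rule poly_mapping_eqI)
    fix A
    have "Poly_Mapping.lookup (J (J z)) A = - Poly_Mapping.lookup (J (J z)) A"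
      using arg_cong[OF e, of "\<lambda>x. Poly_Mapping.lookup x A"] by simp
    then show "Poly_Mapping.lookup (J (J z)) A = Poly_Mapping.lookup 0 A" by simp
  qed
qed

lemma degree_one_keys:
  assumes "degree_one S J" "finite S"
  shows "x \<in> exterior_algebra S \<Longrightarrow> B \<in> Poly_Mapping.keys (J x) \<Longrightarrow> \<exists>A\<in>Poly_Mapping.keys x. card B = Suc (card A)"
  using assms(1)
proof (induction arbitrary: B rule: degree_one.induct)
  case (generator v)
  then have B: "v \<in> B" "B - {v} \<in> Poly_Mapping.keys x"
    by (auto simp: in_keys_iff lookup_iota split: if_splits)
  then have "B - {v} \<subseteq> S" using generator(2) by (auto simp: exterior_algebra_def)
  then have "finite (B - {v})" using assms(2) finite_subset by blast
  then have "finite B" by simp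
  then have "card B = Suc (card (B - {v}))" using B(1) by (rule card.remove)
  then show ?case using B(2) by blast
next
  case (add J K)
  then show ?case using Poly_Mapping.keys_add[of "J x" "K x"] by blast
next
  case (scale J k) then show ?case using keys_cmul[of k "J x"] by blast
qed

text \<open>Identify a generator \<open>e i\<close> with the circle through the point \<open>i\<close>. The twist fixes
  \<open>e 1\<close> up to the sign \<open>\<epsilon>\<close> and multiplies \<open>e (i + 1) - e i\<close> by \<open>\<epsilon> \<delta>\<^sup>i\<close>: for \<open>\<delta> = -1\<close> it distinguishes
  the differences across the two classes of regions of the chequered plane. It is well defined
  because both half-planes are cut by crossingless matchings, which is \<open>transport_arc\<close>.\<close>

definition twist_generator :: "int \<Rightarrow> int \<Rightarrow> (nat \<Rightarrow> nat set) \<Rightarrow> nat \<Rightarrow> exterior \<Rightarrow> exterior" where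
  "twist_generator \<epsilon> \<delta> e i x = frag_cmul \<epsilon> (iota (e 1) x) +
     (\<Sum>j=1..<i. frag_cmul (\<epsilon> * \<delta> ^ j) (iota (e (Suc j)) x - iota (e j) x))"

lemma twist_generator_1: "twist_generator \<epsilon> \<delta> e 1 x = frag_cmul \<epsilon> (iota (e 1) x)"
  by (simp add: twist_generator_def)

lemma twist_generator_Suc:
  "1 \<le> i \<Longrightarrow> twist_generator \<epsilon> \<delta> e (Suc i) x =
    twist_generator \<epsilon> \<delta> e i x + frag_cmul (\<epsilon> * \<delta> ^ i) (iota (e (Suc i)) x - iota (e i) x)"
  by (simp add: twist_generator_def)

lemma twist_degree_one:
  assumes "\<And>i. i \<in> {1..N} \<Longrightarrow> e i \<in> S" shows "1 \<le> i \<Longrightarrow> i \<le> N \<Longrightarrow> degree_one S (twist_generator \<epsilon> \<delta> e i)"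
proof (induction i rule: dec_induct)
  case base
  have "degree_one S (\<lambda>x. frag_cmul \<epsilon> (iota (e 1) x))"
    using base assms by (intro degree_one.intros) simp
  then show ?case using twist_generator_1[of \<epsilon> \<delta> e] by presburger
next
  case (step i)
  have eq: "twist_generator \<epsilon> \<delta> e (Suc i) = (\<lambda>x. twist_generator \<epsilon> \<delta> e i x +
      frag_cmul (\<epsilon> * \<delta> ^ i) (iota (e (Suc i)) x + frag_cmul (-1) (iota (e i) x)))"
    using twist_generator_Suc[OF step(1)] by (simp add: fun_eq_iff)
  show ?case unfolding eq using step assms by (intro degree_one.intros) auto
qed

text \<open>Directly below an arc the points form consecutive outermost arcs. By induction
  \<open>G\<close> and \<open>E\<close> agree at the ends of each of them, so crossing it costs
  nothing. The remaining steps start at points with the parity of \<open>i\<close>, all carry the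
  factor \<open>\<delta> ^ i\<close>, and telescope to a multiple of \<open>E k - E i\<close>, which
  is zero.\<close>

lemma transport_arc:
  fixes G E :: "nat \<Rightarrow> exterior"
  assumes x: "x \<in> cm n" and \<delta>: "\<delta> * \<delta> = (1 :: int)"
    and G: "\<And>m. 1 \<le> m \<Longrightarrow> G (Suc m) = G m + frag_cmul (c * \<delta> ^ m) (E (Suc m) - E m)"
    and E: "\<And>u v. {u, v} \<in> x \<Longrightarrow> E u = E v"
    and ik: "{i, k} \<in> x"
  shows "G i = G k"
proof -
  have "{i, k} \<in> x \<Longrightarrow> i < k \<Longrightarrow> G i = G k" for i k
  proof (induction "k - i" arbitrary: i k rule: less_induct)
    case less
    note ik = less.prems and IH = less.hyps
    have pi: "1 \<le> i" using cm_range[OF x ik(1)] by simp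
    define X where "X m = frag_cmul (c * \<delta> ^ i) (E m - E i)" for m
    \<comment> \<open>The points from \<open>m\<close> to \<open>k - 1\<close> are matched among
      themselves, so \<open>m\<close> opens the next outermost arc below the given one, unless
      \<open>m = k\<close>.\<close>
    define top where "top m \<longleftrightarrow> (\<forall>u v. {u, v} \<in> x \<and> m \<le> u \<and> u < k \<longrightarrow> m \<le> v \<and> v < k)" for m
    have parity: "\<delta> ^ m = \<delta> ^ i" if "even (m + i)" for m
    proof -
      have \<delta>2: "\<delta> = 1 \<or> \<delta> = -1" using \<delta> by (simp add: zmult_eq_1_iff)
      then show ?thesis using that by (auto simp: minus_one_power_iff)
    qed
    have run: "G k - G i = X k" if "i < m" "m \<le> k" "odd (m + i)" "top m" "G m - G i = X m" for m
      using that
    proof (induction "k - m" arbitrary: m rule: less_induct)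
      case less
      show ?case
      proof (cases "m = k")
        case True then show ?thesis using less.prems by simp
      next
        case False
        have mk: "m < k" using False less.prems by simp
        then have "m \<in> {1..2 * n}" using cm_range[OF x ik(1)] less.prems(1) by auto
        then obtain m' where m': "{m, m'} \<in> x" "m' \<noteq> m" by (rule cm_mate[OF x])
        have "m \<le> m' \<and> m' < k" using less.prems(4) m'(1) mk unfolding top_def by blast
        then have mm: "m < m'" "m' < k" using m'(2) by auto
        have Gm: "G m = G m'" using less.prems(1,2) mm by (intro IH[OF _ m'(1)]) auto
        have Em: "E m = E m'" by (rule E[OF m'(1)])
        have odd: "odd m \<noteq> odd m'" using cm_parity[OF x m'(1) mm(1)] .
        then have ev: "even (m' + i)" using less.prems(3) by auto
        have Gs: "G (Suc m') = G m' + frag_cmul (c * \<delta> ^ i) (E (Suc m') - E m')"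
          using G[of m'] mm parity[OF ev] by simp
        have "G (Suc m') - G i = (G m - G i) + frag_cmul (c * \<delta> ^ i) (E (Suc m') - E m)"
          unfolding Gs Gm Em by simp
        also have "\<dots> = X (Suc m')"
          unfolding less.prems(5) X_def by (simp flip: frag_cmul_distrib2)
        finally have "G (Suc m') - G i = X (Suc m')" .
        moreover have "top (Suc m')"
          unfolding top_def
        proof (intro allI impI)
          fix u v assume uv: "{u, v} \<in> x \<and> Suc m' \<le> u \<and> u < k"
          then have v: "m \<le> v \<and> v < k" using less.prems(4) mm unfolding top_def by (meson Suc_leD less_le_trans order_less_imp_le)
          have ne: "{u, v} \<noteq> {m, m'}" using uv mm by (auto simp: doubleton_eq_iff)
          have "{u, v} \<inter> {m, m'} = {}" using cm_unique[OF x _ m'(1)] uv ne by blast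
          then have "v \<noteq> m" "v \<noteq> m'" by auto
          moreover have "(m < u \<and> u < m') \<longleftrightarrow> (m < v \<and> v < m')"
            by (rule cm_sides[OF x _ m'(1) ne mm(1)]) (use uv in blast)
          then have "\<not> (m < v \<and> v < m')" using uv by auto
          ultimately show "Suc m' \<le> v \<and> v < k" using v by simp
        qed
        ultimately show ?thesis using less.prems(1,2,3) mm odd ev by (intro less.hyps) auto
      qed
    qed
    have "G (Suc i) - G i = X (Suc i)" using G[OF pi] by (simp add: X_def)
    moreover have "top (Suc i)"
      unfolding top_def
    proof (intro allI impI)
      fix u v assume uv: "{u, v} \<in> x \<and> Suc i \<le> u \<and> u < k"
      then have ne: "{u, v} \<noteq> {i, k}" by (auto simp: doubleton_eq_iff)
      have "(i < u \<and> u < k) \<longleftrightarrow> (i < v \<and> v < k)"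
        by (rule cm_sides[OF x _ ik(1) ne ik(2)]) (use uv in blast)
      then have "i < v \<and> v < k" using uv by simp
      then show "Suc i \<le> v \<and> v < k" by simp
    qed
    ultimately have "G k - G i = X k" using run[of "Suc i"] ik(2) by simp
    also have "\<dots> = 0" using E[OF ik(1)] by (simp add: X_def)
    finally show ?case by simp
  qed
  moreover have "i \<noteq> k" by (rule cm_distinct[OF x ik])
  moreover have "{k, i} \<in> x" using ik by (simp add: insert_commute)
  ultimately show ?thesis using ik by (metis linorder_neqE_nat)
qed

lemma twist_arc:
  assumes "x \<in> cm n" "\<delta> * \<delta> = 1" "\<And>u v. {u, v} \<in> x \<Longrightarrow> iota (e u) z = iota (e v) z" "{i, k} \<in> x"
  shows "twist_generator \<epsilon> \<delta> e i z = twist_generator \<epsilon> \<delta> e k z"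
  by (rule transport_arc[OF assms(1,2) _ assms(3,4), where c = \<epsilon>]) (simp add: twist_generator_Suc)

text \<open>The operator for a circle is read off at its least point; by
  \<open>twist_generator_circle\<close> any of its points would give the same operator.\<close>

definition twist :: "int \<Rightarrow> int \<Rightarrow> matching \<Rightarrow> matching \<Rightarrow> exterior \<Rightarrow> exterior" where
  "twist \<epsilon> \<delta> b a = extend (\<lambda>s. twist_generator \<epsilon> \<delta> (circle_of (b \<union> a)) (Min s)) unit_ext"

section \<open>The twist as a graded involution of each component\<close>

locale twisted =
  fixes n :: nat and \<epsilon> \<delta> :: int
  assumes \<epsilon>: "\<epsilon> * \<epsilon> = 1" and \<delta>: "\<delta> * \<delta> = 1"
begin

lemma lin_twist: "lin (twist \<epsilon> \<delta> b a)" by (simp add: twist_def)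

lemma twist_unit: "twist \<epsilon> \<delta> b a unit_ext = unit_ext" by (simp add: twist_def)

context
  fixes b a :: matching
  assumes b: "b \<in> cm n" and a: "a \<in> cm n"
begin

abbreviation "e \<equiv> circle_of (b \<union> a)"
abbreviation "tg \<equiv> twist_generator \<epsilon> \<delta> e"

lemma glue_e: "glue b a = e ` {1..2 * n}" by (rule glue_eq[OF b a])

lemma keyed_g: "keyed (glue b a)"
  using three_matchings.keyed_glue(1)[OF cm_three[OF b a a]] .

lemma e_glue: "i \<in> {1..2 * n} \<Longrightarrow> e i \<in> glue b a" by (simp add: glue_e)

lemma twist_generator_circle: "k \<in> e i \<Longrightarrow> tg i z = tg k z"
proof (rule circle_of_respects[of k "b \<union> a" i "\<lambda>i. tg i z"])
  fix x y assume xy: "{x, y} \<in> b \<union> a"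
  have E: "iota (e u) z = iota (e v) z" if "{u, v} \<in> b \<union> a" for u v
    using circle_of_edge[OF that] by simp
  show "tg x z = tg y z"
    using xy twist_arc[OF b \<delta>, of e z x y] twist_arc[OF a \<delta>, of e z x y] E by blast
qed

lemma twist_generator_Min: "i \<in> {1..2 * n} \<Longrightarrow> tg (Min (e i)) = tg i \<and> Min (e i) \<in> {1..2 * n}"
proof -
  assume i: "i \<in> {1..2 * n}"
  have sub: "e i \<subseteq> {1..2 * n}"
    using cm_facts(1)[OF b] cm_facts(1)[OF a] by (intro circle_of_subset[OF _ i]) auto
  then have "finite (e i)" by (rule finite_subset) simp
  then have "Min (e i) \<in> e i" using circle_of_self by (metis Min_in empty_iff)
  then show ?thesis using twist_generator_circle sub by (auto simp: fun_eq_iff)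
qed

lemma tg_degree_one: "i \<in> {1..2 * n} \<Longrightarrow> degree_one (glue b a) (tg i)"
  using twist_degree_one[of "2 * n" e "glue b a" i] e_glue by simp

lemma J_degree_one: "s \<in> glue b a \<Longrightarrow> degree_one (glue b a) (tg (Min s))"
  unfolding glue_e using twist_generator_Min tg_degree_one[unfolded glue_e] by auto

lemma anticommuting_twist: "anticommuting (glue b a) (glue b a) (\<lambda>s. tg (Min s))"
proof
  show "keyed (glue b a)" by (rule keyed_g)
  show "lin (tg (Min v))" if "v \<in> glue b a" for v by (rule degree_one_lin[OF J_degree_one[OF that]])
  show "tg (Min v) z \<in> exterior_algebra (glue b a)" if "v \<in> glue b a" "z \<in> exterior_algebra (glue b a)" for v z
    by (rule degree_one_closed[OF J_degree_one[OF that(1)] that(2)])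
  show "tg (Min v) (tg (Min v) z) = 0" if "v \<in> glue b a" "z \<in> exterior_algebra (glue b a)" for v z
    by (rule degree_one_square[OF keyed_g J_degree_one[OF that(1)] that(2)])
  show "tg (Min v) (tg (Min w) z) = - tg (Min w) (tg (Min v) z)"
    if "v \<in> glue b a" "w \<in> glue b a" "z \<in> exterior_algebra (glue b a)" for v w z
    by (rule degree_one_anticomm[OF keyed_g J_degree_one[OF that(2)] J_degree_one[OF that(1)] that(3)])
qed

lemma twist_closed: "x \<in> exterior_algebra (glue b a) \<Longrightarrow> twist \<epsilon> \<delta> b a x \<in> exterior_algebra (glue b a)"
  unfolding twist_def by (rule anticommuting.extend_closed[OF anticommuting_twist]) simp_all

lemma twist_iota:
  assumes "x \<in> exterior_algebra (glue b a)" "i \<in> {1..2 * n}"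
  shows "twist \<epsilon> \<delta> b a (iota (e i) x) = tg i (twist \<epsilon> \<delta> b a x)"
  using anticommuting.extend_iota[OF anticommuting_twist assms(1) exterior_algebra_unit e_glue[OF assms(2)]]
    twist_generator_Min[OF assms(2)] by (simp add: twist_def)

text \<open>The twist multiplies each difference of consecutive generators by a sign of square 1, so
  applying it twice restores the generators one after another.\<close>

lemma twist_twist_generator:
  assumes x: "x \<in> exterior_algebra (glue b a)"
  shows "1 \<le> i \<Longrightarrow> i \<le> 2 * n \<Longrightarrow> twist \<epsilon> \<delta> b a (tg i x) = iota (e i) (twist \<epsilon> \<delta> b a x)"
proof (induction i rule: dec_induct)
  case base
  then show ?case
    unfolding twist_generator_1 lin_cmul[OF lin_twist] using twist_iota[OF x, of 1] \<epsilon>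
    by (simp add: twist_generator_1[simplified])
next
  case (step i)
  have i: "i \<in> {1..2 * n}" "Suc i \<in> {1..2 * n}" using step by auto
  have "\<epsilon> * \<delta> ^ i * (\<epsilon> * \<delta> ^ i) = (\<epsilon> * \<epsilon>) * (\<delta> * \<delta>) ^ i" by (simp add: power_mult_distrib algebra_simps)
  then have sq: "\<epsilon> * \<delta> ^ i * (\<epsilon> * \<delta> ^ i) = 1" using \<epsilon> \<delta> by simp
  have "twist \<epsilon> \<delta> b a (tg (Suc i) x) = iota (e i) (twist \<epsilon> \<delta> b a x) +
      frag_cmul (\<epsilon> * \<delta> ^ i) (tg (Suc i) (twist \<epsilon> \<delta> b a x) - tg i (twist \<epsilon> \<delta> b a x))"
    unfolding twist_generator_Suc[OF step(1)] lin_add[OF lin_twist] lin_cmul[OF lin_twist] lin_diff[OF lin_twist]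
      twist_iota[OF x i(1)] twist_iota[OF x i(2)] using step
    by (simp add: twist_generator_Suc[OF step(1)])
  also have "\<dots> = iota (e (Suc i)) (twist \<epsilon> \<delta> b a x)"
    unfolding twist_generator_Suc[OF step(1)] by (simp add: sq)
  finally show ?case .
qed

lemma twist_twist:
  assumes "x \<in> exterior_algebra (glue b a)" shows "twist \<epsilon> \<delta> b a (twist \<epsilon> \<delta> b a x) = x"
  using keyed_g assms
proof (induction x rule: exterior_induct)
  case unit show ?case by (simp add: twist_unit)
next
  case (diff x y) then show ?case by (simp add: lin_diff[OF lin_twist])
next
  case (iota x v)
  then obtain i where i: "i \<in> {1..2 * n}" "v = e i" unfolding glue_e by blast
  then show ?case using iota twist_twist_generator[OF twist_closed[OF iota(2)], of i]
    by (simp add: twist_iota)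
qed

lemma twist_keys:
  assumes x: "x \<in> exterior_algebra (glue b a)" and A: "A \<in> Poly_Mapping.keys (twist \<epsilon> \<delta> b a x)"
  shows "\<exists>B\<in>Poly_Mapping.keys x. card A = card B"
proof -
  let ?J = "\<lambda>s. tg (Min s)"
  have fin: "finite (glue b a)" using keyed_g by (simp add: keyed_def)
  have f: "card A = length vs" if "A \<in> Poly_Mapping.keys (foldr ?J vs unit_ext)" "set vs \<subseteq> glue b a" for vs A
    using that
  proof (induction vs arbitrary: A)
    case Nil then show ?case by (simp add: unit_ext_def)
  next
    case (Cons v vs)
    have "foldr ?J vs unit_ext \<in> exterior_algebra (glue b a)"
      using Cons.prems(2) by (intro anticommuting.foldr_closed[OF anticommuting_twist]) simp_all
    then obtain B where "B \<in> Poly_Mapping.keys (foldr ?J vs unit_ext)" "card A = Suc (card B)"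
      using degree_one_keys[OF J_degree_one[of v] fin, of "foldr ?J vs unit_ext" A] Cons.prems by auto
    then show ?case using Cons by auto
  qed
  obtain B where B: "B \<in> Poly_Mapping.keys x" "A \<in> Poly_Mapping.keys (foldr ?J (increasing_list B) unit_ext)"
    using A keys_frag_extend unfolding twist_def extend_def by fastforce
  have "B \<subseteq> glue b a" using B(1) x by (auto simp: exterior_algebra_def)
  then have k: "keyed B" by (rule keyed_subset[OF keyed_g])
  then have "length (increasing_list B) = card B" by (metis distinct_card distinct_increasing_list set_increasing_list)
  then show ?thesis using f[OF B(2)] B(1) \<open>B \<subseteq> glue b a\<close> set_increasing_list[OF k] by auto
qed

end

end

section \<open>Compatibility of twists with products\<close>

lemma frag_cmul_diff: "frag_cmul k (x - y) = frag_cmul k x - frag_cmul k (y :: exterior)"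
  by (rule lin_diff[OF lin_scale[of "\<lambda>x. x", OF linI[OF refl]]])

lemma rule_admissible:
  assumes "C \<in> multiplication_rules n" "c \<in> cm n" "b \<in> cm n" "a \<in> cm n"
  shows "admissible_rule n C c b a"
proof -
  have "admissible_order n b (fst (C c b a))" "orientation b (snd (C c b a))"
    using assms by (simp_all add: multiplication_rules_def)
  then show ?thesis by (simp add: admissible_order_def admissible_rule_def permutations_of_set_def)
qed

context three_matchings
begin

text \<open>The left factor is taken apart against a general right factor and the right factor only
  against the unit, so no sign depending on a degree occurs and agreement at the units
  decides.\<close>

lemma bilinear_agree:
  assumes lins: "\<And>y. lin (\<lambda>x. A x y)" "\<And>y. lin (\<lambda>x. B x y)" "lin (A unit_ext)" "lin (B unit_ext)"
    and AB: "A unit_ext unit_ext = B unit_ext unit_ext"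
    and A: "\<And>x y i. x \<in> exterior_algebra (glue c b) \<Longrightarrow> y \<in> exterior_algebra (glue b a) \<Longrightarrow> i \<in> {1..2 * n} \<Longrightarrow>
        A (iota (cb i) x) y = K i (A x y)"
      "\<And>y i. y \<in> exterior_algebra (glue b a) \<Longrightarrow> i \<in> {1..2 * n} \<Longrightarrow> A unit_ext (iota (ba i) y) = K i (A unit_ext y)"
    and B: "\<And>x y i. x \<in> exterior_algebra (glue c b) \<Longrightarrow> y \<in> exterior_algebra (glue b a) \<Longrightarrow> i \<in> {1..2 * n} \<Longrightarrow>
        B (iota (cb i) x) y = K i (B x y)"
      "\<And>y i. y \<in> exterior_algebra (glue b a) \<Longrightarrow> i \<in> {1..2 * n} \<Longrightarrow> B unit_ext (iota (ba i) y) = K i (B unit_ext y)"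
    and x: "x \<in> exterior_algebra (glue c b)" and y: "y \<in> exterior_algebra (glue b a)"
  shows "A x y = B x y"
proof -
  have 1: "A unit_ext y = B unit_ext y"
    using keyed_glue(2) y
  proof (induction y rule: exterior_induct)
    case unit show ?case by (rule AB)
  next
    case (diff x y) then show ?case by (simp add: lin_diff[OF lins(3)] lin_diff[OF lins(4)])
  next
    case (iota x v)
    then obtain i where "i \<in> {1..2 * n}" "v = ba i" unfolding glue_circles by blast
    then show ?case using A(2) B(2) iota by simp
  qed
  show ?thesis
    using keyed_glue(1) x
  proof (induction x rule: exterior_induct)
    case unit show ?case by (rule 1)
  next
    case (diff x x') then show ?case by (simp add: lin_diff[OF lins(1)] lin_diff[OF lins(2)])
  next
    case (iota x v)
    then obtain i where "i \<in> {1..2 * n}" "v = cb i" unfolding glue_circles by blast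
    then show ?case using A(1) B(1) iota y by simp
  qed
qed

lemma mult_zero:
  assumes C: "admissible_rule n C c b a" and z: "component_mult C c b a unit_ext unit_ext = 0"
    and xy: "x \<in> exterior_algebra (glue c b)" "y \<in> exterior_algebra (glue b a)"
  shows "component_mult C c b a x y = 0"
proof -
  obtain s where s: "card (glue c a) + n = card (glue c b) + card (glue b a) + 2 * s" by (rule rule_stage[OF C])
  show ?thesis
    by (rule bilinear_agree[where B = "\<lambda>x y. 0" and K = "\<lambda>i z. frag_cmul ((- 1) ^ s) (iota (ca i) z)", OF _ _ _ _ _ _ _ _ _ xy])
      (simp_all add: z lin_zero mult_iota_left[OF C s] mult_iota_right[OF C s] lin_mult_left lin_mult_right linI)
qed

text \<open>\<open>twist_generator\<close> is indexed by points, so the same combination of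
  consecutive points appears in source and target, and \<open>mult_iota_left\<close> applies term by
  term.\<close>

lemma mult_twist_generator_left:
  assumes C: "admissible_rule n C c b a" and s: "card (glue c a) + n = card (glue c b) + card (glue b a) + 2 * s"
    and xy: "x \<in> exterior_algebra (glue c b)" "y \<in> exterior_algebra (glue b a)"
  shows "1 \<le> i \<Longrightarrow> i \<le> 2 * n \<Longrightarrow> component_mult C c b a (twist_generator \<epsilon> \<delta> cb i x) y =
    frag_cmul ((- 1) ^ s) (twist_generator \<epsilon> \<delta> ca i (component_mult C c b a x y))"
proof (induction i rule: dec_induct)
  case base
  then show ?case
    unfolding twist_generator_1 lin_cmul[OF lin_mult_left[of C y]] using mult_iota_left[OF C s xy, of 1]
    by (simp add: mult.commute)
next
  case (step i)
  then have i: "i \<in> {1..2 * n}" "Suc i \<in> {1..2 * n}" by auto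
  have L: "lin (\<lambda>x. component_mult C c b a x y)" by (rule lin_mult_left)
  show ?case
    unfolding twist_generator_Suc[OF step(1)] lin_add[OF L] lin_cmul[OF L] lin_diff[OF L]
      mult_iota_left[OF C s xy i(1)] mult_iota_left[OF C s xy i(2)]
    using step by (simp add: frag_cmul_distrib2 frag_cmul_diff mult.commute)
qed

lemma mult_twist_generator_right:
  assumes C: "admissible_rule n C c b a" and s: "card (glue c a) + n = card (glue c b) + card (glue b a) + 2 * s"
    and y: "y \<in> exterior_algebra (glue b a)"
  shows "1 \<le> i \<Longrightarrow> i \<le> 2 * n \<Longrightarrow> component_mult C c b a unit_ext (twist_generator \<epsilon> \<delta> ba i y) =
    frag_cmul ((- 1) ^ s) (twist_generator \<epsilon> \<delta> ca i (component_mult C c b a unit_ext y))"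
proof (induction i rule: dec_induct)
  case base
  then show ?case
    unfolding twist_generator_1 lin_cmul[OF lin_mult_right] using mult_iota_right[OF C s y, of 1]
    by (simp add: mult.commute)
next
  case (step i)
  then have i: "i \<in> {1..2 * n}" "Suc i \<in> {1..2 * n}" by auto
  show ?case
    unfolding twist_generator_Suc[OF step(1)] lin_add[OF lin_mult_right] lin_cmul[OF lin_mult_right]
      lin_diff[OF lin_mult_right] mult_iota_right[OF C s y i(1)] mult_iota_right[OF C s y i(2)]
    using step by (simp add: frag_cmul_distrib2 frag_cmul_diff mult.commute)
qed

end

context twisted
begin

text \<open>The twist preserves the degree and, by \<open>transport_arc\<close> for the arcs of
  \<open>b\<close>, the annihilation that characterises the product of the units. So it multiplies
  that product by an integer, which is a sign because the twist is an involution.\<close>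

lemma twist_unit_product:
  assumes cba: "c \<in> cm n" "b \<in> cm n" "a \<in> cm n" and C: "admissible_rule n C c b a"
  obtains k where "k = 1 \<or> k = (-1 :: int)"
    "twist \<epsilon> \<delta> c a (component_mult C c b a unit_ext unit_ext) = frag_cmul k (component_mult C c b a unit_ext unit_ext)"
proof -
  interpret three_matchings n c b a by (rule cm_three[OF cba])
  let ?U = "component_mult C c b a unit_ext unit_ext"
  have "\<exists>k. (k = 1 \<or> k = (-1 :: int)) \<and> twist \<epsilon> \<delta> c a ?U = frag_cmul k ?U"
  proof (cases "?U = 0")
    case True then show ?thesis by (intro exI[of _ 1]) (simp add: lin_zero[OF lin_twist])
  next
    case False
    obtain s where s: "card (glue c a) + n = card (glue c b) + card (glue b a) + 2 * s" by (rule rule_stage[OF C])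
    have U: "?U \<in> exterior_algebra (glue c a)" by (rule mult_closed[OF C]) simp_all
    have hom: "homogeneous s (twist \<epsilon> \<delta> c a ?U)"
      unfolding homogeneous_def
    proof (intro allI impI)
      fix A assume "Poly_Mapping.lookup (twist \<epsilon> \<delta> c a ?U) A \<noteq> 0"
      then obtain B where "B \<in> Poly_Mapping.keys ?U" "card A = card B"
        using twist_keys[OF cba(1,3) U] by (metis in_keys_iff)
      then show "card A = s" using mult_unit_homogeneous[OF C s] by (simp add: homogeneous_def in_keys_iff)
    qed
    have killed: "iota (ca i) (twist \<epsilon> \<delta> c a ?U) = iota (ca j) (twist \<epsilon> \<delta> c a ?U)" if ij: "{i, j} \<in> b" for i j
    proof -
      have r: "1 \<le> i" "i \<le> 2 * n" "1 \<le> j" "j \<le> 2 * n" using cm_range[OF cba(2) ij] by auto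
      have "twist_generator \<epsilon> \<delta> ca i ?U = twist_generator \<epsilon> \<delta> ca j ?U"
        using mult_unit_killed[OF C] ij by (intro twist_arc[OF cba(2) \<delta>]) auto
      then show ?thesis
        using twist_twist_generator[OF cba(1,3) U r(1,2)] twist_twist_generator[OF cba(1,3) U r(3,4)] by simp
    qed
    obtain k where k: "twist \<epsilon> \<delta> c a ?U = frag_cmul k ?U"
      by (rule mult_unit_generates[OF C s False twist_closed[OF cba(1,3) U] hom killed])
    have "?U = frag_cmul (k * k) ?U"
      using twist_twist[OF cba(1,3) U] by (simp add: k lin_cmul[OF lin_twist])
    moreover obtain A where "Poly_Mapping.lookup ?U A \<noteq> 0" using False by (metis lookup_zero poly_mapping_eqI)
    ultimately have "k * k = 1" by (metis lookup_frag_cmul mult_cancel_right1)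
    then have "k = 1 \<or> k = -1" using zmult_eq_1_iff[of k k] by blast
    then show ?thesis using k by blast
  qed
  then show ?thesis using that by blast
qed

text \<open>Both sides turn a circle at \<open>i\<close> into the same operator on the result, so
  they need to be compared at the units only; there the twist contributes \<open>k\<close> and the
  change of rule \<open>\<tau>\<close>.\<close>

lemma twisted_product:
  assumes cba: "c \<in> cm n" "b \<in> cm n" "a \<in> cm n" and C: "admissible_rule n C c b a" and C': "admissible_rule n C' c b a"
  shows "\<exists>\<rho>. (\<rho> = 1 \<or> \<rho> = (-1 :: int)) \<and> (\<forall>x\<in>exterior_algebra (glue c b). \<forall>y\<in>exterior_algebra (glue b a).
      twist \<epsilon> \<delta> c a (component_mult C c b a x y) =
      frag_cmul \<rho> (component_mult C' c b a (twist \<epsilon> \<delta> c b x) (twist \<epsilon> \<delta> b a y)))"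
proof -
  interpret three_matchings n c b a by (rule cm_three[OF cba])
  let ?U = "component_mult C c b a unit_ext unit_ext"
  obtain \<tau> where \<tau>: "\<tau> = 1 \<or> \<tau> = (-1 :: int)"
    "\<And>x y. x \<in> exterior_algebra (glue c b) \<Longrightarrow> y \<in> exterior_algebra (glue b a) \<Longrightarrow>
      component_mult C' c b a x y = frag_cmul \<tau> (component_mult C c b a x y)" by (rule mult_sign[OF C C']) blast
  obtain k where k: "k = 1 \<or> k = (-1 :: int)" "twist \<epsilon> \<delta> c a ?U = frag_cmul k ?U"
    by (rule twist_unit_product[OF cba C])
  obtain s where s: "card (glue c a) + n = card (glue c b) + card (glue b a) + 2 * s" by (rule rule_stage[OF C])
  have "twist \<epsilon> \<delta> c a (component_mult C c b a x y) =
      frag_cmul (k * \<tau>) (component_mult C' c b a (twist \<epsilon> \<delta> c b x) (twist \<epsilon> \<delta> b a y))"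
    if xy: "x \<in> exterior_algebra (glue c b)" "y \<in> exterior_algebra (glue b a)" for x y
  proof (rule bilinear_agree[where K = "\<lambda>i z. frag_cmul ((- 1) ^ s) (twist_generator \<epsilon> \<delta> ca i z)", OF _ _ _ _ _ _ _ _ _ xy])
    show "lin (\<lambda>x. twist \<epsilon> \<delta> c a (component_mult C c b a x y))" for y
      by (rule lin_compose[OF lin_twist lin_mult_left])
    show "lin (\<lambda>y. twist \<epsilon> \<delta> c a (component_mult C c b a unit_ext y))"
      by (rule lin_compose[OF lin_twist lin_mult_right])
    show "lin (\<lambda>x. frag_cmul (k * \<tau>) (component_mult C' c b a (twist \<epsilon> \<delta> c b x) (twist \<epsilon> \<delta> b a y)))" for y
      by (rule lin_scale[OF lin_compose[OF lin_mult_left lin_twist]])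
    show "lin (\<lambda>y. frag_cmul (k * \<tau>) (component_mult C' c b a (twist \<epsilon> \<delta> c b unit_ext) (twist \<epsilon> \<delta> b a y)))"
      by (rule lin_scale[OF lin_compose[OF lin_mult_right lin_twist]])
    show "twist \<epsilon> \<delta> c a ?U = frag_cmul (k * \<tau>) (component_mult C' c b a (twist \<epsilon> \<delta> c b unit_ext) (twist \<epsilon> \<delta> b a unit_ext))"
      using \<tau>(1) by (auto simp: twist_unit k(2) \<tau>(2))
  next
    fix x y i assume x: "x \<in> exterior_algebra (glue c b)" and y: "y \<in> exterior_algebra (glue b a)" and i: "i \<in> {1..2 * n}"
    have i': "1 \<le> i" "i \<le> 2 * n" using i by auto
    show "twist \<epsilon> \<delta> c a (component_mult C c b a (iota (cb i) x) y) =
        frag_cmul ((- 1) ^ s) (twist_generator \<epsilon> \<delta> ca i (twist \<epsilon> \<delta> c a (component_mult C c b a x y)))"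
      unfolding mult_iota_left[OF C s x y i] lin_cmul[OF lin_twist]
      using twist_iota[OF cba(1,3) mult_closed[OF C x y] i] by simp
    show "frag_cmul (k * \<tau>) (component_mult C' c b a (twist \<epsilon> \<delta> c b (iota (cb i) x)) (twist \<epsilon> \<delta> b a y)) =
        frag_cmul ((- 1) ^ s) (twist_generator \<epsilon> \<delta> ca i
          (frag_cmul (k * \<tau>) (component_mult C' c b a (twist \<epsilon> \<delta> c b x) (twist \<epsilon> \<delta> b a y))))"
      unfolding twist_iota[OF cba(1,2) x i] lin_cmul[OF degree_one_lin[OF tg_degree_one[OF cba(1,3) i]]]
      using mult_twist_generator_left[OF C' s twist_closed[OF cba(1,2) x] twist_closed[OF cba(2,3) y] i']
      by (simp add: mult.commute)
  next
    fix y i assume y: "y \<in> exterior_algebra (glue b a)" and i: "i \<in> {1..2 * n}"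
    have i': "1 \<le> i" "i \<le> 2 * n" using i by auto
    show "twist \<epsilon> \<delta> c a (component_mult C c b a unit_ext (iota (ba i) y)) =
        frag_cmul ((- 1) ^ s) (twist_generator \<epsilon> \<delta> ca i (twist \<epsilon> \<delta> c a (component_mult C c b a unit_ext y)))"
      unfolding mult_iota_right[OF C s y i] lin_cmul[OF lin_twist]
      using twist_iota[OF cba(1,3) mult_closed[OF C _ y] i] by simp
    show "frag_cmul (k * \<tau>) (component_mult C' c b a (twist \<epsilon> \<delta> c b unit_ext) (twist \<epsilon> \<delta> b a (iota (ba i) y))) =
        frag_cmul ((- 1) ^ s) (twist_generator \<epsilon> \<delta> ca i
          (frag_cmul (k * \<tau>) (component_mult C' c b a (twist \<epsilon> \<delta> c b unit_ext) (twist \<epsilon> \<delta> b a y))))"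
      unfolding twist_iota[OF cba(2,3) y i] lin_cmul[OF degree_one_lin[OF tg_degree_one[OF cba(1,3) i]]] twist_unit
      using mult_twist_generator_right[OF C' s twist_closed[OF cba(2,3) y] i']
      by (simp add: mult.commute)
  qed
  then show ?thesis using k(1) \<tau>(1) by (intro exI[of _ "k * \<tau>"]) auto
qed

text \<open>Every arc of \<open>b\<close> stays on one circle or joins the circles through
  \<open>p\<close> and \<open>Suc p\<close>, so their difference is a nonzero multiple of the
  product of the units. By the definition of the twist this difference is scaled by
  \<open>\<epsilon> * \<delta> ^ p\<close>.\<close>

lemma twist_elementary:
  assumes cb: "c \<in> cm n" "b \<in> cm n" and C: "admissible_rule n C c b c" and g: "Suc (cg c b) = n"
    and p: "1 \<le> p" "Suc p \<le> 2 * n" and ne: "circle_of (c \<union> c) p \<noteq> circle_of (c \<union> c) (Suc p)"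
    and b: "\<And>i j. {i, j} \<in> b \<Longrightarrow> circle_of (c \<union> c) i = circle_of (c \<union> c) j \<or>
      {circle_of (c \<union> c) i, circle_of (c \<union> c) j} = {circle_of (c \<union> c) p, circle_of (c \<union> c) (Suc p)}"
  shows "component_mult C c b c unit_ext unit_ext \<noteq> 0"
    "twist \<epsilon> \<delta> c c (component_mult C c b c unit_ext unit_ext) = frag_cmul (\<epsilon> * \<delta> ^ p) (component_mult C c b c unit_ext unit_ext)"
proof -
  interpret three_matchings n c b c by (rule cm_three[OF cb cb(1)])
  let ?U = "component_mult C c b c unit_ext unit_ext"
  have s: "card (glue c c) + n = card (glue c b) + card (glue b c) + 2 * 1"
    using g cg_self[OF cb(1)] by (simp add: glue_commute[of b c])
  show nz: "?U \<noteq> 0"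
    using s g cg_self[OF cb(1)] by (intro mult_unit_one_split[OF C]) (simp_all add: glue_commute[of b c])
  let ?p = "ca p" and ?q = "ca (Suc p)"
  have pq: "p \<in> {1..2 * n}" "Suc p \<in> {1..2 * n}" using p by auto
  have S: "?p \<in> glue c c" "?q \<in> glue c c" using pq unfolding glue_circles by blast+
  let ?\<eta> = "iota ?q unit_ext - iota ?p unit_ext"
  have \<eta>: "?\<eta> \<in> exterior_algebra (glue c c)" using S by (intro exterior_algebra_diff exterior_algebra_iota) simp_all
  have hom: "homogeneous 1 ?\<eta>"
    unfolding homogeneous_def
  proof (intro allI impI)
    fix A assume "Poly_Mapping.lookup ?\<eta> A \<noteq> 0"
    then have "A = {?p} \<or> A = {?q}"
      by (auto simp: lookup_minus lookup_iota unit_ext_def split: if_splits)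
    then show "card A = 1" by auto
  qed
  have "Min ?p \<noteq> Min ?q" using keyed_glue(3) S ne by (meson inj_onD keyed_def)
  moreover have "finite (glue c c)" using keyed_glue(3) by (simp add: keyed_def)
  ultimately have ac: "iota ?p (iota ?q unit_ext) = - iota ?q (iota ?p unit_ext)"
    by (intro iota_anticomm[OF exterior_algebra_unit])
  have pqk: "iota ?p ?\<eta> = iota ?q ?\<eta>"
    unfolding lin_diff[OF lin_iota] iota_iota ac by simp
  have killed: "iota (ca i) ?\<eta> = iota (ca j) ?\<eta>" if "{i, j} \<in> b" for i j
    using b[OF that] pqk by (auto simp: doubleton_eq_iff)
  obtain k where k: "?\<eta> = frag_cmul k ?U"
    by (rule mult_unit_generates[OF C s nz \<eta> hom killed])
  have "Poly_Mapping.lookup ?\<eta> {?p} \<noteq> 0"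
    using ne by (simp add: lookup_minus lookup_iota unit_ext_def)
  then have "k \<noteq> 0" using k by auto
  have U: "unit_ext \<in> exterior_algebra (glue c c)" by simp
  have "twist \<epsilon> \<delta> c c ?\<eta> = frag_cmul (\<epsilon> * \<delta> ^ p) ?\<eta>"
    unfolding lin_diff[OF lin_twist] twist_iota[OF cb(1,1) U pq(1)] twist_iota[OF cb(1,1) U pq(2)] twist_unit
      twist_generator_Suc[OF p(1)] by simp
  then have "frag_cmul k (twist \<epsilon> \<delta> c c ?U) = frag_cmul k (frag_cmul (\<epsilon> * \<delta> ^ p) ?U)"
    unfolding k lin_cmul[OF lin_twist] by (simp add: mult.commute)
  then have "k * Poly_Mapping.lookup (twist \<epsilon> \<delta> c c ?U) A = k * Poly_Mapping.lookup (frag_cmul (\<epsilon> * \<delta> ^ p) ?U) A" for A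
    by (metis lookup_frag_cmul)
  then show "twist \<epsilon> \<delta> c c ?U = frag_cmul (\<epsilon> * \<delta> ^ p) ?U"
    using \<open>k \<noteq> 0\<close> by (intro poly_mapping_eqI) simp
qed

end

section \<open>The isomorphism\<close>

lemma surgeries_zero: "surgeries c b a R T ps 0 = 0"
proof (induction ps arbitrary: T)
  case (Cons p ps)
  have "surgery c b a T i j 0 = 0" for i j
    unfolding surgery_def Let_def by (simp add: lin_zero[OF lin_exterior_map] lin_zero[OF lin_wedge_right])
  then show ?case using Cons by (simp add: split_beta)
qed simp

lemma component_mult_0 [simp]: "component_mult C c b a 0 y = 0" "component_mult C c b a x 0 = 0"
  by (simp_all add: component_mult_def lin_zero[OF lin_exterior_map] lin_zero[OF lin_wedge_left]
      lin_zero[OF lin_wedge_right] surgeries_zero)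

section \<open>Elements of one component, and the associator at units\<close>

definition comp_el :: "matching \<Rightarrow> matching \<Rightarrow> exterior \<Rightarrow> oh" where
  "comp_el b a z = (\<lambda>b' a'. if b' = b \<and> a' = a then z else 0)"

lemma comp_el_mult:
  assumes "c \<in> cm n"
  shows "comp_el d c x \<otimes>\<^bsub>OH n C\<^esub> comp_el c b y = comp_el d b (component_mult C d c b x y)"
proof (intro ext)
  fix c' a'
  have "component_mult C c' b' a' (comp_el d c x c' b') (comp_el c b y b' a') =
      (if b' = c then (if c' = d \<and> a' = b then component_mult C d c b x y else 0) else 0)" for b'
    by (auto simp: comp_el_def)
  then show "(comp_el d c x \<otimes>\<^bsub>OH n C\<^esub> comp_el c b y) c' a' = comp_el d b (component_mult C d c b x y) c' a'"
    using assms finite_cm by (simp add: OH_def comp_el_def)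
qed

lemma comp_el_unit:
  assumes "b \<in> cm n" "a \<in> cm n"
  shows "comp_el b a unit_ext \<in> OH_component n b a \<inter> OH_degree n (int n - int (cg b a))"
  using assms by (auto simp: OH_component_def OH_degree_def OH_carrier_def comp_el_def unit_ext_def monomial_degree_def)

text \<open>Units are homogeneous with bidegrees independent of the rule, so the same value of
  \<open>\<phi>\<close> appears for both rules and cancels in their quotient.\<close>

lemma associator_unit:
  assumes \<phi>: "is_associator n C \<phi>" and cm: "d \<in> cm n" "c \<in> cm n" "b \<in> cm n" "a \<in> cm n"
  shows "component_mult C d b a (component_mult C d c b unit_ext unit_ext) unit_ext =
    frag_cmul (\<phi> (int n - int (cg d c), d, c) (int n - int (cg c b), c, b) (int n - int (cg b a), b, a))
      (component_mult C d c a unit_ext (component_mult C c b a unit_ext unit_ext))" (is "?l = frag_cmul ?\<phi> ?r")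
proof -
  have "(comp_el d c unit_ext \<otimes>\<^bsub>OH n C\<^esub> comp_el c b unit_ext) \<otimes>\<^bsub>OH n C\<^esub> comp_el b a unit_ext =
    (\<lambda>b' a'. frag_cmul ?\<phi> ((comp_el d c unit_ext \<otimes>\<^bsub>OH n C\<^esub> (comp_el c b unit_ext \<otimes>\<^bsub>OH n C\<^esub> comp_el b a unit_ext)) b' a'))"
    using \<phi> cm comp_el_unit[OF cm(1,2)] comp_el_unit[OF cm(2,3)] comp_el_unit[OF cm(3,4)]
    unfolding is_associator_def by blast
  then have "comp_el d a ?l = (\<lambda>b' a'. frag_cmul ?\<phi> (comp_el d a ?r b' a'))"
    by (simp only: comp_el_mult[OF cm(2)] comp_el_mult[OF cm(3)])
  from fun_cong[OF fun_cong[OF this, of d], of a] show ?thesis by (simp add: comp_el_def)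
qed

definition twist_ring :: "int \<Rightarrow> int \<Rightarrow> oh \<Rightarrow> oh" where
  "twist_ring \<epsilon> \<delta> x = (\<lambda>b a. twist \<epsilon> \<delta> b a (x b a))"

lemma OH_carrier_component: "x \<in> OH_carrier n \<Longrightarrow> b \<in> cm n \<Longrightarrow> a \<in> cm n \<Longrightarrow> x b a \<in> exterior_algebra (glue b a)"
  by (simp add: OH_carrier_def)

lemma OH_carrier_outside: "x \<in> OH_carrier n \<Longrightarrow> \<not> (b \<in> cm n \<and> a \<in> cm n) \<Longrightarrow> x b a = 0"
  unfolding OH_carrier_def by (metis (mono_tags, lifting) mem_Collect_eq)

context twisted
begin

lemma twist_zero: "twist \<epsilon> \<delta> b a 0 = 0" by (rule lin_zero[OF lin_twist])

lemma twist_ring_carrier: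
  assumes x: "x \<in> OH_carrier n" shows "twist_ring \<epsilon> \<delta> x \<in> OH_carrier n"
proof -
  have "if b \<in> cm n \<and> a \<in> cm n then twist_ring \<epsilon> \<delta> x b a \<in> exterior_algebra (glue b a) else twist_ring \<epsilon> \<delta> x b a = 0" for b a
    using OH_carrier_component[OF x] OH_carrier_outside[OF x] by (simp add: twist_ring_def twist_closed twist_zero)
  then show ?thesis unfolding OH_carrier_def by blast
qed

lemma twist_ring_involution:
  assumes x: "x \<in> OH_carrier n" shows "twist_ring \<epsilon> \<delta> (twist_ring \<epsilon> \<delta> x) = x"
proof (intro ext)
  fix b a
  show "twist_ring \<epsilon> \<delta> (twist_ring \<epsilon> \<delta> x) b a = x b a"
  proof (cases "b \<in> cm n \<and> a \<in> cm n")
    case True then show ?thesis using twist_twist OH_carrier_component[OF x] by (simp add: twist_ring_def)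
  next
    case False then show ?thesis using OH_carrier_outside[OF x] by (simp add: twist_ring_def twist_zero)
  qed
qed

lemma twist_ring_degree: "x \<in> OH_degree n k \<Longrightarrow> twist_ring \<epsilon> \<delta> x \<in> OH_degree n k"
proof -
  assume x: "x \<in> OH_degree n k"
  then have c: "x \<in> OH_carrier n" by (simp add: OH_degree_def)
  have "monomial_degree n b a A = k" if A: "A \<in> Poly_Mapping.keys (twist \<epsilon> \<delta> b a (x b a))" for b a A
  proof (cases "b \<in> cm n \<and> a \<in> cm n")
    case True
    then have "x b a \<in> exterior_algebra (glue b a)" using OH_carrier_component[OF c] by blast
    then obtain B where "B \<in> Poly_Mapping.keys (x b a)" "card A = card B" using twist_keys True A by blast
    then show ?thesis using x by (simp add: OH_degree_def monomial_degree_def)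
  next
    case False
    then have "x b a = 0" by (rule OH_carrier_outside[OF c])
    then show ?thesis using A by (simp add: twist_zero)
  qed
  then show ?thesis using twist_ring_carrier[OF c] by (simp add: OH_degree_def twist_ring_def)
qed

lemma twist_ring_iso:
  assumes mult: "\<And>c b a x y. c \<in> cm n \<Longrightarrow> b \<in> cm n \<Longrightarrow> a \<in> cm n \<Longrightarrow>
      x \<in> exterior_algebra (glue c b) \<Longrightarrow> y \<in> exterior_algebra (glue b a) \<Longrightarrow>
      twist \<epsilon> \<delta> c a (component_mult C c b a x y) = component_mult C' c b a (twist \<epsilon> \<delta> c b x) (twist \<epsilon> \<delta> b a y)"
  shows "twist_ring \<epsilon> \<delta> \<in> graded_ring_iso n C C'"
proof -
  let ?h = "twist_ring \<epsilon> \<delta>"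
  have car: "carrier (OH n C) = OH_carrier n" "carrier (OH n C') = OH_carrier n" by (simp_all add: OH_def)
  have m: "?h (x \<otimes>\<^bsub>OH n C\<^esub> y) = ?h x \<otimes>\<^bsub>OH n C'\<^esub> ?h y" if x: "x \<in> OH_carrier n" and y: "y \<in> OH_carrier n" for x y
  proof (intro ext)
    fix c a
    show "?h (x \<otimes>\<^bsub>OH n C\<^esub> y) c a = (?h x \<otimes>\<^bsub>OH n C'\<^esub> ?h y) c a"
    proof (cases "c \<in> cm n \<and> a \<in> cm n")
      case True
      have "twist \<epsilon> \<delta> c a (component_mult C c b a (x c b) (y b a)) =
          component_mult C' c b a (twist \<epsilon> \<delta> c b (x c b)) (twist \<epsilon> \<delta> b a (y b a))" if "b \<in> cm n" for b
        using mult True that OH_carrier_component[OF x] OH_carrier_component[OF y] by blast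
      then show ?thesis by (simp add: OH_def twist_ring_def lin_sum[OF lin_twist])
    next
      case False
      then have "x c b = 0 \<or> y b a = 0" for b using OH_carrier_outside[OF x] OH_carrier_outside[OF y] by blast
      then have "component_mult C c b a (x c b) (y b a) = 0"
        "component_mult C' c b a (twist \<epsilon> \<delta> c b (x c b)) (twist \<epsilon> \<delta> b a (y b a)) = 0" for b
        by (metis component_mult_0 twist_zero)+
      then show ?thesis by (simp add: OH_def twist_ring_def twist_zero)
    qed
  qed
  have "bij_betw ?h (OH_carrier n) (OH_carrier n)"
    by (rule bij_betw_byWitness[where f' = ?h]) (auto simp: twist_ring_involution twist_ring_carrier)
  moreover have "?h \<in> ring_hom (OH n C) (OH n C')"
  proof (rule ring_hom_memI; (unfold car)?)
    show "?h x \<in> OH_carrier n" if "x \<in> OH_carrier n" for x using twist_ring_carrier[OF that] .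
    show "?h (x \<otimes>\<^bsub>OH n C\<^esub> y) = ?h x \<otimes>\<^bsub>OH n C'\<^esub> ?h y" if "x \<in> OH_carrier n" "y \<in> OH_carrier n" for x y
      by (rule m[OF that])
    show "?h (x \<oplus>\<^bsub>OH n C\<^esub> y) = ?h x \<oplus>\<^bsub>OH n C'\<^esub> ?h y" if "x \<in> OH_carrier n" "y \<in> OH_carrier n" for x y
      by (simp add: OH_def twist_ring_def lin_add[OF lin_twist])
    show "?h \<one>\<^bsub>OH n C\<^esub> = \<one>\<^bsub>OH n C'\<^esub>"
      using twist_unit by (auto simp: OH_def twist_ring_def twist_zero unit_ext_def intro!: ext)
  qed
  moreover have "?h ` OH_degree n k = OH_degree n k" for k
  proof
    show "?h ` OH_degree n k \<subseteq> OH_degree n k" using twist_ring_degree by blast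
    show "OH_degree n k \<subseteq> ?h ` OH_degree n k"
    proof
      fix x assume x: "x \<in> OH_degree n k"
      then have "x = ?h (?h x)" using twist_ring_involution by (simp add: OH_degree_def)
      then show "x \<in> ?h ` OH_degree n k" using twist_ring_degree[OF x] by blast
    qed
  qed
  ultimately show ?thesis by (simp add: graded_ring_iso_def ring_iso_def car)
qed

end

theorem theorem3:
  fixes n :: nat and C C' :: rule
  assumes "C \<in> multiplication_rules n"
    and "C' \<in> multiplication_rules n"
    and "\<exists>\<phi>. is_associator n C \<phi> \<and> is_associator n C' \<phi>"
  shows "graded_ring_iso n C C' \<noteq> {}"
proof -
  obtain \<phi> where \<phi>: "is_associator n C \<phi>" "is_associator n C' \<phi>" using assms(3) by blast
  note C = rule_admissible[OF assms(1)] and C' = rule_admissible[OF assms(2)]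
  define w t where "w = std n" and "t = tau n 0 1"
  \<comment> \<open>The ratio of the two rules on a move. For \<open>n < 2\<close> there are no
    moves and any sign will do.\<close>
  have "\<exists>\<tau>. (\<tau> = 1 \<or> \<tau> = (-1 :: int)) \<and> (2 \<le> n \<longrightarrow> component_mult C' c b c unit_ext unit_ext =
      frag_cmul \<tau> (component_mult C c b c unit_ext unit_ext))" if "2 \<le> n \<Longrightarrow> c \<in> cm n \<and> b \<in> cm n" for c b
  proof (cases "2 \<le> n")
    case True
    then have cb: "c \<in> cm n" "b \<in> cm n" using that by auto
    then show ?thesis
      using three_matchings.mult_sign[OF cm_three[OF cb cb(1)] C[OF cb cb(1)] C'[OF cb cb(1)]] exterior_algebra_unit by metis
  qed auto
  moreover have wt: "w \<in> cm n" "2 \<le> n \<Longrightarrow> t \<in> cm n" "2 \<le> n \<Longrightarrow> Suc (cg w t) = n"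
    using std_cm tau_facts[of 0 1 n] by (simp_all add: w_def t_def)
  ultimately obtain \<tau>1 \<tau>2 :: int where \<tau>: "\<tau>1 = 1 \<or> \<tau>1 = -1" "\<tau>2 = 1 \<or> \<tau>2 = -1"
    "2 \<le> n \<Longrightarrow> component_mult C' w t w unit_ext unit_ext = frag_cmul \<tau>1 (component_mult C w t w unit_ext unit_ext)"
    "2 \<le> n \<Longrightarrow> component_mult C' t w t unit_ext unit_ext = frag_cmul \<tau>2 (component_mult C t w t unit_ext unit_ext)"
    by metis
  \<comment> \<open>The product on \<open>(w, t, w)\<close> is a multiple of the difference across
    the points 2 and 3, with twist factor \<open>\<epsilon> * \<delta> ^ 2 = \<epsilon>\<close>; on
    \<open>(t, w, t)\<close> the points are 1 and 2, with factor
    \<open>\<epsilon> * \<delta>\<close>. These have to be \<open>\<tau>1\<close> and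
    \<open>\<tau>2\<close>.\<close>
  define \<epsilon> \<delta> where "\<epsilon> = \<tau>1" and "\<delta> = \<tau>1 * \<tau>2"
  interpret twisted n \<epsilon> \<delta> by unfold_locales (use \<tau>(1,2) in \<open>auto simp: \<epsilon>_def \<delta>_def\<close>)
  define P where "P c b a \<rho> \<longleftrightarrow> (\<rho> = 1 \<or> \<rho> = (-1 :: int)) \<and> (\<forall>x\<in>exterior_algebra (glue c b). \<forall>y\<in>exterior_algebra (glue b a).
      twist \<epsilon> \<delta> c a (component_mult C c b a x y) =
      frag_cmul \<rho> (component_mult C' c b a (twist \<epsilon> \<delta> c b x) (twist \<epsilon> \<delta> b a y)))" for c b a \<rho>
  \<comment> \<open>Where the products vanish both signs satisfy \<open>P\<close>, so one of them is
    chosen.\<close>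
  define \<rho> where "\<rho> c b a = (SOME r. P c b a r)" for c b a
  have P: "P c b a (\<rho> c b a)" if "c \<in> cm n" "b \<in> cm n" "a \<in> cm n" for c b a
    using twisted_product[OF that C[OF that] C'[OF that], folded P_def] unfolding \<rho>_def by (rule someI_ex)
  let ?U = "\<lambda>c b a. component_mult C c b a unit_ext unit_ext" and ?U' = "\<lambda>c b a. component_mult C' c b a unit_ext unit_ext"
  have \<rho>1: "\<rho> c b a = 1 \<or> \<rho> c b a = -1" if "c \<in> cm n" "b \<in> cm n" "a \<in> cm n" for c b a
    using P[OF that] by (simp add: P_def)
  have tw: "twist \<epsilon> \<delta> c a (component_mult C c b a x y) =
      frag_cmul (\<rho> c b a) (component_mult C' c b a (twist \<epsilon> \<delta> c b x) (twist \<epsilon> \<delta> b a y))"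
    if "c \<in> cm n" "b \<in> cm n" "a \<in> cm n" "x \<in> exterior_algebra (glue c b)" "y \<in> exterior_algebra (glue b a)" for c b a x y
    using P[OF that(1-3)] that(4,5) by (simp add: P_def)
  have closed: "?U c b a \<in> exterior_algebra (glue c a)" if "c \<in> cm n" "b \<in> cm n" "a \<in> cm n" for c b a
    using three_matchings.mult_closed[OF cm_three[OF that] C[OF that]] by simp
  have twU: "twist \<epsilon> \<delta> c a (?U c b a) = frag_cmul (\<rho> c b a) (?U' c b a)" if "c \<in> cm n" "b \<in> cm n" "a \<in> cm n" for c b a
    using tw[OF that exterior_algebra_unit exterior_algebra_unit] by (simp add: twist_unit)
  have cancel: "r = (1 :: int)" if "z = frag_cmul r z" "z \<noteq> 0" for r and z :: exterior
  proof -
    obtain A where A: "Poly_Mapping.lookup z A \<noteq> 0" using \<open>z \<noteq> 0\<close> by (metis lookup_zero poly_mapping_eqI)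
    have "Poly_Mapping.lookup z A = r * Poly_Mapping.lookup z A" by (metis lookup_frag_cmul that(1))
    then show ?thesis using A by (metis mult_cancel_right1)
  qed
  \<comment> \<open>Twisting both bracketings of three units and using the associator for each rule
    gives two expressions with the same \<open>\<phi>\<close>; a nonzero coefficient allows the
    remaining signs to be compared.\<close>
  have cocycle: "\<rho> d c b * \<rho> d b a = \<rho> d c a * \<rho> c b a"
    "component_mult C d c a unit_ext (?U c b a) \<noteq> 0"
    if cm: "d \<in> cm n" "c \<in> cm n" "b \<in> cm n" "a \<in> cm n" and nz: "component_mult C d b a (?U d c b) unit_ext \<noteq> 0" for d c b a
  proof -
    define f where "f = \<phi> (int n - int (cg d c), d, c) (int n - int (cg c b), c, b) (int n - int (cg b a), b, a)"
    define l r l' r' where "l = component_mult C d b a (?U d c b) unit_ext" and "r = component_mult C d c a unit_ext (?U c b a)"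
      and "l' = component_mult C' d b a (?U' d c b) unit_ext" and "r' = component_mult C' d c a unit_ext (?U' c b a)"
    have lr: "l = frag_cmul f r" "l' = frag_cmul f r'"
      unfolding l_def r_def l'_def r'_def f_def
      by (rule associator_unit[OF \<phi>(1) cm] associator_unit[OF \<phi>(2) cm])+
    note dba = cm(1,3,4) and dca = cm(1,2,4) and dcb = cm(1,2,3) and cba = cm(2,3,4)
    have l: "twist \<epsilon> \<delta> d a l = frag_cmul (\<rho> d b a * \<rho> d c b) l'"
      unfolding l_def l'_def tw[OF dba closed[OF dcb] exterior_algebra_unit] twU[OF dcb] twist_unit
      using lin_cmul[OF three_matchings.lin_mult_left[OF cm_three[OF dba]]] by simp
    have r: "twist \<epsilon> \<delta> d a r = frag_cmul (\<rho> d c a * \<rho> c b a) r'"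
      unfolding r_def r'_def tw[OF dca exterior_algebra_unit closed[OF cba]] twU[OF cba] twist_unit
      using lin_cmul[OF three_matchings.lin_mult_right[OF cm_three[OF dca]]] by simp
    have l0: "l \<noteq> 0" using nz by (simp add: l_def)
    have "l \<in> exterior_algebra (glue d a)"
      unfolding l_def by (rule three_matchings.mult_closed[OF cm_three[OF dba] C[OF dba] closed[OF dcb] exterior_algebra_unit])
    then have "twist \<epsilon> \<delta> d a l \<noteq> 0" using twist_twist[OF cm(1,4)] l0 twist_zero by metis
    then have l'0: "l' \<noteq> 0" using l by auto
    have "twist \<epsilon> \<delta> d a l = frag_cmul f (twist \<epsilon> \<delta> d a r)" unfolding lr(1) by (rule lin_cmul[OF lin_twist])
    also have "\<dots> = frag_cmul (\<rho> d c a * \<rho> c b a) l'" unfolding r lr(2) by (simp add: mult.commute)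
    finally have eq: "frag_cmul (\<rho> d b a * \<rho> d c b) l' = frag_cmul (\<rho> d c a * \<rho> c b a) l'" unfolding l .
    have signs: "\<rho> d b a = 1 \<or> \<rho> d b a = -1" "\<rho> d c b = 1 \<or> \<rho> d c b = -1"
      using \<rho>1[OF dba] \<rho>1[OF dcb] by auto
    obtain A where A: "Poly_Mapping.lookup l' A \<noteq> 0" using l'0 by (metis lookup_zero poly_mapping_eqI)
    have "(\<rho> d b a * \<rho> d c b) * Poly_Mapping.lookup l' A = (\<rho> d c a * \<rho> c b a) * Poly_Mapping.lookup l' A"
      using arg_cong[OF eq, of "\<lambda>z. Poly_Mapping.lookup z A"] by simp
    then show "\<rho> d c b * \<rho> d b a = \<rho> d c a * \<rho> c b a" using A by (simp add: mult.commute)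
    show "component_mult C d c a unit_ext (?U c b a) \<noteq> 0" using l0 lr(1) by (auto simp: r_def)
  qed
  have phi1: "\<phi> u v x \<noteq> 0" for u v x
  proof -
    have "\<phi> u v x \<in> {-1, 1}" using \<phi>(1) unfolding is_associator_def by blast
    then show ?thesis by auto
  qed
  have nz_zero: "component_mult C c b a x y = 0"
    if "c \<in> cm n" "b \<in> cm n" "a \<in> cm n" "?U c b a = 0" "x \<in> exterior_algebra (glue c b)" "y \<in> exterior_algebra (glue b a)" for c b a x y
    using three_matchings.mult_zero[OF cm_three[OF that(1-3)] C[OF that(1-3)] that(4-6)] .
  have no_split: "?U c b a = unit_ext" "\<rho> c b a = 1"
    if "c \<in> cm n" "b \<in> cm n" "a \<in> cm n" "cg c a + n = cg c b + cg b a" for c b a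
  proof -
    show u: "?U c b a = unit_ext" by (rule three_matchings.mult_unit_no_split[OF cm_three[OF that(1-3)] C[OF that(1-3)] that(4)])
    have "?U' c b a = unit_ext" by (rule three_matchings.mult_unit_no_split[OF cm_three[OF that(1-3)] C'[OF that(1-3)] that(4)])
    then have "unit_ext = frag_cmul (\<rho> c b a) unit_ext" using twU[OF that(1-3)] u by (simp add: twist_unit)
    then show "\<rho> c b a = 1" by (rule cancel) (simp add: unit_ext_def)
  qed
  \<comment> \<open>If the twist scales the product of units by the very sign that relates the two
    rules, nothing is left for \<open>\<rho>\<close>.\<close>
  have elementary: "\<rho> c b c = 1"
    if "2 \<le> n" and cb: "c \<in> cm n" "b \<in> cm n" and \<tau>: "\<tau> = 1 \<or> \<tau> = -1" "?U' c b c = frag_cmul \<tau> (?U c b c)"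
      and U: "?U c b c \<noteq> 0" "twist \<epsilon> \<delta> c c (?U c b c) = frag_cmul \<tau> (?U c b c)" for c b \<tau>
  proof -
    have "frag_cmul \<tau> (?U c b c) = frag_cmul (\<rho> c b c) (frag_cmul \<tau> (?U c b c))"
      using twU[OF cb cb(1)] unfolding U(2) \<tau>(2) .
    then show ?thesis by (rule cancel) (use \<tau>(1) U(1) in auto)
  qed
  interpret rigid_signs n \<rho> "\<lambda>d b a. ?U d b a \<noteq> 0"
  proof
    fix d b a assume dba: "d \<in> cm n" "b \<in> cm n" "a \<in> cm n"
    show "\<rho> d b a = 1" if "cg d a + n = cg d b + cg b a" by (rule no_split(2)[OF dba that])
    show "?U d b a \<noteq> 0" if "cg d a + n = cg d b + cg b a + 2" "cg b a < cg d a"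
      by (rule three_matchings.mult_unit_one_split[OF cm_three[OF dba] C[OF dba] that])
  next
    fix d c b a assume cm: "d \<in> cm n" "c \<in> cm n" "b \<in> cm n" "a \<in> cm n"
      and s: "cg d b + n = cg d c + cg c b" and nz: "?U d b a \<noteq> 0"
    note ns = no_split[OF cm(1,2,3) s]
    have "component_mult C d b a (?U d c b) unit_ext \<noteq> 0" using nz ns by simp
    note c = cocycle[OF cm this]
    have "?U c b a \<noteq> 0" using c(2) by auto
    then show "?U c b a \<noteq> 0 \<and> \<rho> d b a = \<rho> d c a * \<rho> c b a" using c(1) ns(2) by simp
  next
    fix d c b a assume cm: "d \<in> cm n" "c \<in> cm n" "b \<in> cm n" "a \<in> cm n"
      and s: "cg c a + n = cg c b + cg b a" and nz: "?U d c a \<noteq> 0"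
    note ns = no_split[OF cm(2,3,4) s]
    \<comment> \<open>The nonvanishing is given for the right bracketing; the associator, being a
      sign, carries it to the left one.\<close>
    have l: "component_mult C d b a (?U d c b) unit_ext \<noteq> 0"
      using associator_unit[OF \<phi>(1) cm] nz ns(1) phi1 by simp
    have "?U d b a \<noteq> 0"
      using nz_zero[OF cm(1,3,4) _ closed[OF cm(1,2,3)] exterior_algebra_unit] l by blast
    then show "?U d b a \<noteq> 0 \<and> \<rho> d c b * \<rho> d b a = \<rho> d c a" using cocycle(1)[OF cm l] ns(2) by simp
  next
    assume n: "2 \<le> n"
    note wt' = wt(1) wt(2)[OF n]
    have signs: "\<tau>1 * \<tau>1 = 1" "\<tau>2 * \<tau>2 = 1" using \<tau>(1,2) by auto
    have caps: "cap 0 = {1, 2}" "cap 1 = {3, 4}" by (simp_all add: cap_def numeral_eq_Suc)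
    have w: "cap m \<in> w" if "m < n" for m using cap_in_std[OF that] by (simp add: w_def)
    have ww: "circle_of (w \<union> w) i = cap m" if "m < n" "i \<in> cap m" for m i
      using circle_of_arc[OF wt(1) w[OF that(1)] that(2)] by simp
    have t_eq: "t = w - {cap 0, cap 1} \<union> {{2, 3}, {1, 4}}" by (simp add: t_def w_def tau_eq numeral_eq_Suc)
    have arcs: "{1, 4} \<in> t" "{2, 3} \<in> t" by (auto simp: t_eq)
    have tt: "circle_of (t \<union> t) 1 = {1, 4}" "circle_of (t \<union> t) 4 = {1, 4}" "circle_of (t \<union> t) 2 = {2, 3}" "circle_of (t \<union> t) 3 = {2, 3}"
      using circle_of_arc[OF wt'(2) arcs(1)] circle_of_arc[OF wt'(2) arcs(2)] by simp_all
    have w1: "circle_of (w \<union> w) 1 = cap 0" "circle_of (w \<union> w) 2 = cap 0" "circle_of (w \<union> w) 3 = cap 1" "circle_of (w \<union> w) 4 = cap 1"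
    proof -
      have "1 \<in> cap 0" "2 \<in> cap 0" "3 \<in> cap 1" "4 \<in> cap 1" unfolding caps by simp_all
      moreover have "0 < n" "1 < n" using n by simp_all
      ultimately show "circle_of (w \<union> w) 1 = cap 0" "circle_of (w \<union> w) 2 = cap 0" "circle_of (w \<union> w) 3 = cap 1" "circle_of (w \<union> w) 4 = cap 1"
        using ww by blast+
    qed
    have g: "Suc (cg w t) = n" "Suc (cg t w) = n" using wt(3)[OF n] glue_commute[of t w] by simp_all
    have "\<rho> w t w = 1"
    proof (rule elementary[OF n wt' \<tau>(1) \<tau>(3)[OF n]])
      have b: "circle_of (w \<union> w) i = circle_of (w \<union> w) j \<or>
          {circle_of (w \<union> w) i, circle_of (w \<union> w) j} = {circle_of (w \<union> w) 2, circle_of (w \<union> w) (Suc 2)}"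
        if ij: "{i, j} \<in> t" for i j
      proof (cases "{i, j} \<in> w")
        case True
        then have "circle_of (w \<union> w) i = circle_of (w \<union> w) j" by (intro circle_of_edge) simp
        then show ?thesis ..
      next
        case False
        then have "{i, j} = {2, 3} \<or> {i, j} = {1, 4}" using ij t_eq by blast
        then show ?thesis using w1 by (auto simp: doubleton_eq_iff)
      qed
      \<comment> \<open>The points 2 and 3 belong to different caps of \<open>w\<close>, and the
        arcs of \<open>t\<close> that are not in \<open>w\<close> join these two caps.\<close>
      note te = twist_elementary[OF wt' C[OF wt' wt(1)] g(1), of 2, OF _ _ _ b]
      show "?U w t w \<noteq> 0" using n w1 by (intro te(1)) simp_all
      have "twist \<epsilon> \<delta> w w (?U w t w) = frag_cmul (\<epsilon> * \<delta> ^ 2) (?U w t w)" using n w1 by (intro te(2)) simp_all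
      moreover have "\<epsilon> * \<delta> ^ 2 = \<tau>1" using signs \<delta> by (simp add: \<epsilon>_def power2_eq_square)
      ultimately show "twist \<epsilon> \<delta> w w (?U w t w) = frag_cmul \<tau>1 (?U w t w)" by simp
    qed
    then show "\<rho> (std n) (tau n 0 1) (std n) = 1" by (simp add: w_def t_def)
    have "\<rho> t w t = 1"
    proof (rule elementary[OF n wt'(2,1) \<tau>(2) \<tau>(4)[OF n]])
      have b: "circle_of (t \<union> t) i = circle_of (t \<union> t) j \<or>
          {circle_of (t \<union> t) i, circle_of (t \<union> t) j} = {circle_of (t \<union> t) 1, circle_of (t \<union> t) (Suc 1)}"
        if ij: "{i, j} \<in> w" for i j
      proof (cases "{i, j} \<in> t")
        case True
        then have "circle_of (t \<union> t) i = circle_of (t \<union> t) j" by (intro circle_of_edge) simp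
        then show ?thesis ..
      next
        case False
        then have "{i, j} = cap 0 \<or> {i, j} = cap 1" using ij unfolding t_eq by blast
        then consider "i = 1" "j = 2" | "i = 2" "j = 1" | "i = 3" "j = 4" | "i = 4" "j = 3"
          unfolding caps doubleton_eq_iff by blast
        then show ?thesis by cases (simp_all only: tt Suc_1 insert_commute simp_thms)
      qed
      \<comment> \<open>In \<open>t\<close> the point 1 lies on the outer and 2 on the inner of the
        two nested arcs; the caps 0 and 1 join them.\<close>
      note te = twist_elementary[OF wt'(2,1) C[OF wt'(2,1,2)] g(2), of 1, OF _ _ _ b]
      have ne: "circle_of (t \<union> t) 1 \<noteq> circle_of (t \<union> t) (Suc 1)"
        unfolding Suc_1 tt by (simp add: doubleton_eq_iff)
      show "?U t w t \<noteq> 0" using n ne by (intro te(1)) simp_all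
      have "twist \<epsilon> \<delta> t t (?U t w t) = frag_cmul (\<epsilon> * \<delta> ^ 1) (?U t w t)" using n ne by (intro te(2)) simp_all
      moreover have "\<epsilon> * \<delta> ^ 1 = \<tau>2" using signs by (simp add: \<epsilon>_def \<delta>_def mult.assoc[symmetric])
      ultimately show "twist \<epsilon> \<delta> t t (?U t w t) = frag_cmul \<tau>2 (?U t w t)" by simp
    qed
    then show "\<rho> (tau n 0 1) (std n) (tau n 0 1) = 1" by (simp add: w_def t_def)
  qed
  have "twist_ring \<epsilon> \<delta> \<in> graded_ring_iso n C C'"
  proof (rule twist_ring_iso)
    fix c b a x y
    assume cba: "c \<in> cm n" "b \<in> cm n" "a \<in> cm n"
      and xy: "x \<in> exterior_algebra (glue c b)" "y \<in> exterior_algebra (glue b a)"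
    show "twist \<epsilon> \<delta> c a (component_mult C c b a x y) = component_mult C' c b a (twist \<epsilon> \<delta> c b x) (twist \<epsilon> \<delta> b a y)"
    \<comment> \<open>Rigidity says nothing where the product of units vanishes, but there it
      vanishes for both rules and so do all products of the two components.\<close>
    proof (cases "?U c b a = 0")
      case False
      then have "\<rho> c b a = 1" by (rule signs_trivial[OF cba])
      then show ?thesis using tw[OF cba xy] by simp
    next
      case True
      then have "?U' c b a = 0" using twU[OF cba] \<rho>1[OF cba] by (auto simp: twist_zero)
      then have "component_mult C' c b a (twist \<epsilon> \<delta> c b x) (twist \<epsilon> \<delta> b a y) = 0"
        using three_matchings.mult_zero[OF cm_three[OF cba] C'[OF cba]] twist_closed xy cba by blast
      then show ?thesis using nz_zero[OF cba True xy] by (simp add: twist_zero)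
    qed
  qed
  then show ?thesis by blast
qed

end
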